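(* The satisfiability problem of the strongly uniform two-dimensional fragment $\mathrm{SUF}_2$ of first-order logic (given a formula of $\mathrm{SUF}_2$, is it satisfied in some model?) is $\Pi^0_1$-complete.
   Context: Let $\mathcal{T}=\bigcup_{k\ge 1}\tau_k$ be the complete relational vocabulary, where $\tau_k$ is a countably infinite set of $k$-ary relation symbols; every vocabulary is a subset of $\mathcal{T}$ (no constants, no function symbols). Symbols $y,y_i$ are meta-variables ranging over a countably infinite set of variable symbols; different meta-variables may denote the same variable. An atomic formula is $m$-ary if exactly $m$ distinct variables occur in it; unary means $1$-ary and binary means $2$-ary. A $\tau$-atom is an atomic formula whose relation symbol is in $\tau$. For a finite set $V$ of variables, a $V$-uniform set is a finite set of atomic formulae each of which has exactly $V$ as its set of variables (the empty set is $\emptyset$-uniform). For $\tau\subseteq\mathcal{T}$, the set of $\tau$-formulae of $\mathrm{SUF}_2$ is the smallest set $\mathcal{F}$ such that: (i) every unary or binary $\tau$-atom is in $\mathcal{F}$, and $\top,\bot\in\mathcal{F}$; (ii) if $\varphi\in\mathcal{F}$ then $\neg\varphi\in\mathcal{F}$, and if $\varphi_1,\varphi_2\in\mathcal{F}$ then $(\varphi_1\wedge\varphi_2)\in\mathcal{F}$; (iii) if $y_1,y_2$ are variable symbols, $U$ is a finite set of formulae in $\mathcal{F}$ whose free variables are in $\{y_1,y_2\}$, and $\varphi$ is any Boolean combination of formulae in $U$, then $\exists y_2\,\varphi\in\mathcal{F}$ and $\exists y_1\exists y_2\,\varphi\in\mathcal{F}$; (iv) if $Y=\{y_1,\dots,y_k\}$,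 $k\ge 3$, is a set of variable symbols, $U$ is a finite set of formulae $\psi\in\mathcal{F}$ such that each $\psi$ has at most one free variable and that variable is in $Y$, $F$ is a $V$-uniform set of $\tau$-atoms for some $V\subseteq Y$, and $\varphi$ is any Boolean combination of formulae in $F\cup U$, then $\exists y_3\dots\exists y_k\,\varphi\in\mathcal{F}$, $\exists y_2\dots\exists y_k\,\varphi\in\mathcal{F}$ and $\exists y_1\dots\exists y_k\,\varphi\in\mathcal{F}$. There is no equality symbol. $\mathrm{SUF}_2$ is the set of such formulae for $\tau=\mathcal{T}$. $\Pi^0_1$-completeness is with respect to computable many-one reductions, under a standard encoding of formulae. *)

theory Defs
  imports "HOL-Library.Nat_Bijection" "HOL-Library.Countable_Set"
begin

section \<open>Recursive functions and the class \<open>\<Pi>\<^sup>0\<^sub>1\<close>\<close>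

text \<open>
  The total recursive functions: the least class containing the zero, successor and projection
  functions and closed under composition, primitive recursion and minimisation of regular functions.
  In \<open>recursive n f\<close> only the values of \<open>f\<close> on lists of length \<open>n\<close> are meaningful.
\<close>

inductive recursive :: "nat \<Rightarrow> (nat list \<Rightarrow> nat) \<Rightarrow> bool" where
  zero: "recursive n (\<lambda>xs. 0)"
| succ: "recursive 1 (\<lambda>xs. Suc (xs ! 0))"
| proj: "i < n \<Longrightarrow> recursive n (\<lambda>xs. xs ! i)"
| comp: "\<lbrakk>recursive (length gs) f; \<forall>g\<in>set gs. recursive n g\<rbrakk>
    \<Longrightarrow> recursive n (\<lambda>xs. f (map (\<lambda>g. g xs) gs))"
| primitive_recursion: "\<lbrakk>recursive n f; recursive (Suc (Suc n)) g\<rbrakk>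
    \<Longrightarrow> recursive (Suc n) (\<lambda>xs. rec_nat (f (tl xs)) (\<lambda>k v. g (k # v # tl xs)) (hd xs))"
| minimisation: "\<lbrakk>recursive (Suc n) f; \<forall>xs. length xs = n \<longrightarrow> (\<exists>y. f (y # xs) = 0)\<rbrakk>
    \<Longrightarrow> recursive n (\<lambda>xs. LEAST y. f (y # xs) = 0)"

definition computable :: "(nat \<Rightarrow> nat) \<Rightarrow> bool" where
  "computable f \<longleftrightarrow> (\<exists>g. recursive 1 g \<and> (\<forall>x. f x = g [x]))"

definition decidable_rel :: "(nat \<Rightarrow> nat \<Rightarrow> bool) \<Rightarrow> bool" where
  "decidable_rel R \<longleftrightarrow> (\<exists>g. recursive 2 g \<and> (\<forall>x y. g [x, y] = (if R x y then 1 else 0)))"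

definition Pi01 :: "nat set \<Rightarrow> bool" where
  "Pi01 A \<longleftrightarrow> (\<exists>R. decidable_rel R \<and> A = {x. \<forall>y. R x y})"

definition many_one_reducible :: "nat set \<Rightarrow> nat set \<Rightarrow> bool" (infix \<open>\<le>\<^sub>m\<close> 50) where
  "B \<le>\<^sub>m A \<longleftrightarrow> (\<exists>f. computable f \<and> (\<forall>x. x \<in> B \<longleftrightarrow> f x \<in> A))"

definition Pi01_complete :: "nat set \<Rightarrow> bool" where
  "Pi01_complete A \<longleftrightarrow> Pi01 A \<and> (\<forall>B. Pi01 B \<longrightarrow> B \<le>\<^sub>m A)"


section \<open>Relational first-order logic without equality\<close>

text \<open>
  \<open>Rel k i\<close> is the \<open>i\<close>-th relation symbol of arity \<open>k\<close>; only arities \<open>k \<ge> 1\<close> belong to the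
  complete vocabulary. Variable symbols are natural numbers.
\<close>

datatype rsym = Rel (arity: nat) nat

definition full_vocab :: "rsym set" where
  "full_vocab = {R. arity R \<ge> 1}"

datatype fm =
    Top
  | Bot
  | Atom rsym "nat list"
  | Neg fm
  | Conj fm fm
  | Ex nat fm

abbreviation Exs :: "nat list \<Rightarrow> fm \<Rightarrow> fm" where
  "Exs ys \<phi> \<equiv> foldr Ex ys \<phi>"

fun fv :: "fm \<Rightarrow> nat set" where
  "fv Top = {}"
| "fv Bot = {}"
| "fv (Atom R ys) = set ys"
| "fv (Neg \<phi>) = fv \<phi>"
| "fv (Conj \<phi> \<psi>) = fv \<phi> \<union> fv \<psi>"
| "fv (Ex y \<phi>) = fv \<phi> - {y}"

record 'a struct =
  universe :: "'a set"
  rel :: "rsym \<Rightarrow> 'a list set"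

definition is_structure :: "'a struct \<Rightarrow> bool" where
  "is_structure M \<longleftrightarrow> universe M \<noteq> {} \<and>
     (\<forall>R\<in>full_vocab. rel M R \<subseteq> {as. length as = arity R \<and> set as \<subseteq> universe M})"

fun holds :: "'a struct \<Rightarrow> (nat \<Rightarrow> 'a) \<Rightarrow> fm \<Rightarrow> bool" where
  "holds M s Top \<longleftrightarrow> True"
| "holds M s Bot \<longleftrightarrow> False"
| "holds M s (Atom R ys) \<longleftrightarrow> map s ys \<in> rel M R"
| "holds M s (Neg \<phi>) \<longleftrightarrow> \<not> holds M s \<phi>"
| "holds M s (Conj \<phi> \<psi>) \<longleftrightarrow> holds M s \<phi> \<and> holds M s \<psi>"
| "holds M s (Ex y \<phi>) \<longleftrightarrow> (\<exists>d\<in>universe M. holds M (s(y := d)) \<phi>)"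

text \<open>
  HOL cannot quantify over the type that a model lives in, so the type is a parameter. By
  \<open>satisfiable_transfer\<close> below, a formula satisfiable over some type is satisfiable over
  every infinite type.
\<close>

definition satisfiable :: "'a itself \<Rightarrow> fm \<Rightarrow> bool" where
  "satisfiable u \<phi> \<longleftrightarrow>
     (\<exists>(M :: 'a struct) s. is_structure M \<and> range s \<subseteq> universe M \<and> holds M s \<phi>)"


section \<open>The fragment \<open>SUF\<^sub>2\<close>\<close>

definition atoms :: "rsym set \<Rightarrow> fm set" where
  "atoms \<tau> = {Atom R ys | R ys. R \<in> \<tau> \<and> length ys = arity R}"

definition uniform :: "nat set \<Rightarrow> fm set \<Rightarrow> bool" where
  "uniform V F \<longleftrightarrow> finite F \<and> F \<subseteq> atoms full_vocab \<and> (\<forall>\<alpha>\<in>F. fv \<alpha> = V)"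

inductive_set bool_comb :: "fm set \<Rightarrow> fm set" for U :: "fm set" where
  base: "\<psi> \<in> U \<Longrightarrow> \<psi> \<in> bool_comb U"
| Neg: "\<phi> \<in> bool_comb U \<Longrightarrow> Neg \<phi> \<in> bool_comb U"
| Conj: "\<lbrakk>\<phi> \<in> bool_comb U; \<psi> \<in> bool_comb U\<rbrakk> \<Longrightarrow> Conj \<phi> \<psi> \<in> bool_comb U"

text \<open>
  A list \<open>ys\<close> enumerates the variables \<open>y\<^sub>1, \<dots>, y\<^sub>k\<close>, so that \<open>drop 2 ys\<close> and \<open>drop 1 ys\<close> are
  \<open>y\<^sub>3, \<dots>, y\<^sub>k\<close> and \<open>y\<^sub>2, \<dots>, y\<^sub>k\<close>. Different \<open>y\<^sub>i\<close> may denote the same variable.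
\<close>

inductive_set suf2_over :: "rsym set \<Rightarrow> fm set" for \<tau> :: "rsym set" where
  atom: "\<lbrakk>\<alpha> \<in> atoms \<tau>; card (fv \<alpha>) = 1 \<or> card (fv \<alpha>) = 2\<rbrakk> \<Longrightarrow> \<alpha> \<in> suf2_over \<tau>"
| Top: "Top \<in> suf2_over \<tau>"
| Bot: "Bot \<in> suf2_over \<tau>"
| Neg: "\<phi> \<in> suf2_over \<tau> \<Longrightarrow> Neg \<phi> \<in> suf2_over \<tau>"
| Conj: "\<lbrakk>\<phi> \<in> suf2_over \<tau>; \<psi> \<in> suf2_over \<tau>\<rbrakk> \<Longrightarrow> Conj \<phi> \<psi> \<in> suf2_over \<tau>"
| two_var_1: "\<lbrakk>finite U; \<forall>\<psi>\<in>U. \<psi> \<in> suf2_over \<tau> \<and> fv \<psi> \<subseteq> {y\<^sub>1, y\<^sub>2}; \<phi> \<in> bool_comb U\<rbrakk>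
    \<Longrightarrow> Ex y\<^sub>2 \<phi> \<in> suf2_over \<tau>"
| two_var_2: "\<lbrakk>finite U; \<forall>\<psi>\<in>U. \<psi> \<in> suf2_over \<tau> \<and> fv \<psi> \<subseteq> {y\<^sub>1, y\<^sub>2}; \<phi> \<in> bool_comb U\<rbrakk>
    \<Longrightarrow> Ex y\<^sub>1 (Ex y\<^sub>2 \<phi>) \<in> suf2_over \<tau>"
| block: "\<lbrakk>length ys \<ge> 3;
      finite U; \<forall>\<psi>\<in>U. \<psi> \<in> suf2_over \<tau> \<and> card (fv \<psi>) \<le> 1 \<and> fv \<psi> \<subseteq> set ys;
      F \<subseteq> atoms \<tau>; uniform V F; V \<subseteq> set ys;
      \<phi> \<in> bool_comb (F \<union> U); j \<in> {0, 1, 2}\<rbrakk>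
    \<Longrightarrow> Exs (drop j ys) \<phi> \<in> suf2_over \<tau>"

definition SUF2 :: "fm set" where
  "SUF2 = suf2_over full_vocab"


section \<open>Encoding of formulae and the satisfiability problem\<close>

fun fm_encode :: "fm \<Rightarrow> nat" where
  "fm_encode Top = prod_encode (0, 0)"
| "fm_encode Bot = prod_encode (1, 0)"
| "fm_encode (Atom R ys) =
     (case R of Rel k i \<Rightarrow> prod_encode (2, prod_encode (prod_encode (k, i), list_encode ys)))"
| "fm_encode (Neg \<phi>) = prod_encode (3, fm_encode \<phi>)"
| "fm_encode (Conj \<phi> \<psi>) = prod_encode (4, prod_encode (fm_encode \<phi>, fm_encode \<psi>))"
| "fm_encode (Ex y \<phi>) = prod_encode (5, prod_encode (y, fm_encode \<phi>))"

lemma inj_fm_encode: "inj fm_encode"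
proof (rule injI)
  fix \<phi> \<psi> show "fm_encode \<phi> = fm_encode \<psi> \<Longrightarrow> \<phi> = \<psi>"
    by (induction \<phi> arbitrary: \<psi>)
      (case_tac \<psi>; auto split: rsym.splits simp: list_encode_eq)+
qed

definition SUF2_SAT :: "'a itself \<Rightarrow> nat set" where
  "SUF2_SAT u = fm_encode ` {\<phi> \<in> SUF2. satisfiable u \<phi>}"


section \<open>Independence of the universe type\<close>

instance rsym :: countable by countable_datatype
instance fm :: countable by countable_datatype

text \<open>
  Downward Loewenheim-Skolem: these terms name the assignments obtained from a given one by
  overwriting variables with values already reached or with Skolem witnesses.
\<close>

datatype hull_term = Init | Copy hull_term nat hull_term nat | Skolem hull_term nat fm

instance hull_term :: countable by countable_datatype

primrec hull_val :: "'a struct \<Rightarrow> (nat \<Rightarrow> 'a) \<Rightarrow> hull_term \<Rightarrow> nat \<Rightarrow> 'a" where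
  "hull_val M s Init = s"
| "hull_val M s (Copy e y e' z) = (hull_val M s e)(y := hull_val M s e' z)"
| "hull_val M s (Skolem e y \<phi>) = (hull_val M s e)(y :=
     (if \<exists>d\<in>universe M. holds M ((hull_val M s e)(y := d)) \<phi>
      then SOME d. d \<in> universe M \<and> holds M ((hull_val M s e)(y := d)) \<phi> else s 0))"

lemma hull_val_dom:
  assumes "range s \<subseteq> universe M"
  shows "range (hull_val M s e) \<subseteq> universe M"
proof (induction e)
  case (Skolem e y \<phi>)
  have "(SOME d. d \<in> universe M \<and> holds M ((hull_val M s e)(y := d)) \<phi>) \<in> universe M"
    if "\<exists>d\<in>universe M. holds M ((hull_val M s e)(y := d)) \<phi>"
    using someI_ex[OF that[unfolded Bex_def]] by (rule conjunct1)
  moreover have "s 0 \<in> universe M" using assms by blast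
  ultimately show ?case using Skolem by (auto simp: image_subset_iff)
qed (use assms in \<open>auto simp: image_subset_iff\<close>)

theorem satisfiable_transfer:
  assumes inf: "infinite (UNIV :: 'b set)" and sat: "satisfiable TYPE('a) \<phi>"
  shows "satisfiable TYPE('b) \<phi>"
proof -
  obtain M :: "'a struct" and s where M: "is_structure M" and s: "range s \<subseteq> universe M"
    and \<phi>: "holds M s \<phi>"
    using sat unfolding satisfiable_def by blast
  define D where "D = (\<Union>e. range (hull_val M s e))"
  have D_iff: "a \<in> D \<longleftrightarrow> (\<exists>e z. a = hull_val M s e z)" for a
    unfolding D_def by blast
  have D_sub: "D \<subseteq> universe M"
    using hull_val_dom[OF s] unfolding D_def by blast
  have "countable D" by (simp add: D_def)
  obtain g :: "nat \<Rightarrow> 'b" where g: "inj g"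
    using inf infinite_countable_subset by blast
  define f where "f = g \<circ> to_nat_on D"
  have f: "inj_on f D"
    unfolding f_def using \<open>countable D\<close> g
    by (meson comp_inj_on inj_on_subset inj_on_to_nat_on subset_UNIV)
  define N where "N = \<lparr>universe = f ` D, rel = \<lambda>R. map f ` {as \<in> rel M R. set as \<subseteq> D}\<rparr>"
  have N: "is_structure N"
  proof -
    have "D \<noteq> {}" unfolding D_def by blast
    then show ?thesis
      using M unfolding is_structure_def N_def by (auto 0 3)
  qed
  have "holds M (hull_val M s e) \<psi> \<longleftrightarrow> holds N (f \<circ> hull_val M s e) \<psi>" for e \<psi>
  proof (induction \<psi> arbitrary: e)
    case (Atom R ys)
    let ?as = "map (hull_val M s e) ys"
    have as: "set ?as \<subseteq> D" using D_iff by auto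
    have rel: "rel N R = map f ` {as \<in> rel M R. set as \<subseteq> D}" by (simp add: N_def)
    have "map f ?as \<in> rel N R \<longleftrightarrow> ?as \<in> rel M R"
    proof
      assume "map f ?as \<in> rel N R"
      then obtain bs where bs: "map f ?as = map f bs" "bs \<in> rel M R" "set bs \<subseteq> D"
        unfolding rel by (elim imageE) simp
      have "?as = bs"
      proof (rule map_inj_on[OF bs(1)])
        show "inj_on f (set ?as \<union> set bs)"
          by (rule inj_on_subset[OF f]) (use bs(3) as in simp)
      qed
      then show "?as \<in> rel M R" using bs(2) by (rule ssubst)
    next
      assume "?as \<in> rel M R"
      then show "map f ?as \<in> rel N R"
        unfolding rel by (intro imageI CollectI conjI as)
    qed
    then show ?case by (simp add: comp_def)
  next
    case (Ex y \<psi>)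
    have upd: "f \<circ> t(y := d) = (f \<circ> t)(y := f d)" for t :: "nat \<Rightarrow> 'a" and d by auto
    show ?case
    proof
      assume "holds M (hull_val M s e) (Ex y \<psi>)"
      then have ex: "\<exists>d\<in>universe M. holds M ((hull_val M s e)(y := d)) \<psi>" by simp
      define d where "d = (SOME d. d \<in> universe M \<and> holds M ((hull_val M s e)(y := d)) \<psi>)"
      have d: "hull_val M s (Skolem e y \<psi>) = (hull_val M s e)(y := d)"
        using ex by (simp add: d_def)
      have "holds M ((hull_val M s e)(y := d)) \<psi>"
        using someI_ex[OF ex[unfolded Bex_def]] unfolding d_def by (rule conjunct2)
      then have "holds N ((f \<circ> hull_val M s e)(y := f d)) \<psi>"
        using Ex[of "Skolem e y \<psi>"] unfolding d upd by blast
      moreover have "d = hull_val M s (Skolem e y \<psi>) y"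
        unfolding d by (rule fun_upd_same[symmetric])
      then have "d \<in> D"
        unfolding D_iff by blast
      moreover have "universe N = f ` D" by (simp add: N_def)
      ultimately show "holds N (f \<circ> hull_val M s e) (Ex y \<psi>)"
        unfolding holds.simps by blast
    next
      assume "holds N (f \<circ> hull_val M s e) (Ex y \<psi>)"
      then have "\<exists>d\<in>f ` D. holds N ((f \<circ> hull_val M s e)(y := d)) \<psi>"
        by (simp only: holds.simps) (simp add: N_def)
      then obtain d where "d \<in> D" and d: "holds N ((f \<circ> hull_val M s e)(y := f d)) \<psi>"
        by blast
      obtain e' z where "d = hull_val M s e' z" using \<open>d \<in> D\<close> D_iff by blast
      then have "holds M ((hull_val M s e)(y := d)) \<psi>"
        using d Ex[of "Copy e y e' z"] unfolding hull_val.simps upd by (simp only:)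
      then show "holds M (hull_val M s e) (Ex y \<psi>)"
        unfolding holds.simps using \<open>d \<in> D\<close> D_sub by blast
    qed
  qed auto
  from this[of Init] have "holds N (f \<circ> s) \<phi>" using \<phi> by simp
  moreover have "range (f \<circ> s) \<subseteq> universe N"
  proof -
    have "s z \<in> D" for z
      unfolding D_iff using hull_val.simps(1)[of M s] by metis
    then show ?thesis by (auto simp: N_def)
  qed
  ultimately show ?thesis using N unfolding satisfiable_def by blast
qed

end

theory Submission
  imports Defs
begin

text \<open>
  Upper bound. A formula is satisfiable iff there is a truth table \<open>W\<close> on pairs of an environment
  and a formula that satisfies countably many local conditions, each of which relates at most three
  entries of \<open>W\<close>: the Tarski clauses for the connectives, and for an existential formula the demand
  that it is true as soon as one instance is, and that its instance at a reserved name is true if it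
  is true itself (a Henkin witness). Natural numbers serve as names. A model yields such a table by
  evaluation, and a table yields a model on the names (\<open>satisfiable_iff_bits\<close>). By compactness of the
  Cantor space (\<open>koenig_bits\<close>) a table exists iff for every \<open>n\<close> some \<open>n\<close>-bit number passes those
  conditions that mention only indices below \<open>n\<close>; for fixed \<open>n\<close> this is decidable by a bounded
  search. Membership in the fragment is decidable because the fragment has an
  equivalent definition by structural recursion (\<open>SUF2_iff_is_suf2\<close>).

  Lower bound. The block rule lets two variables of a uniform matrix remain free. Hence a 9-ary
  predicate can be forced to depend on two chosen positions only and to agree there with a given
  binary predicate (\<open>padded\<close>). Padded atoms all contain the same nine variables, so arbitrary Boolean
  combinations of them are matrices, and every universal Horn clause over binary predicates can
  be written in the fragment even if its binary atoms have different sets of variables. Horn clauses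
  suffice to compute: the clauses for a recursive function hold for its true graph
  (\<open>std_interp_clauses\<close>), and in each of their models with total successor and pairing every true value is derived
  (\<open>ex_represents\<close>).
  Equality is dispensable because numbers and argument lists are only
  represented, possibly by several elements of the model. Given \<open>R x y \<longleftrightarrow> g [x, y] = 1\<close>, the formula
  assigned to \<open>x\<close> contains the clauses for \<open>g\<close> and denies that \<open>g [x, y] = 0\<close> for any \<open>y\<close>; its dependence
  on \<open>x\<close> is a chain of unary predicates that marks the numeral \<open>x\<close>.
\<close>

section \<open>Closure properties of the computable functions\<close>

text \<open>
  Values on lists of the wrong length are immaterial in \<open>recursive\<close>, so closure properties are
  stated up to agreement on lists of the right length.
\<close>

definition recursive_ext :: "nat \<Rightarrow> (nat list \<Rightarrow> nat) \<Rightarrow> bool" where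
  "recursive_ext n h \<longleftrightarrow> (\<exists>g. recursive n g \<and> (\<forall>xs. length xs = n \<longrightarrow> h xs = g xs))"

lemma recursive_ext_cong:
  assumes "recursive_ext n f" "\<And>xs. length xs = n \<Longrightarrow> h xs = f xs"
  shows "recursive_ext n h"
  using assms unfolding recursive_ext_def by metis

lemma recursive_ext_comp:
  assumes "recursive_ext (length hs) f" "\<forall>h\<in>set hs. recursive_ext n h"
  shows "recursive_ext n (\<lambda>xs. f (map (\<lambda>h. h xs) hs))"
proof -
  obtain F where F: "recursive (length hs) F" "\<And>xs. length xs = length hs \<Longrightarrow> f xs = F xs"
    using assms(1) unfolding recursive_ext_def by blast
  obtain G where G: "\<forall>h\<in>set hs. recursive n (G h) \<and> (\<forall>xs. length xs = n \<longrightarrow> h xs = G h xs)"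
    using assms(2) unfolding recursive_ext_def by metis
  have "recursive n (\<lambda>xs. F (map (\<lambda>g. g xs) (map G hs)))"
    by (rule recursive.comp) (use F G in auto)
  moreover have "f (map (\<lambda>h. h xs) hs) = F (map (\<lambda>g. g xs) (map G hs))" if "length xs = n" for xs
  proof -
    have "map (\<lambda>h. h xs) hs = map (\<lambda>g. g xs) (map G hs)"
      using G that by auto
    then show ?thesis using F(2)[of "map (\<lambda>h. h xs) hs"] by (metis length_map)
  qed
  ultimately show ?thesis unfolding recursive_ext_def by blast
qed

lemma recursive_ext_proj: "i < n \<Longrightarrow> recursive_ext n (\<lambda>xs. xs ! i)"
  unfolding recursive_ext_def using recursive.proj by blast

lemma recursive_ext_1: "recursive_ext 1 (\<lambda>xs. h (xs ! 0)) \<Longrightarrow> recursive_ext n f \<Longrightarrow> recursive_ext n (\<lambda>xs. h (f xs))"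
  using recursive_ext_comp[of "[f]" "\<lambda>xs. h (xs ! 0)" n] by simp

lemma recursive_ext_Suc: "recursive_ext n f \<Longrightarrow> recursive_ext n (\<lambda>xs. Suc (f xs))"
  by (rule recursive_ext_1[where h = Suc]) (use recursive.succ in \<open>auto simp: recursive_ext_def\<close>)

lemma recursive_ext_const: "recursive_ext n (\<lambda>xs. c)"
proof (induction c)
  case 0 then show ?case unfolding recursive_ext_def using recursive.zero by blast
qed (rule recursive_ext_Suc)

lemma recursive_ext_prim:
  assumes "recursive_ext n f" "recursive_ext (Suc (Suc n)) g"
  shows "recursive_ext (Suc n) (\<lambda>xs. rec_nat (f (tl xs)) (\<lambda>k v. g (k # v # tl xs)) (hd xs))"
proof -
  obtain F where F: "recursive n F" "\<And>xs. length xs = n \<Longrightarrow> f xs = F xs"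
    using assms(1) unfolding recursive_ext_def by blast
  obtain G where G: "recursive (Suc (Suc n)) G" "\<And>xs. length xs = Suc (Suc n) \<Longrightarrow> g xs = G xs"
    using assms(2) unfolding recursive_ext_def by blast
  have "rec_nat (f (tl xs)) (\<lambda>k v. g (k # v # tl xs)) m
      = rec_nat (F (tl xs)) (\<lambda>k v. G (k # v # tl xs)) m" if "length xs = Suc n" for xs m
    using that by (induction m) (auto simp: F(2) G(2))
  then show ?thesis
    unfolding recursive_ext_def using recursive.primitive_recursion[OF F(1) G(1)] by blast
qed

lemma recursive_ext_min:
  assumes "recursive_ext (Suc n) f" "\<And>xs. length xs = n \<Longrightarrow> \<exists>y. f (y # xs) = 0"
  shows "recursive_ext n (\<lambda>xs. LEAST y. f (y # xs) = 0)"
proof -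
  obtain F where F: "recursive (Suc n) F" "\<And>xs. length xs = Suc n \<Longrightarrow> f xs = F xs"
    using assms(1) unfolding recursive_ext_def by blast
  have eq: "f (y # xs) = F (y # xs)" if "length xs = n" for y xs
    using F(2)[of "y # xs"] that by simp
  have "recursive n (\<lambda>xs. LEAST y. F (y # xs) = 0)"
    by (rule recursive.minimisation[OF F(1)]) (use assms(2) eq in auto)
  then show ?thesis unfolding recursive_ext_def
    by (intro exI[of _ "\<lambda>xs. LEAST y. F (y # xs) = 0"] conjI) (auto simp only: eq)
qed

text \<open>
  Primitive recursion with the recursion argument and the parameters in arbitrary position:
  compose the primitive scheme with projections.
\<close>

lemma recursive_ext_rec_nat:
  assumes "recursive_ext n a" "recursive_ext n m" "recursive_ext (Suc (Suc n)) g"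
  shows "recursive_ext n (\<lambda>xs. rec_nat (a xs) (\<lambda>k v. g (k # v # xs)) (m xs))"
proof -
  let ?h = "\<lambda>xs. rec_nat (a (tl xs)) (\<lambda>k v. g (k # v # tl xs)) (hd xs)"
  let ?ps = "m # map (\<lambda>i xs. xs ! i) [0..<n]"
  have "recursive_ext n (\<lambda>xs. ?h (map (\<lambda>h. h xs) ?ps))"
    by (rule recursive_ext_comp) (use recursive_ext_prim[OF assms(1,3)] assms(2) recursive_ext_proj in auto)
  then show ?thesis
  proof (rule recursive_ext_cong)
    fix xs :: "nat list" assume "length xs = n"
    then have "map ((\<lambda>h. h xs) \<circ> (\<lambda>i xs. xs ! i)) [0..<n] = xs"
      using map_nth[of xs] by (simp add: comp_def)
    then show "rec_nat (a xs) (\<lambda>k v. g (k # v # xs)) (m xs) = ?h (map (\<lambda>h. h xs) ?ps)"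
      by simp
  qed
qed

lemma recursive_ext_pred: "recursive_ext n f \<Longrightarrow> recursive_ext n (\<lambda>xs. f xs - 1)"
proof -
  assume f: "recursive_ext n f"
  have "rec_nat 0 (\<lambda>k v. k) m = m - 1" for m by (cases m) auto
  then show ?thesis
    using recursive_ext_rec_nat[OF recursive_ext_const[of n 0] f recursive_ext_proj[of 0 "Suc (Suc n)"]] by simp
qed

lemma recursive_ext_add:
  assumes "recursive_ext n f" "recursive_ext n g" shows "recursive_ext n (\<lambda>xs. f xs + g xs)"
proof -
  have "rec_nat a (\<lambda>k v. Suc v) m = a + m" for a m by (induction m) auto
  then show ?thesis
    using recursive_ext_rec_nat[OF assms recursive_ext_Suc[OF recursive_ext_proj[of 1 "Suc (Suc n)"]]] by simp
qed

lemma recursive_ext_diff: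
  assumes "recursive_ext n f" "recursive_ext n g" shows "recursive_ext n (\<lambda>xs. f xs - g xs)"
proof -
  have "rec_nat a (\<lambda>k v. v - 1) m = a - m" for a m by (induction m) auto
  then show ?thesis
    using recursive_ext_rec_nat[OF assms recursive_ext_pred[OF recursive_ext_proj[of 1 "Suc (Suc n)"]]] by simp
qed

lemma recursive_ext_triangle:
  assumes "recursive_ext n f" shows "recursive_ext n (\<lambda>xs. triangle (f xs))"
proof -
  have "rec_nat 0 (\<lambda>k v. v + Suc k) m = triangle m" for m by (induction m) auto
  then show ?thesis
    using recursive_ext_rec_nat[OF recursive_ext_const[of n 0] assms recursive_ext_add[OF recursive_ext_proj[of 1 "Suc (Suc n)"] recursive_ext_Suc[OF recursive_ext_proj[of 0 "Suc (Suc n)"]]]] by simp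
qed

definition pair :: "nat \<Rightarrow> nat \<Rightarrow> nat" where "pair a b = prod_encode (a, b)"
definition pfst :: "nat \<Rightarrow> nat" where "pfst p = fst (prod_decode p)"
definition psnd :: "nat \<Rightarrow> nat" where "psnd p = snd (prod_decode p)"

lemma pfst_pair [simp]: "pfst (pair a b) = a"
  and psnd_pair [simp]: "psnd (pair a b) = b"
  by (simp_all add: pair_def pfst_def psnd_def)

lemma pair_pfst_psnd [simp]: "pair (pfst p) (psnd p) = p"
  by (simp add: pair_def pfst_def psnd_def)

lemma pair_eq_iff [simp]: "pair a b = pair c d \<longleftrightarrow> a = c \<and> b = d"
  by (auto simp: pair_def)

lemma pair_eq_conv: "pair a b = p \<longleftrightarrow> a = pfst p \<and> b = psnd p"
  by auto

lemma recursive_ext_pair: "recursive_ext n f \<Longrightarrow> recursive_ext n g \<Longrightarrow> recursive_ext n (\<lambda>xs. pair (f xs) (g xs))"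
  unfolding pair_def prod_encode_def split_conv by (intro recursive_ext_add recursive_ext_triangle)

lemma triangle_mono: "a \<le> b \<Longrightarrow> triangle a \<le> triangle b"
  by (induction rule: dec_induct) auto

text \<open>
  The two components of a pair are recovered from their sum, which a single regular
  minimisation computes.
\<close>

definition psum :: "nat \<Rightarrow> nat" where
  "psum p = (LEAST s. Suc p - triangle (Suc s) = 0)"

lemma psum: "psum p = pfst p + psnd p"
proof -
  obtain a b where p: "p = pair a b" by (metis pair_pfst_psnd)
  have p': "p = triangle (a + b) + a" by (simp add: p pair_def prod_encode_def)
  have "psum p = a + b"
    unfolding psum_def
  proof (rule Least_equality)
    show "Suc p - triangle (Suc (a + b)) = 0" using p' by simp
  next
    fix s assume s: "Suc p - triangle (Suc s) = 0"
    show "a + b \<le> s"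
    proof (rule ccontr)
      assume "\<not> a + b \<le> s"
      then have "triangle (Suc s) \<le> triangle (a + b)" by (intro triangle_mono) simp
      then show False using s p' by simp
    qed
  qed
  then show ?thesis by (simp add: p)
qed

lemma recursive_ext_psum:
  assumes f: "recursive_ext n f" shows "recursive_ext n (\<lambda>xs. psum (f xs))"
proof -
  let ?f = "\<lambda>xs. Suc (xs ! 1) - triangle (Suc (xs ! 0))"
  have "recursive_ext (Suc 1) ?f"
    by (intro recursive_ext_diff recursive_ext_triangle recursive_ext_Suc recursive_ext_proj) auto
  moreover have "\<exists>y. ?f (y # xs) = 0" for xs :: "nat list"
  proof -
    have "m \<le> triangle m" for m by (induction m) auto
    from this[of "Suc (xs ! 0)"] show ?thesis by (intro exI[of _ "xs ! 0"]) simp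
  qed
  ultimately have "recursive_ext 1 (\<lambda>xs. LEAST y. ?f (y # xs) = 0)"
    by (rule recursive_ext_min)
  then have "recursive_ext 1 (\<lambda>xs. psum (xs ! 0))"
    unfolding psum_def by (simp only: nth_Cons_0 One_nat_def nth_Cons_Suc)
  from this f show ?thesis by (rule recursive_ext_1)
qed

lemma pfst_conv: "pfst p = p - triangle (psum p)"
proof -
  have "p = triangle (pfst p + psnd p) + pfst p"
    using pair_pfst_psnd[of p] unfolding pair_def prod_encode_def split_conv by (rule sym)
  then show ?thesis unfolding psum by linarith
qed

lemma psnd_conv: "psnd p = psum p - pfst p"
  unfolding psum by simp

lemma recursive_ext_pfst: "recursive_ext n f \<Longrightarrow> recursive_ext n (\<lambda>xs. pfst (f xs))"
  unfolding pfst_conv by (intro recursive_ext_diff recursive_ext_triangle recursive_ext_psum)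

lemma recursive_ext_psnd: "recursive_ext n f \<Longrightarrow> recursive_ext n (\<lambda>xs. psnd (f xs))"
  unfolding psnd_conv by (intro recursive_ext_diff recursive_ext_pfst recursive_ext_psum)

lemma computable_iff: "computable f \<longleftrightarrow> recursive_ext 1 (\<lambda>xs. f (xs ! 0))"
proof
  assume "recursive_ext 1 (\<lambda>xs. f (xs ! 0))"
  then obtain g where g: "recursive 1 g" "\<forall>xs. length xs = 1 \<longrightarrow> f (xs ! 0) = g xs"
    unfolding recursive_ext_def by (elim exE conjE)
  have "f x = g [x]" for x using g(2)[rule_format, of "[x]"] by simp
  with g(1) have "recursive 1 g \<and> (\<forall>x. f x = g [x])" by simp
  then show "computable f" unfolding computable_def by blast
next
  assume "computable f"
  then obtain g where g: "recursive 1 g" "\<And>x. f x = g [x]"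
    unfolding computable_def by blast
  have "f (xs ! 0) = g xs" if "length xs = 1" for xs
    using that g(2) by (cases xs) auto
  with g(1) show "recursive_ext 1 (\<lambda>xs. f (xs ! 0))" unfolding recursive_ext_def by blast
qed

lemma recursive_ext_computable: "computable f \<Longrightarrow> recursive_ext n g \<Longrightarrow> recursive_ext n (\<lambda>xs. f (g xs))"
  unfolding computable_iff by (rule recursive_ext_1)

definition decidable :: "(nat \<Rightarrow> bool) \<Rightarrow> bool" where
  "decidable P \<longleftrightarrow> computable (\<lambda>x. of_bool (P x))"

named_theorems computable_intros

lemma computable_id [computable_intros]: "computable (\<lambda>x. x)"
  unfolding computable_iff by (rule recursive_ext_proj) simp

lemma computable_const [computable_intros]: "computable (\<lambda>x. c)"
  unfolding computable_iff by (rule recursive_ext_const)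

lemma computable_Suc [computable_intros]: "computable f \<Longrightarrow> computable (\<lambda>x. Suc (f x))"
  unfolding computable_iff by (rule recursive_ext_Suc)

lemma computable_add [computable_intros]: "computable f \<Longrightarrow> computable g \<Longrightarrow> computable (\<lambda>x. f x + g x)"
  unfolding computable_iff by (rule recursive_ext_add)

lemma computable_diff [computable_intros]: "computable f \<Longrightarrow> computable g \<Longrightarrow> computable (\<lambda>x. f x - g x)"
  unfolding computable_iff by (rule recursive_ext_diff)

lemma computable_pair [computable_intros]: "computable f \<Longrightarrow> computable g \<Longrightarrow> computable (\<lambda>x. pair (f x) (g x))"
  unfolding computable_iff by (rule recursive_ext_pair)

lemma computable_pfst [computable_intros]: "computable f \<Longrightarrow> computable (\<lambda>x. pfst (f x))"
  unfolding computable_iff by (rule recursive_ext_pfst)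

lemma computable_psnd [computable_intros]: "computable f \<Longrightarrow> computable (\<lambda>x. psnd (f x))"
  unfolding computable_iff by (rule recursive_ext_psnd)

lemma computable_compose: "computable f \<Longrightarrow> computable g \<Longrightarrow> computable (\<lambda>x. f (g x))"
  using recursive_ext_computable[of f 1] by (simp add: computable_iff)

text \<open>
  Functions are unary: additional arguments travel in pairs, and a premise about
  \<open>pfst p\<close> and \<open>psnd p\<close> stands for computability in several variables. The rules in
  \<open>computable_intros\<close> thus apply below binders as well.
\<close>

lemma computable_rec_nat [computable_intros]:
  assumes "computable a" "computable m"
    and "computable (\<lambda>p. g (pfst p) (pfst (psnd p)) (psnd (psnd p)))"
  shows "computable (\<lambda>x. rec_nat (a x) (\<lambda>k v. g k v x) (m x))"
proof -
  let ?G = "\<lambda>p. g (pfst p) (pfst (psnd p)) (psnd (psnd p))"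
  have "recursive_ext 3 (\<lambda>xs. ?G (pair (xs ! 0) (pair (xs ! 1) (xs ! 2))))"
    by (intro recursive_ext_computable[OF assms(3)] recursive_ext_pair recursive_ext_proj) auto
  then have "recursive_ext (Suc (Suc 1)) (\<lambda>xs. g (xs ! 0) (xs ! 1) (xs ! 2))"
    by (simp add: numeral_3_eq_3)
  from recursive_ext_rec_nat[OF assms(1,2)[unfolded computable_iff] this]
  show ?thesis by (simp add: computable_iff)
qed

lemma computable_funpow [computable_intros]:
  assumes "computable a" "computable m" "computable (\<lambda>p. g (pfst p) (psnd p))"
  shows "computable (\<lambda>x. ((\<lambda>v. g v x) ^^ m x) (a x))"
proof -
  have "((\<lambda>v. g v x) ^^ n) b = rec_nat b (\<lambda>k v. g v x) n" for x n b
    by (induction n) auto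
  moreover have "computable (\<lambda>p. g (pfst (psnd p)) (psnd (psnd p)))"
    using computable_compose[OF assms(3), of psnd] by (simp add: computable_intros)
  ultimately show ?thesis
    using computable_rec_nat[OF assms(1,2), of "\<lambda>k v. g v"] by simp
qed

lemma computable_mult [computable_intros]:
  assumes "computable f" "computable g" shows "computable (\<lambda>x. f x * g x)"
proof -
  have "((\<lambda>v. v + a) ^^ m) 0 = m * a" for a m :: nat by (induction m) auto
  moreover have "computable (\<lambda>x. ((\<lambda>v. v + g x) ^^ f x) 0)"
    by (intro computable_intros assms computable_compose[OF assms(2)])
  ultimately show ?thesis by simp
qed

lemma computable_power [computable_intros]:
  assumes "computable f" "computable g" shows "computable (\<lambda>x. f x ^ g x)"
proof -
  have "((\<lambda>v. v * a) ^^ m) 1 = a ^ m" for a m :: nat by (induction m) auto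
  moreover have "computable (\<lambda>x. ((\<lambda>v. v * f x) ^^ g x) 1)"
    by (intro computable_intros assms computable_compose[OF assms(1)])
  ultimately show ?thesis by simp
qed

lemma computable_of_bool [computable_intros]: "decidable P \<Longrightarrow> computable (\<lambda>x. of_bool (P x))"
  unfolding decidable_def .

lemma decidable_compose: "decidable P \<Longrightarrow> computable g \<Longrightarrow> decidable (\<lambda>x. P (g x))"
  unfolding decidable_def by (rule computable_compose)

lemma decidable_const [computable_intros]: "decidable (\<lambda>x. c)"
  unfolding decidable_def by (rule computable_const)

lemma decidable_not [computable_intros]: "decidable P \<Longrightarrow> decidable (\<lambda>x. \<not> P x)"
proof -
  assume "decidable P"
  then have "computable (\<lambda>x. 1 - of_bool (P x))"
    unfolding decidable_def by (intro computable_diff computable_const)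
  moreover have "1 - of_bool (P x) = (of_bool (\<not> P x) :: nat)" for x by simp
  ultimately show ?thesis unfolding decidable_def by simp
qed

lemma decidable_conj [computable_intros]: "decidable P \<Longrightarrow> decidable Q \<Longrightarrow> decidable (\<lambda>x. P x \<and> Q x)"
  unfolding decidable_def of_bool_conj by (rule computable_mult)

lemma decidable_disj [computable_intros]: "decidable P \<Longrightarrow> decidable Q \<Longrightarrow> decidable (\<lambda>x. P x \<or> Q x)"
proof -
  assume "decidable P" "decidable Q"
  then have "decidable (\<lambda>x. \<not> (\<not> P x \<and> \<not> Q x))" by (intro decidable_not decidable_conj)
  then show ?thesis by simp
qed

lemma decidable_imp [computable_intros]: "decidable P \<Longrightarrow> decidable Q \<Longrightarrow> decidable (\<lambda>x. P x \<longrightarrow> Q x)"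
  unfolding imp_conv_disj by (intro decidable_disj decidable_not)

lemma decidable_iff [computable_intros]: "decidable P \<Longrightarrow> decidable Q \<Longrightarrow> decidable (\<lambda>x. P x \<longleftrightarrow> Q x)"
  unfolding iff_conv_conj_imp by (intro decidable_conj decidable_imp)

lemma decidable_if [computable_intros]: "decidable P \<Longrightarrow> decidable Q \<Longrightarrow> decidable R \<Longrightarrow> decidable (\<lambda>x. if P x then Q x else R x)"
  unfolding if_bool_eq_conj by (intro decidable_conj decidable_imp decidable_not)

lemma decidable_le [computable_intros]: "computable f \<Longrightarrow> computable g \<Longrightarrow> decidable (\<lambda>x. f x \<le> g x)"
proof -
  assume "computable f" "computable g"
  then have "computable (\<lambda>x. 1 - (f x - g x))" by (intro computable_intros)
  moreover have "1 - (a - b) = (of_bool (a \<le> b) :: nat)" for a b :: nat by auto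
  ultimately show ?thesis unfolding decidable_def by simp
qed

lemma decidable_less [computable_intros]: "computable f \<Longrightarrow> computable g \<Longrightarrow> decidable (\<lambda>x. f x < g x)"
  unfolding less_eq_Suc_le by (intro decidable_le computable_Suc)

lemma decidable_eq [computable_intros]: "computable f \<Longrightarrow> computable g \<Longrightarrow> decidable (\<lambda>x. f x = g x)"
  unfolding order_eq_iff by (intro decidable_conj decidable_le)

lemma decidable_all [computable_intros]:
  assumes "computable b" "decidable (\<lambda>p. P (pfst p) (psnd p))"
  shows "decidable (\<lambda>x. \<forall>i<b x. P i x)"
proof -
  have "computable (\<lambda>p. of_bool (P (pfst p) (psnd (psnd p))) * pfst (psnd p))"
    by (intro computable_intros decidable_compose[OF assms(2), of "\<lambda>p. pair (pfst p) (psnd (psnd p))",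
        unfolded pfst_pair psnd_pair])
  then have "computable (\<lambda>x. rec_nat 1 (\<lambda>k v. of_bool (P k x) * v) (b x))"
    by (intro computable_rec_nat computable_const assms(1))
  moreover have "rec_nat 1 (\<lambda>k v. of_bool (P k x) * v) m = (of_bool (\<forall>i<m. P i x) :: nat)" for x m
    by (induction m) (auto simp: less_Suc_eq)
  ultimately show ?thesis unfolding decidable_def by simp
qed

lemma decidable_ex [computable_intros]:
  assumes "computable b" "decidable (\<lambda>p. P (pfst p) (psnd p))"
  shows "decidable (\<lambda>x. \<exists>i<b x. P i x)"
proof -
  have "decidable (\<lambda>x. \<not> (\<forall>i<b x. \<not> P i x))" by (intro decidable_not decidable_all assms)
  then show ?thesis by simp
qed

lemma computable_Least:
  assumes "decidable (\<lambda>p. P (pfst p) (psnd p))" "\<And>x. \<exists>y. P y x"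
  shows "computable (\<lambda>x. LEAST y. P y x)"
proof -
  let ?f = "\<lambda>xs. 1 - of_bool (P (xs ! 0) (xs ! 1)) :: nat"
  have "recursive_ext 2 (\<lambda>xs. of_bool (P (pfst (pair (xs ! 0) (xs ! 1))) (psnd (pair (xs ! 0) (xs ! 1)))))"
    by (intro recursive_ext_computable[OF assms(1)[unfolded decidable_def]] recursive_ext_pair recursive_ext_proj) auto
  then have "recursive_ext (Suc 1) ?f"
    by (intro recursive_ext_diff recursive_ext_const) (simp add: numeral_2_eq_2)
  moreover have "\<exists>y. ?f (y # xs) = 0" for xs
    using assms(2)[of "xs ! 0"] by auto
  ultimately have "recursive_ext 1 (\<lambda>xs. LEAST y. ?f (y # xs) = 0)" by (rule recursive_ext_min)
  moreover have "?f (y # xs) = 0 \<longleftrightarrow> P y (xs ! 0)" for y xs by simp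
  ultimately show ?thesis by (simp add: computable_iff)
qed

lemma computable_div [computable_intros]:
  assumes "computable f" "0 < k" shows "computable (\<lambda>x. f x div k)"
proof -
  have "(LEAST q. a < Suc q * k) = a div k" for a
  proof (rule Least_equality)
    show "a < Suc (a div k) * k" using assms(2)
      by (metis dividend_less_times_div mult.commute mult_Suc_right)
  next
    fix q assume "a < Suc q * k"
    then show "a div k \<le> q" using assms(2)
      by (simp add: less_mult_imp_div_less less_Suc_eq_le[symmetric])
  qed
  moreover have "computable (\<lambda>a. LEAST q. a < Suc q * k)"
  proof (rule computable_Least)
    show "\<exists>q. a < Suc q * k" for a
      using assms(2) by (intro exI[of _ a], cases k) auto
  qed (intro computable_intros)
  ultimately show ?thesis using computable_compose[OF _ assms(1)] by simp
qed

lemma computable_mod [computable_intros]: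
  assumes "computable f" "0 < k" shows "computable (\<lambda>x. f x mod k)"
  unfolding modulo_nat_def by (intro computable_intros assms)

lemma decidable_bit [computable_intros]:
  assumes "computable f" "computable g" shows "decidable (\<lambda>x. bit (f x) (g x))"
proof -
  have "((\<lambda>v. v div 2) ^^ m) a = a div 2 ^ m" for a m :: nat
    by (induction m) (simp_all add: div_mult2_eq[symmetric] mult.commute)
  moreover have "computable (\<lambda>x. ((\<lambda>v. v div 2) ^^ g x) (f x) mod 2)"
    by (intro computable_intros assms) simp_all
  moreover have "a mod 2 = (of_bool (odd a) :: nat)" for a by (simp add: mod_2_eq_odd)
  ultimately show ?thesis unfolding decidable_def bit_iff_odd by simp
qed

lemma ex_bits: "\<exists>w < (2::nat) ^ n. \<forall>i<n. bit w i \<longleftrightarrow> P i" for P :: "nat \<Rightarrow> bool"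
proof (intro exI conjI)
  show "horner_sum of_bool 2 (map P [0..<n]) < (2 :: nat) ^ n"
    using horner_sum_of_bool_2_less[of "map P [0..<n]"] by simp
qed (simp add: bit_horner_sum_bit_iff)

text \<open>
  Course-of-values recursion for predicates: the history \<open>P 0, \<dots>, P x\<close> is a bit pattern below
  \<open>2 ^ Suc x\<close>, and the recursion equation singles out the right pattern, so a bounded search
  finds it. The guard \<open>j < i\<close> on the access to the history makes the recursion local for every \<open>S\<close>.
\<close>

lemma decidable_course_of_values:
  assumes rec: "\<And>i. P i \<longleftrightarrow> S (\<lambda>j. j < i \<and> P j) i"
    and decidable: "decidable (\<lambda>p. S (\<lambda>j. j < psnd p \<and> bit (pfst p) j) (psnd p))"
  shows "decidable P"
proof -
  define T where "T w x \<longleftrightarrow> (\<forall>i<Suc x. bit w i \<longleftrightarrow> S (\<lambda>j. j < i \<and> bit w j) i)" for w x :: nat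
  have T: "bit w i \<longleftrightarrow> P i" if "T w x" "i \<le> x" for w x i
    using that(2)
  proof (induction i rule: less_induct)
    case (less i)
    then have "(\<lambda>j. j < i \<and> bit w j) = (\<lambda>j. j < i \<and> P j)" by auto
    then show ?case using that(1) less.prems rec[of i] unfolding T_def by auto
  qed
  have ex: "\<exists>w < (2::nat) ^ Suc x. T w x" for x
  proof -
    obtain w :: nat where w: "w < 2 ^ Suc x" "\<forall>i<Suc x. bit w i \<longleftrightarrow> P i"
      using ex_bits by blast
    have "T w x" unfolding T_def
    proof (intro allI impI)
      fix i assume i: "i < Suc x"
      then have "(\<lambda>j. j < i \<and> bit w j) = (\<lambda>j. j < i \<and> P j)" using w(2) by auto
      then show "bit w i \<longleftrightarrow> S (\<lambda>j. j < i \<and> bit w j) i" using rec[of i] w(2) i by simp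
    qed
    with w(1) show ?thesis by blast
  qed
  have "P = (\<lambda>x. \<exists>w < 2 ^ Suc x. T w x \<and> bit w x)"
    by (rule ext) (use T[OF _ order_refl] ex in blast)
  moreover have "decidable (\<lambda>x. \<exists>w < 2 ^ Suc x. T w x \<and> bit w x)"
    unfolding T_def
    by (intro computable_intros decidable_compose[OF decidable, of "\<lambda>p. pair (pfst (psnd p)) (pfst p)", simplified])
  ultimately show ?thesis by (simp only:)
qed

section \<open>Codes of formulae\<close>

lemma pfst_le: "pfst p \<le> p" and psnd_le: "psnd p \<le> p"
  using le_prod_encode_1[of "pfst p" "psnd p"] le_prod_encode_2[of "psnd p" "pfst p"]
  by (simp_all add: pair_def[symmetric])

lemma psnd_less: "pfst p \<noteq> 0 \<Longrightarrow> psnd p < p"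
proof -
  assume "pfst p \<noteq> 0"
  moreover have "m \<le> triangle m" for m by (induction m) auto
  from this[of "pfst p + psnd p"] have "psnd p + pfst p \<le> p"
    using pair_pfst_psnd[of p] unfolding pair_def prod_encode_def split_conv by linarith
  ultimately show ?thesis by linarith
qed

lemma pfst_psnd_less: "pfst p \<noteq> 0 \<Longrightarrow> pfst (psnd p) < p"
  and psnd_psnd_less: "pfst p \<noteq> 0 \<Longrightarrow> psnd (psnd p) < p"
  using psnd_less[of p] pfst_le[of "psnd p"] psnd_le[of "psnd p"] by linarith+

text \<open>
  The decoding is total: arguments that are no code yield some formula with the same tag, and unknown
  tags yield \<open>Top\<close>. The Tarski clauses then hold for all arguments, not only for codes.
\<close>

function decode :: "nat \<Rightarrow> fm" where
  "decode c =
    (if pfst c = 1 then Bot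
     else if pfst c = 2 then Atom (Rel (pfst (pfst (psnd c))) (psnd (pfst (psnd c)))) (list_decode (psnd (psnd c)))
     else if pfst c = 3 then Neg (decode (psnd c))
     else if pfst c = 4 then Conj (decode (pfst (psnd c))) (decode (psnd (psnd c)))
     else if pfst c = 5 then Ex (pfst (psnd c)) (decode (psnd (psnd c)))
     else Top)"
  by pat_completeness auto
termination
  by (relation "measure id") (simp_all add: psnd_less pfst_psnd_less psnd_psnd_less)

declare decode.simps [simp del]

lemma decode_simps [simp]:
  "pfst c = Suc 0 \<Longrightarrow> decode c = Bot"
  "pfst c = 2 \<Longrightarrow> decode c = Atom (Rel (pfst (pfst (psnd c))) (psnd (pfst (psnd c)))) (list_decode (psnd (psnd c)))"
  "pfst c = 3 \<Longrightarrow> decode c = Neg (decode (psnd c))"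
  "pfst c = 4 \<Longrightarrow> decode c = Conj (decode (pfst (psnd c))) (decode (psnd (psnd c)))"
  "pfst c = 5 \<Longrightarrow> decode c = Ex (pfst (psnd c)) (decode (psnd (psnd c)))"
  "pfst c = 0 \<or> 5 < pfst c \<Longrightarrow> decode c = Top"
  by (auto simp: decode.simps[of c])

lemma tag_cases:
  obtains "pfst c = Suc 0" | "pfst c = 2" | "pfst c = 3" | "pfst c = 4" | "pfst c = 5"
    | "pfst c = 0 \<or> 5 < pfst c"
  by linarith

lemma decode_fm_encode: "decode (fm_encode \<phi>) = \<phi>"
  by (induction \<phi>) (auto simp: pair_def[symmetric] split: rsym.splits)

definition ltl :: "nat \<Rightarrow> nat" where "ltl l = psnd (l - 1)"
definition ldrop :: "nat \<Rightarrow> nat \<Rightarrow> nat" where "ldrop i l = (ltl ^^ i) l"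
definition lnth :: "nat \<Rightarrow> nat \<Rightarrow> nat" where "lnth l i = pfst (ldrop i l - 1)"

lemma list_decode_ltl: "list_decode (ltl l) = tl (list_decode l)"
proof (cases l)
  case 0
  have "psnd 0 = 0" using psnd_le[of 0] by simp
  then show ?thesis using 0 by (simp add: ltl_def)
qed (simp add: ltl_def psnd_def split: prod.split)

lemma list_decode_ldrop: "list_decode (ldrop i l) = drop i (list_decode l)"
  by (induction i) (auto simp: ldrop_def list_decode_ltl drop_Suc tl_drop)

lemma ldrop_eq_0_iff: "ldrop i l = 0 \<longleftrightarrow> length (list_decode l) \<le> i"
proof -
  have "ldrop i l = 0 \<longleftrightarrow> list_decode (ldrop i l) = []"
    by (metis list_decode_inverse list_encode.simps(1) list_decode.simps(1))
  then show ?thesis by (simp add: list_decode_ldrop)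
qed

lemma lnth_eq: "i < length (list_decode l) \<Longrightarrow> lnth l i = list_decode l ! i"
proof -
  assume i: "i < length (list_decode l)"
  then obtain m where m: "ldrop i l = Suc m"
    using ldrop_eq_0_iff[of i l] by (metis leD not0_implies_Suc)
  have "hd (list_decode (ldrop i l)) = pfst m"
    unfolding m by (simp add: pfst_def split: prod.split)
  then have "pfst m = list_decode l ! i"
    unfolding list_decode_ldrop hd_drop_conv_nth[OF i] by (rule sym)
  then show ?thesis by (simp add: lnth_def m)
qed

lemma list_decode_bounds:
  "length (list_decode l) \<le> l" "y \<in> set (list_decode l) \<Longrightarrow> y < l"
proof -
  have "length xs \<le> list_encode xs \<and> (\<forall>y\<in>set xs. y < list_encode xs)" for xs
  proof (induction xs)
    case (Cons x xs)
    then show ?case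
      using le_prod_encode_1[of x "list_encode xs"] le_prod_encode_2[of "list_encode xs" x]
      by fastforce
  qed simp
  from this[of "list_decode l"]
  show "length (list_decode l) \<le> l" "y \<in> set (list_decode l) \<Longrightarrow> y < l" by auto
qed

lemma set_list_decode_iff:
  "y \<in> set (list_decode l) \<longleftrightarrow> (\<exists>i<l. ldrop i l \<noteq> 0 \<and> lnth l i = y)"
proof
  assume "y \<in> set (list_decode l)"
  then obtain i where "i < length (list_decode l)" "list_decode l ! i = y"
    by (auto simp: in_set_conv_nth)
  then show "\<exists>i<l. ldrop i l \<noteq> 0 \<and> lnth l i = y"
    using list_decode_bounds(1)[of l] by (auto simp: ldrop_eq_0_iff lnth_eq intro!: exI[of _ i])
next
  assume "\<exists>i<l. ldrop i l \<noteq> 0 \<and> lnth l i = y"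
  then show "y \<in> set (list_decode l)"
    by (auto simp: ldrop_eq_0_iff lnth_eq not_le intro: nth_mem)
qed

lemma length_list_decode_iff:
  "length (list_decode l) = k \<longleftrightarrow> ldrop k l = 0 \<and> (\<forall>i<k. ldrop i l \<noteq> 0)"
  by (auto simp: ldrop_eq_0_iff not_le intro: le_antisym leI)

lemma computable_ldrop [computable_intros]:
  "computable f \<Longrightarrow> computable g \<Longrightarrow> computable (\<lambda>x. ldrop (f x) (g x))"
  unfolding ldrop_def ltl_def by (intro computable_intros)

lemma computable_lnth [computable_intros]:
  "computable f \<Longrightarrow> computable g \<Longrightarrow> computable (\<lambda>x. lnth (f x) (g x))"
  unfolding lnth_def by (intro computable_intros)

lemma decidable_set_list_decode [computable_intros]:
  assumes "computable f" "computable g" shows "decidable (\<lambda>x. f x \<in> set (list_decode (g x)))"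
proof -
  have "decidable (\<lambda>p. pfst p \<in> set (list_decode (psnd p)))"
    unfolding set_list_decode_iff by (intro computable_intros)
  from decidable_compose[OF this computable_pair[OF assms]] show ?thesis by simp
qed

lemma decidable_length_list_decode [computable_intros]:
  assumes "computable f" "computable g" shows "decidable (\<lambda>x. length (list_decode (f x)) = g x)"
proof -
  have "decidable (\<lambda>p. length (list_decode (pfst p)) = psnd p)"
    unfolding length_list_decode_iff by (intro computable_intros)
  from decidable_compose[OF this computable_pair[OF assms]] show ?thesis by simp
qed

text \<open>
  Every variable of a decoded formula lies below its code, so quantifiers over variables are
  bounded.
\<close>

lemma fv_decode_less: "z \<in> fv (decode c) \<Longrightarrow> z < c"
proof (induction c rule: less_induct)
  case (less c)
  show ?case
  proof (cases c rule: tag_cases)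
    case 2
    then have "z < psnd (psnd c)" using less.prems list_decode_bounds(2) by simp
    then show ?thesis using psnd_psnd_less[of c] 2 by simp
  next
    case 3
    then show ?thesis using less psnd_less[of c] by force
  next
    case 4
    then show ?thesis using less pfst_psnd_less[of c] psnd_psnd_less[of c] by force
  next
    case 5
    then show ?thesis using less psnd_psnd_less[of c] by force
  qed (use less in auto)
qed

text \<open>
  Lets a course-of-values recursion on the second component of a pair carry a parameter in the first
  one.
\<close>

lemma pair_mono: "b < c \<Longrightarrow> pair a b < pair a c"
proof -
  assume "b < c"
  then have "triangle (Suc (a + b)) \<le> triangle (a + c)" by (intro triangle_mono) simp
  then show ?thesis by (simp add: pair_def prod_encode_def)
qed

lemma decidable_fv:
  assumes "computable f" "computable g" shows "decidable (\<lambda>x. f x \<in> fv (decode (g x)))"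
proof -
  define S where "S Q p \<longleftrightarrow>
    (pfst (psnd p) = 2 \<and> pfst p \<in> set (list_decode (psnd (psnd (psnd p))))) \<or>
    (pfst (psnd p) = 3 \<and> Q (pair (pfst p) (psnd (psnd p)))) \<or>
    (pfst (psnd p) = 4 \<and> (Q (pair (pfst p) (pfst (psnd (psnd p)))) \<or> Q (pair (pfst p) (psnd (psnd (psnd p)))))) \<or>
    (pfst (psnd p) = 5 \<and> pfst p \<noteq> pfst (psnd (psnd p)) \<and> Q (pair (pfst p) (psnd (psnd (psnd p)))))"
    for Q p
  have "decidable (\<lambda>p. pfst p \<in> fv (decode (psnd p)))"
  proof (rule decidable_course_of_values[where S = S])
    fix p
    show "pfst p \<in> fv (decode (psnd p)) \<longleftrightarrow> S (\<lambda>j. j < p \<and> pfst j \<in> fv (decode (psnd j))) p"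
    proof -
      have small: "pair (pfst p) b < p" if "b < psnd p" for b
        using pair_mono[OF that, of "pfst p"] by simp
      show ?thesis
        unfolding S_def
        by (cases "psnd p" rule: tag_cases)
          (auto simp: small psnd_less pfst_psnd_less psnd_psnd_less)
    qed
  next
    show "decidable (\<lambda>p. S (\<lambda>j. j < psnd p \<and> bit (pfst p) j) (psnd p))"
      unfolding S_def by (intro computable_intros)
  qed
  from decidable_compose[OF this computable_pair[OF assms]] show ?thesis by simp
qed

declare decidable_fv [computable_intros]

lemma decidable_is_code: "decidable (\<lambda>c. fm_encode (decode c) = c)"
proof (rule decidable_course_of_values[where S = "\<lambda>Q c.
    (pfst c < 2 \<and> psnd c = 0) \<or> pfst c = 2 \<or> (pfst c = 3 \<and> Q (psnd c)) \<or>
    (pfst c = 4 \<and> Q (pfst (psnd c)) \<and> Q (psnd (psnd c))) \<or>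
    (pfst c = 5 \<and> Q (psnd (psnd c)))"])
  fix c
  show "fm_encode (decode c) = c \<longleftrightarrow>
    (pfst c < 2 \<and> psnd c = 0) \<or> pfst c = 2 \<or>
    (pfst c = 3 \<and> psnd c < c \<and> fm_encode (decode (psnd c)) = psnd c) \<or>
    (pfst c = 4 \<and> (pfst (psnd c) < c \<and> fm_encode (decode (pfst (psnd c))) = pfst (psnd c)) \<and>
      psnd (psnd c) < c \<and> fm_encode (decode (psnd (psnd c))) = psnd (psnd c)) \<or>
    (pfst c = 5 \<and> psnd (psnd c) < c \<and> fm_encode (decode (psnd (psnd c))) = psnd (psnd c))"
  proof (cases c rule: tag_cases)
    case 6
    then show ?thesis by (auto simp: pair_def[symmetric] pair_eq_conv)
  qed (auto simp: pair_def[symmetric] pair_eq_conv psnd_less pfst_psnd_less psnd_psnd_less)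
qed (intro computable_intros)

section \<open>Recognising the fragment\<close>

definition at_most_one :: "nat set \<Rightarrow> bool" where "at_most_one S \<longleftrightarrow> (\<exists>u. S \<subseteq> {u})"
definition at_most_two :: "nat set \<Rightarrow> bool" where "at_most_two S \<longleftrightarrow> (\<exists>u v. S \<subseteq> {u, v})"

primrec skeleton_atoms :: "fm \<Rightarrow> fm set" where
  "skeleton_atoms Top = {}"
| "skeleton_atoms Bot = {}"
| "skeleton_atoms (Atom R ys) = {Atom R ys}"
| "skeleton_atoms (Neg \<phi>) = skeleton_atoms \<phi>"
| "skeleton_atoms (Conj \<phi> \<psi>) = skeleton_atoms \<phi> \<union> skeleton_atoms \<psi>"
| "skeleton_atoms (Ex y \<phi>) = {}"

text \<open>
  Atoms with at most one variable count as unary formulae and are exempt from uniformity.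
\<close>

definition uniform_skeleton :: "fm \<Rightarrow> bool" where
  "uniform_skeleton \<phi> \<longleftrightarrow> (\<forall>\<alpha>\<in>skeleton_atoms \<phi>. \<forall>\<beta>\<in>skeleton_atoms \<phi>. \<not> at_most_one (fv \<alpha>) \<longrightarrow> \<not> at_most_one (fv \<beta>) \<longrightarrow> fv \<alpha> = fv \<beta>)"

text \<open>
  Three mutually recursive classes: \<open>is_suf2\<close> is the fragment, \<open>is_matrix\<close> are the Boolean
  combinations of atoms and of formulae of the fragment with at most one free variable, and \<open>is_body\<close>
  are uniform matrices below any number of existential quantifiers. The last class absorbs the
  ambiguity of where the quantifier block of a formula ends: a further quantifier is either part of
  the block or, if the quantified formula has at most one free variable, an ingredient of the matrix.
  Since different \<open>y\<^sub>i\<close> may coincide and \<open>y\<^sub>1, y\<^sub>2\<close> need not occur, the three variants of the block rule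
  amount to the single condition that at most two variables remain free.
\<close>

fun is_suf2 :: "fm \<Rightarrow> bool" and is_matrix :: "fm \<Rightarrow> bool" and is_body :: "fm \<Rightarrow> bool" where
  "is_suf2 Top = True"
| "is_suf2 Bot = True"
| "is_suf2 (Atom R ys) = (Atom R ys \<in> atoms full_vocab \<and> at_most_two (set ys))"
| "is_suf2 (Neg \<phi>) = is_suf2 \<phi>"
| "is_suf2 (Conj \<phi> \<psi>) = (is_suf2 \<phi> \<and> is_suf2 \<psi>)"
| "is_suf2 (Ex y \<phi>) = ((is_suf2 \<phi> \<and> at_most_one (fv \<phi> - {y})) \<or> (at_most_two (fv \<phi> - {y}) \<and> is_body \<phi>))"
| "is_matrix Top = True"
| "is_matrix Bot = True"
| "is_matrix (Atom R ys) = (Atom R ys \<in> atoms full_vocab)"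
| "is_matrix (Neg \<phi>) = is_matrix \<phi>"
| "is_matrix (Conj \<phi> \<psi>) = (is_matrix \<phi> \<and> is_matrix \<psi>)"
| "is_matrix (Ex y \<phi>) = (at_most_one (fv \<phi> - {y}) \<and> (is_suf2 \<phi> \<or> is_body \<phi>))"
| "is_body (Ex y \<phi>) = (is_body \<phi> \<or> (at_most_one (fv \<phi> - {y}) \<and> (is_suf2 \<phi> \<or> is_body \<phi>)))"
| "is_body \<phi> = (is_matrix \<phi> \<and> uniform_skeleton \<phi>)"

lemma is_bodyI: "is_matrix \<phi> \<Longrightarrow> uniform_skeleton \<phi> \<Longrightarrow> is_body \<phi>"
  by (cases \<phi>) auto

lemma is_bodyD: "is_body \<phi> \<Longrightarrow> (\<exists>y \<psi>. \<phi> = Ex y \<psi>) \<or> (is_matrix \<phi> \<and> uniform_skeleton \<phi>)"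
  by (cases \<phi>) auto

lemma is_body_Exs: "is_body \<phi> \<Longrightarrow> is_body (Exs zs \<phi>)"
  by (induction zs) auto

lemma finite_fv: "finite (fv \<phi>)"
  by (induction \<phi>) auto

lemma fv_Exs: "fv (Exs zs \<phi>) = fv \<phi> - set zs"
  by (induction zs) auto

lemma at_most_one_iff_card: "finite S \<Longrightarrow> at_most_one S \<longleftrightarrow> card S \<le> 1"
proof
  assume "at_most_one S"
  then obtain u where "S \<subseteq> {u}" unfolding at_most_one_def by blast
  then show "card S \<le> 1" using card_mono[of "{u}" S] by simp
next
  assume "finite S" "card S \<le> 1"
  then show "at_most_one S" unfolding at_most_one_def
    by (metis One_nat_def card_le_Suc0_iff_eq insertI1 subset_singletonD subsetI singletonI)
qed

lemma at_most_two_iff_card: "finite S \<Longrightarrow> at_most_two S \<longleftrightarrow> card S \<le> 2"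
proof
  assume "at_most_two S"
  then obtain u v where uv: "S \<subseteq> {u, v}" unfolding at_most_two_def by blast
  have "card {u, v} \<le> 2" by (cases "u = v") auto
  then show "card S \<le> 2" using card_mono[OF _ uv] by simp
next
  assume S: "finite S" "card S \<le> 2"
  then consider "card S = 0" | "card S = 1" | "card S = 2" by linarith
  then show "at_most_two S"
    using S(1) unfolding at_most_two_def by cases (auto simp: card_1_singleton_iff card_2_iff)
qed

lemma at_most_one_mono: "at_most_one S \<Longrightarrow> T \<subseteq> S \<Longrightarrow> at_most_one T"
  unfolding at_most_one_def by blast

lemma at_most_one_at_most_two: "at_most_one S \<Longrightarrow> at_most_two S"
  unfolding at_most_one_def at_most_two_def by blast

lemma bool_comb_mono: "\<phi> \<in> bool_comb U \<Longrightarrow> U \<subseteq> W \<Longrightarrow> \<phi> \<in> bool_comb W"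
  by (induction rule: bool_comb.induct) (auto intro: bool_comb.intros)

lemma bool_comb_is_suf2:
  "\<phi> \<in> bool_comb U \<Longrightarrow> \<forall>\<psi>\<in>U. is_suf2 \<psi> \<and> fv \<psi> \<subseteq> V \<Longrightarrow> is_suf2 \<phi> \<and> fv \<phi> \<subseteq> V"
  by (induction rule: bool_comb.induct) auto

text \<open>
  A formula of the fragment with at most one free variable is a matrix whose atoms with two or more
  variables are all below quantifiers, so its skeleton does not interfere with the uniform set.
\<close>

lemma is_suf2_unary_is_matrix:
  "is_suf2 \<psi> \<Longrightarrow> at_most_one (fv \<psi>) \<Longrightarrow> is_matrix \<psi> \<and> (\<forall>\<alpha>\<in>skeleton_atoms \<psi>. at_most_one (fv \<alpha>))"
proof (induction \<psi>)
  case (Conj \<phi> \<psi>)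
  then show ?case using at_most_one_mono[OF Conj.prems(2)] by auto
qed auto

lemma bool_comb_is_matrix:
  assumes "\<phi> \<in> bool_comb (F \<union> U)"
    and "\<forall>\<alpha>\<in>F. \<alpha> \<in> atoms full_vocab \<and> fv \<alpha> = V" "\<forall>\<psi>\<in>U. is_suf2 \<psi> \<and> at_most_one (fv \<psi>)"
  shows "is_matrix \<phi> \<and> (\<forall>\<alpha>\<in>skeleton_atoms \<phi>. at_most_one (fv \<alpha>) \<or> fv \<alpha> = V)"
  using assms(1)
proof (induction rule: bool_comb.induct)
  case (base \<psi>)
  show ?case
  proof (cases "\<psi> \<in> U")
    case True
    then show ?thesis using assms(3) is_suf2_unary_is_matrix by blast
  next
    case False
    then have \<psi>: "\<psi> \<in> atoms full_vocab" "fv \<psi> = V" using base assms(2) by auto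
    then obtain R ys where "\<psi> = Atom R ys" unfolding atoms_def by blast
    then show ?thesis using \<psi> by simp
  qed
qed auto

text \<open>
  The block rule leaves at most the first \<open>j \<le> 2\<close> variables of its list free.
\<close>

lemma is_suf2_if_SUF2: "\<phi> \<in> SUF2 \<Longrightarrow> is_suf2 \<phi>"
  unfolding SUF2_def
proof (induction rule: suf2_over.induct)
  case (atom \<alpha>)
  then obtain R ys where \<alpha>: "\<alpha> = Atom R ys" unfolding atoms_def by blast
  have "at_most_two (set ys)"
    using atom(2) at_most_two_iff_card[of "set ys"] by (auto simp: \<alpha>)
  then show ?case using atom(1) by (simp add: \<alpha>)
next
  case (two_var_1 U y\<^sub>1 y\<^sub>2 \<phi>)
  then have "is_suf2 \<phi> \<and> fv \<phi> \<subseteq> {y\<^sub>1, y\<^sub>2}" by (intro bool_comb_is_suf2) auto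
  then show ?case by (auto simp: at_most_one_def)
next
  case (two_var_2 U y\<^sub>1 y\<^sub>2 \<phi>)
  then have "is_suf2 \<phi> \<and> fv \<phi> \<subseteq> {y\<^sub>1, y\<^sub>2}" by (intro bool_comb_is_suf2) auto
  then show ?case by (auto simp: at_most_one_def)
next
  case (block ys U F V \<phi> j)
  have F: "\<forall>\<alpha>\<in>F. \<alpha> \<in> atoms full_vocab \<and> fv \<alpha> = V"
    using block.hyps unfolding uniform_def by blast
  have U: "\<forall>\<psi>\<in>U. is_suf2 \<psi> \<and> at_most_one (fv \<psi>) \<and> fv \<psi> \<subseteq> set ys"
    using block by (simp add: at_most_one_iff_card[OF finite_fv])
  have "is_matrix \<phi> \<and> (\<forall>\<alpha>\<in>skeleton_atoms \<phi>. at_most_one (fv \<alpha>) \<or> fv \<alpha> = V)"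
    using block.hyps F U by (intro bool_comb_is_matrix[of _ F U]) auto
  then have is_body: "is_body \<phi>" by (intro is_bodyI) (auto simp: uniform_skeleton_def)
  have "\<psi> \<in> bool_comb (F \<union> U) \<Longrightarrow> fv \<psi> \<subseteq> set ys" for \<psi>
    by (induction rule: bool_comb.induct) (use F U block.hyps in auto)
  then have fv: "fv \<phi> \<subseteq> set ys" using block.hyps by blast
  obtain z zs where z: "drop j ys = z # zs"
    using block.hyps by (cases "drop j ys") auto
  have "set ys = set (take j ys) \<union> set (drop j ys)"
    by (metis append_take_drop_id set_append)
  then have "fv (Exs zs \<phi>) - {z} \<subseteq> set (take j ys)"
    using fv by (auto simp: fv_Exs z)
  moreover have "card (set (take j ys)) \<le> 2"
    using block.hyps by (intro order_trans[OF card_length]) auto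
  ultimately have "card (fv (Exs zs \<phi>) - {z}) \<le> 2"
    using card_mono[OF finite_set] order_trans by blast
  then have "at_most_two (fv (Exs zs \<phi>) - {z})"
    by (simp add: at_most_two_iff_card finite_fv)
  then show ?case using is_body_Exs[OF is_body, of zs] by (simp add: z)
qed auto

lemma SUF2_Ex: "\<phi> \<in> SUF2 \<Longrightarrow> at_most_one (fv \<phi> - {y}) \<Longrightarrow> Ex y \<phi> \<in> SUF2"
proof -
  assume \<phi>: "\<phi> \<in> SUF2" "at_most_one (fv \<phi> - {y})"
  then obtain u where "fv \<phi> \<subseteq> {u, y}" unfolding at_most_one_def by blast
  then show "Ex y \<phi> \<in> SUF2"
    using \<phi>(1) unfolding SUF2_def
    by (intro suf2_over.two_var_1[where U = "{\<phi>}"]) (auto intro: bool_comb.base)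
qed

text \<open>
  The side conditions of the block rule, freed from the list of variables.
\<close>

definition block_matrix :: "fm \<Rightarrow> bool" where
  "block_matrix \<psi> \<longleftrightarrow> (\<exists>U F V. finite U \<and> (\<forall>\<chi>\<in>U. \<chi> \<in> SUF2 \<and> at_most_one (fv \<chi>) \<and> fv \<chi> \<subseteq> fv \<psi>) \<and>
    uniform V F \<and> V \<subseteq> fv \<psi> \<and> \<psi> \<in> bool_comb (F \<union> U))"

lemma SUF2_block:
  assumes "block_matrix \<psi>" "at_most_two (fv \<psi> - set (y # zs))"
  shows "Exs (y # zs) \<psi> \<in> SUF2"
proof -
  obtain U F V where U: "finite U" "\<forall>\<chi>\<in>U. \<chi> \<in> SUF2 \<and> at_most_one (fv \<chi>) \<and> fv \<chi> \<subseteq> fv \<psi>"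
    and F: "uniform V F" "V \<subseteq> fv \<psi>" "\<psi> \<in> bool_comb (F \<union> U)"
    using assms(1) unfolding block_matrix_def by blast
  obtain u v where "fv \<psi> - set (y # zs) \<subseteq> {u, v}" using assms(2) unfolding at_most_two_def by blast
  then have fv: "fv \<psi> \<subseteq> set (u # v # y # zs)" by auto
  have "Exs (drop 2 (u # v # y # zs)) \<psi> \<in> suf2_over full_vocab"
  proof (rule suf2_over.block[OF _ U(1) _ _ F(1) _ F(3)])
    show "\<forall>\<chi>\<in>U. \<chi> \<in> suf2_over full_vocab \<and> card (fv \<chi>) \<le> 1 \<and> fv \<chi> \<subseteq> set (u # v # y # zs)"
      using U(2) fv unfolding SUF2_def at_most_one_iff_card[OF finite_fv] by blast
    show "F \<subseteq> atoms full_vocab" using F(1) unfolding uniform_def by blast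
    show "V \<subseteq> set (u # v # y # zs)" using F(2) fv by blast
  qed auto
  then show ?thesis by (simp add: SUF2_def)
qed

lemma block_matrixI:
  assumes U: "finite U" "\<forall>\<chi>\<in>U. \<chi> \<in> SUF2 \<and> at_most_one (fv \<chi>) \<and> fv \<chi> \<subseteq> fv \<psi>"
    and \<psi>: "\<psi> \<in> bool_comb ({\<alpha>\<in>skeleton_atoms \<psi>. \<not> at_most_one (fv \<alpha>)} \<union> U)" and "is_matrix \<psi>" "uniform_skeleton \<psi>"
  shows "block_matrix \<psi>"
proof -
  let ?F = "{\<alpha>\<in>skeleton_atoms \<psi>. \<not> at_most_one (fv \<alpha>)}"
  have skeleton_atoms: "finite (skeleton_atoms \<phi>) \<and> (is_matrix \<phi> \<longrightarrow> skeleton_atoms \<phi> \<subseteq> atoms full_vocab) \<and> (\<forall>\<alpha>\<in>skeleton_atoms \<phi>. fv \<alpha> \<subseteq> fv \<phi>)" for \<phi>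
    by (induction \<phi>) auto
  obtain V where "\<forall>\<alpha>\<in>?F. fv \<alpha> = V" "V \<subseteq> fv \<psi>"
  proof (cases "?F = {}")
    case True
    then show ?thesis using that[of "{}"] by blast
  next
    case False
    then obtain \<alpha> where \<alpha>: "\<alpha> \<in> ?F" by blast
    then show ?thesis using that[of "fv \<alpha>"] \<open>uniform_skeleton \<psi>\<close> skeleton_atoms[of \<psi>] unfolding uniform_skeleton_def by blast
  qed
  moreover from this(1) have "uniform V ?F"
    using skeleton_atoms[of \<psi>] \<open>is_matrix \<psi>\<close> unfolding uniform_def by auto
  ultimately show ?thesis unfolding block_matrix_def using U \<psi> by blast
qed

text \<open>
  The decompositions of matrices and bodies are produced along with membership, because existential
  subformulae of a matrix need membership of smaller formulae and vice versa.
\<close>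

lemma SUF2_if_is_suf2_aux:
  "(is_suf2 \<phi> \<longrightarrow> \<phi> \<in> SUF2) \<and>
   (is_matrix \<phi> \<longrightarrow> (\<exists>U. finite U \<and> (\<forall>\<chi>\<in>U. \<chi> \<in> SUF2 \<and> at_most_one (fv \<chi>) \<and> fv \<chi> \<subseteq> fv \<phi>) \<and>
      \<phi> \<in> bool_comb ({\<alpha>\<in>skeleton_atoms \<phi>. \<not> at_most_one (fv \<alpha>)} \<union> U))) \<and>
   (is_body \<phi> \<longrightarrow> (\<exists>zs \<psi>. \<phi> = Exs zs \<psi> \<and> block_matrix \<psi>))"
  (is "?S \<phi> \<and> (is_matrix \<phi> \<longrightarrow> ?C \<phi>) \<and> (is_body \<phi> \<longrightarrow> ?B \<phi>)")
proof (induction \<phi>)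
  have unary: "?C \<chi>" if "\<chi> \<in> SUF2" "at_most_one (fv \<chi>)" for \<chi>
    using that by (intro exI[of _ "{\<chi>}"]) (auto intro: bool_comb.base)
  have B: "?B \<chi>" if "?C \<chi>" "is_matrix \<chi>" "uniform_skeleton \<chi>" for \<chi>
    using that block_matrixI[of _ \<chi>] by (intro exI[of _ "[]"] exI[of _ \<chi>]) auto
  {
    case Top
    have "Top \<in> SUF2" unfolding SUF2_def by (rule suf2_over.Top)
    then have "?C Top" by (intro unary) (auto simp: at_most_one_def)
    with \<open>Top \<in> SUF2\<close> show ?case using B[of Top] by auto
  next
    case Bot
    have "Bot \<in> SUF2" unfolding SUF2_def by (rule suf2_over.Bot)
    then have "?C Bot" by (intro unary) (auto simp: at_most_one_def)
    with \<open>Bot \<in> SUF2\<close> show ?case using B[of Bot] by auto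
  next
    case (Atom R ys)
    have S: "Atom R ys \<in> SUF2" if at: "Atom R ys \<in> atoms full_vocab" and "at_most_two (set ys)"
    proof -
      have "ys \<noteq> []" using at unfolding atoms_def full_vocab_def by auto
      then have "card (set ys) \<noteq> 0" by simp
      moreover have "card (set ys) \<le> 2" using that(2) by (simp add: at_most_two_iff_card)
      ultimately have "card (set ys) = 1 \<or> card (set ys) = 2" by linarith
      then show ?thesis unfolding SUF2_def using at by (intro suf2_over.atom) auto
    qed
    have C: "?C (Atom R ys)" if at: "Atom R ys \<in> atoms full_vocab"
    proof (cases "at_most_one (set ys)")
      case True
      then show ?thesis using S[OF at at_most_one_at_most_two] by (intro unary) auto
    next
      case False
      then show ?thesis by (intro exI[of _ "{}"]) (auto intro: bool_comb.base)
    qed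
    show ?case using S C B[of "Atom R ys"] by auto
  next
    case (Neg \<phi>)
    then have S: "?S (Neg \<phi>)" unfolding SUF2_def by (auto intro: suf2_over.Neg)
    have C: "is_matrix (Neg \<phi>) \<longrightarrow> ?C (Neg \<phi>)" using Neg by (auto intro: bool_comb.Neg)
    show ?case using S C B[of "Neg \<phi>"] is_bodyD[of "Neg \<phi>"] by blast
  next
    case (Conj \<phi> \<psi>)
    then have S: "?S (Conj \<phi> \<psi>)" unfolding SUF2_def by (auto intro: suf2_over.Conj)
    have C: "is_matrix (Conj \<phi> \<psi>) \<longrightarrow> ?C (Conj \<phi> \<psi>)"
    proof
      assume "is_matrix (Conj \<phi> \<psi>)"
      then obtain U W where
        U: "finite U" "\<forall>\<chi>\<in>U. \<chi> \<in> SUF2 \<and> at_most_one (fv \<chi>) \<and> fv \<chi> \<subseteq> fv \<phi>"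
          "\<phi> \<in> bool_comb ({\<alpha>\<in>skeleton_atoms \<phi>. \<not> at_most_one (fv \<alpha>)} \<union> U)" and
        W: "finite W" "\<forall>\<chi>\<in>W. \<chi> \<in> SUF2 \<and> at_most_one (fv \<chi>) \<and> fv \<chi> \<subseteq> fv \<psi>"
          "\<psi> \<in> bool_comb ({\<alpha>\<in>skeleton_atoms \<psi>. \<not> at_most_one (fv \<alpha>)} \<union> W)"
        using Conj by auto
      have "Conj \<phi> \<psi> \<in> bool_comb ({\<alpha>\<in>skeleton_atoms (Conj \<phi> \<psi>). \<not> at_most_one (fv \<alpha>)} \<union> (U \<union> W))"
        by (intro bool_comb.Conj bool_comb_mono[OF U(3)] bool_comb_mono[OF W(3)]) auto
      then show "?C (Conj \<phi> \<psi>)"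
        using U W by (intro exI[of _ "U \<union> W"]) auto
    qed
    show ?case using S C B[of "Conj \<phi> \<psi>"] is_bodyD[of "Conj \<phi> \<psi>"] by blast
  next
    case (Ex y \<phi>)
    have E: "?B (Ex y \<phi>)" if "is_body \<phi>"
    proof -
      obtain zs \<psi> where "\<phi> = Exs zs \<psi>" "block_matrix \<psi>" using Ex \<open>is_body \<phi>\<close> by blast
      then show ?thesis by (intro exI[of _ "y # zs"] exI[of _ \<psi>]) auto
    qed
    have is_body: "Ex y \<phi> \<in> SUF2" if b: "is_body \<phi>" "at_most_two (fv \<phi> - {y})"
    proof -
      obtain zs \<psi> where "\<phi> = Exs zs \<psi>" "block_matrix \<psi>" using Ex b(1) by blast
      moreover have "fv \<phi> - {y} = fv \<psi> - set (y # zs)"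
        unfolding \<open>\<phi> = Exs zs \<psi>\<close> fv_Exs by auto
      ultimately show ?thesis using SUF2_block[of \<psi> y zs] b(2) by simp
    qed
    have one: "Ex y \<phi> \<in> SUF2" if "at_most_one (fv \<phi> - {y})" "is_suf2 \<phi> \<or> is_body \<phi>"
      using that is_body SUF2_Ex[of \<phi> y] Ex at_most_one_at_most_two by blast
    have S: "?S (Ex y \<phi>)" using one is_body by auto
    have C: "is_matrix (Ex y \<phi>) \<longrightarrow> ?C (Ex y \<phi>)" using one unary[of "Ex y \<phi>"] by auto
    have "?B (Ex y \<phi>)" if "is_body (Ex y \<phi>)"
    proof (cases "is_body \<phi>")
      case False
      then have "is_matrix (Ex y \<phi>)" using that by simp
      moreover have "uniform_skeleton (Ex y \<phi>)" by (simp add: uniform_skeleton_def)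
      ultimately show ?thesis using B[of "Ex y \<phi>"] C by blast
    qed (rule E)
    then show ?case using S C by blast
  }
qed

lemma SUF2_iff_is_suf2: "\<phi> \<in> SUF2 \<longleftrightarrow> is_suf2 \<phi>"
  using is_suf2_if_SUF2 SUF2_if_is_suf2_aux by blast

lemma decidable_at_most_one:
  assumes "computable f" "computable g"
  shows "decidable (\<lambda>x. at_most_one (fv (decode (f x)) - {g x}))"
proof -
  have "at_most_one (fv (decode c) - {y}) \<longleftrightarrow> (\<exists>u<Suc c. \<forall>z<c. z \<in> fv (decode c) \<longrightarrow> z = y \<or> z = u)" for c y
  proof
    assume "at_most_one (fv (decode c) - {y})"
    then obtain u where u: "fv (decode c) - {y} \<subseteq> {u}" unfolding at_most_one_def by blast
    show "\<exists>u<Suc c. \<forall>z<c. z \<in> fv (decode c) \<longrightarrow> z = y \<or> z = u"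
    proof (cases "u \<in> fv (decode c)")
      case True
      then show ?thesis using u fv_decode_less[of u c] by (intro exI[of _ u]) auto
    next
      case False
      then show ?thesis using u by (intro exI[of _ 0]) auto
    qed
  next
    assume "\<exists>u<Suc c. \<forall>z<c. z \<in> fv (decode c) \<longrightarrow> z = y \<or> z = u"
    then show "at_most_one (fv (decode c) - {y})"
      using fv_decode_less[of _ c] unfolding at_most_one_def by blast
  qed
  moreover have "decidable (\<lambda>p. \<exists>u<Suc (pfst p). \<forall>z<pfst p. z \<in> fv (decode (pfst p)) \<longrightarrow> z = psnd p \<or> z = u)"
    by (intro computable_intros)
  from decidable_compose[OF this computable_pair[OF assms]] calculation show ?thesis by simp
qed

lemma decidable_at_most_two:
  assumes "computable f" "computable g"
  shows "decidable (\<lambda>x. at_most_two (fv (decode (f x)) - {g x}))"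
proof -
  have "at_most_two (fv (decode c) - {y}) \<longleftrightarrow>
    (\<exists>u<Suc c. \<exists>v<Suc c. \<forall>z<c. z \<in> fv (decode c) \<longrightarrow> z = y \<or> z = u \<or> z = v)" for c y
  proof
    assume "at_most_two (fv (decode c) - {y})"
    then obtain u v where u: "fv (decode c) - {y} \<subseteq> {u, v}" unfolding at_most_two_def by blast
    \<comment> \<open>Bounds that are not free variables are replaced by 0 to keep them below \<open>Suc c\<close>.\<close>
    let ?cut = "\<lambda>u. if u \<in> fv (decode c) then u else 0"
    show "\<exists>u<Suc c. \<exists>v<Suc c. \<forall>z<c. z \<in> fv (decode c) \<longrightarrow> z = y \<or> z = u \<or> z = v"
      using u fv_decode_less[of u c] fv_decode_less[of v c]
      by (intro exI[of _ "?cut u"] conjI exI[of _ "?cut v"]) auto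
  next
    assume "\<exists>u<Suc c. \<exists>v<Suc c. \<forall>z<c. z \<in> fv (decode c) \<longrightarrow> z = y \<or> z = u \<or> z = v"
    then obtain u v where "\<forall>z<c. z \<in> fv (decode c) \<longrightarrow> z = y \<or> z = u \<or> z = v" by blast
    then have "fv (decode c) - {y} \<subseteq> {u, v}" using fv_decode_less[of _ c] by blast
    then show "at_most_two (fv (decode c) - {y})" unfolding at_most_two_def by blast
  qed
  moreover have "decidable (\<lambda>p. \<exists>u<Suc (pfst p). \<exists>v<Suc (pfst p). \<forall>z<pfst p.
      z \<in> fv (decode (pfst p)) \<longrightarrow> z = psnd p \<or> z = u \<or> z = v)"
    by (intro computable_intros)
  from decidable_compose[OF this computable_pair[OF assms]] calculation show ?thesis by simp
qed

text \<open>
  Makes the quantification over skeleton atoms a bounded one.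
\<close>

lemma skeleton_atoms_decode: "\<alpha> \<in> skeleton_atoms (decode c) \<Longrightarrow> \<exists>a<Suc c. pfst a = 2 \<and> \<alpha> = decode a"
proof (induction c rule: less_induct)
  case (less c)
  have IH: "\<exists>a<Suc c. pfst a = 2 \<and> \<alpha> = decode a" if d: "d < c" "\<alpha> \<in> skeleton_atoms (decode d)" for d
  proof -
    obtain a where "a < Suc d" "pfst a = 2" "\<alpha> = decode a" using less.IH[OF d] by blast
    then show ?thesis using d(1) by (intro exI[of _ a]) auto
  qed
  show ?case
  proof (cases c rule: tag_cases)
    case 2
    then show ?thesis using less.prems by (intro exI[of _ c]) auto
  next
    case 3
    then show ?thesis using less.prems IH[of "psnd c"] psnd_less[of c] by auto
  next
    case 4
    then show ?thesis
      using less.prems IH[of "pfst (psnd c)"] IH[of "psnd (psnd c)"]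
        pfst_psnd_less[of c] psnd_psnd_less[of c] by auto
  qed (use less.prems in auto)
qed

lemma decode_atom_inject: "pfst a = 2 \<Longrightarrow> pfst c = 2 \<Longrightarrow> decode a = decode c \<longleftrightarrow> a = c"
proof -
  have "fm_encode (decode a) = a" if "pfst a = 2" for a
    using that by (simp add: pair_def[symmetric] pair_eq_conv)
  then show "pfst a = 2 \<Longrightarrow> pfst c = 2 \<Longrightarrow> decode a = decode c \<longleftrightarrow> a = c" by metis
qed

lemma decidable_skeleton_atoms:
  assumes "computable f" "computable g"
  shows "decidable (\<lambda>x. pfst (f x) = 2 \<and> decode (f x) \<in> skeleton_atoms (decode (g x)))"
proof -
  define S where "S Q p \<longleftrightarrow> pfst (pfst p) = 2 \<and> (
    (pfst (psnd p) = 2 \<and> pfst p = psnd p) \<or>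
    (pfst (psnd p) = 3 \<and> Q (pair (pfst p) (psnd (psnd p)))) \<or>
    (pfst (psnd p) = 4 \<and> (Q (pair (pfst p) (pfst (psnd (psnd p)))) \<or> Q (pair (pfst p) (psnd (psnd (psnd p)))))))"
    for Q p
  have "decidable (\<lambda>p. pfst (pfst p) = 2 \<and> decode (pfst p) \<in> skeleton_atoms (decode (psnd p)))"
  proof (rule decidable_course_of_values[where S = S])
    fix p
    have small: "pair (pfst p) b < p" if "b < psnd p" for b
      using pair_mono[OF that, of "pfst p"] by simp
    show "(pfst (pfst p) = 2 \<and> decode (pfst p) \<in> skeleton_atoms (decode (psnd p))) \<longleftrightarrow>
      S (\<lambda>j. j < p \<and> pfst (pfst j) = 2 \<and> decode (pfst j) \<in> skeleton_atoms (decode (psnd j))) p"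
    proof (cases "psnd p" rule: tag_cases)
      case 2
      have "decode (psnd p) = decode (pfst p) \<longleftrightarrow> psnd p = pfst p" if "pfst (pfst p) = 2"
        using decode_atom_inject 2 that by blast
      moreover have "skeleton_atoms (decode (psnd p)) = {decode (psnd p)}" using 2 by simp
      ultimately show ?thesis using 2 unfolding S_def by auto
    qed (auto simp: S_def small psnd_less pfst_psnd_less psnd_psnd_less simp del: decode_simps(2))
  next
    show "decidable (\<lambda>p. S (\<lambda>j. j < psnd p \<and> bit (pfst p) j) (psnd p))"
      unfolding S_def by (intro computable_intros)
  qed
  from decidable_compose[OF this computable_pair[OF assms]] show ?thesis by simp
qed

text \<open>
  A code is a variable that does not occur in its formula. Subtracting it makes \<open>decidable_at_most_one\<close>
  and \<open>decidable_at_most_two\<close> applicable to the set of all free variables.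
\<close>

lemma fv_decode_minus_self: "fv (decode c) - {c} = fv (decode c)"
  using fv_decode_less[of c c] by blast

lemma decidable_uniform_skeleton:
  assumes "computable f" shows "decidable (\<lambda>x. uniform_skeleton (decode (f x)))"
proof -
  have "uniform_skeleton (decode c) \<longleftrightarrow> (\<forall>a<Suc c. \<forall>b<Suc c.
    (pfst a = 2 \<and> decode a \<in> skeleton_atoms (decode c)) \<and> (pfst b = 2 \<and> decode b \<in> skeleton_atoms (decode c)) \<longrightarrow>
    \<not> at_most_one (fv (decode a) - {a}) \<longrightarrow> \<not> at_most_one (fv (decode b) - {b}) \<longrightarrow>
    (\<forall>z<Suc c. z \<in> fv (decode a) \<longleftrightarrow> z \<in> fv (decode b)))" (is "_ \<longleftrightarrow> ?R") for c
  proof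
    assume "uniform_skeleton (decode c)"
    then show ?R unfolding uniform_skeleton_def fv_decode_minus_self by blast
  next
    assume R: ?R
    show "uniform_skeleton (decode c)" unfolding uniform_skeleton_def
    proof (intro ballI impI)
      fix \<alpha> \<beta> assume at: "\<alpha> \<in> skeleton_atoms (decode c)" "\<beta> \<in> skeleton_atoms (decode c)"
        and s: "\<not> at_most_one (fv \<alpha>)" "\<not> at_most_one (fv \<beta>)"
      obtain a b where a: "a < Suc c" "pfst a = 2" "\<alpha> = decode a"
        and b: "b < Suc c" "pfst b = 2" "\<beta> = decode b"
        using at skeleton_atoms_decode by blast
      have "z < Suc c" if "z \<in> fv \<alpha> \<union> fv \<beta>" for z
        using that fv_decode_less[of z a] fv_decode_less[of z b] a b by auto
      moreover have "\<forall>z<Suc c. z \<in> fv \<alpha> \<longleftrightarrow> z \<in> fv \<beta>"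
        using R a b at s unfolding fv_decode_minus_self by blast
      ultimately show "fv \<alpha> = fv \<beta>" by blast
    qed
  qed
  moreover have "decidable (\<lambda>c. \<forall>a<Suc c. \<forall>b<Suc c.
    (pfst a = 2 \<and> decode a \<in> skeleton_atoms (decode c)) \<and> (pfst b = 2 \<and> decode b \<in> skeleton_atoms (decode c)) \<longrightarrow>
    \<not> at_most_one (fv (decode a) - {a}) \<longrightarrow> \<not> at_most_one (fv (decode b) - {b}) \<longrightarrow>
    (\<forall>z<Suc c. z \<in> fv (decode a) \<longleftrightarrow> z \<in> fv (decode b)))"
    by (intro decidable_skeleton_atoms decidable_at_most_one decidable_all decidable_imp decidable_not decidable_conj[OF decidable_skeleton_atoms decidable_skeleton_atoms] decidable_iff computable_intros)
  from decidable_compose[OF this assms] calculation show ?thesis by simp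
qed

lemma is_body_if_is_matrix: "(\<nexists>y \<psi>. \<phi> = Ex y \<psi>) \<Longrightarrow> is_body \<phi> \<longleftrightarrow> is_matrix \<phi> \<and> uniform_skeleton \<phi>"
  using is_bodyI is_bodyD by blast

text \<open>
  The three mutually recursive predicates are decided by one course-of-values recursion: index
  \<open>3 * c + t\<close> asks for the predicate number \<open>t\<close> of the formula with code \<open>c\<close>.
\<close>

lemma decidable_is_suf2: "decidable (\<lambda>c. is_suf2 (decode c))"
proof -
  define P where "P i \<longleftrightarrow> (if i mod 3 = 0 then is_suf2 (decode (i div 3))
    else if i mod 3 = 1 then is_matrix (decode (i div 3)) else is_body (decode (i div 3)))" for i
  define A where "A c \<longleftrightarrow> 0 < pfst (pfst (psnd c)) \<and>
    length (list_decode (psnd (psnd c))) = pfst (pfst (psnd c))" for c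
  define S where "S Q i \<longleftrightarrow>
    (let c = i div 3; l = psnd c; y = pfst l; d = psnd l in
     if i mod 3 = 0 then
       pfst c < 2 \<or> 5 < pfst c \<or> (pfst c = 2 \<and> A c \<and> at_most_two (fv (decode c) - {c})) \<or>
       (pfst c = 3 \<and> Q (3 * l)) \<or> (pfst c = 4 \<and> Q (3 * y) \<and> Q (3 * d)) \<or>
       (pfst c = 5 \<and> ((Q (3 * d) \<and> at_most_one (fv (decode d) - {y})) \<or>
         (at_most_two (fv (decode d) - {y}) \<and> Q (3 * d + 2))))
     else if i mod 3 = 1 then
       pfst c < 2 \<or> 5 < pfst c \<or> (pfst c = 2 \<and> A c) \<or>
       (pfst c = 3 \<and> Q (3 * l + 1)) \<or> (pfst c = 4 \<and> Q (3 * y + 1) \<and> Q (3 * d + 1)) \<or>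
       (pfst c = 5 \<and> at_most_one (fv (decode d) - {y}) \<and> (Q (3 * d) \<or> Q (3 * d + 2)))
     else
       (pfst c = 5 \<and> (Q (3 * d + 2) \<or> (at_most_one (fv (decode d) - {y}) \<and> (Q (3 * d) \<or> Q (3 * d + 2))))) \<or>
       (pfst c \<noteq> 5 \<and> Q (3 * c + 1) \<and> uniform_skeleton (decode c)))" for Q i
  have A: "Atom (Rel (pfst (pfst (psnd c))) k) (list_decode (psnd (psnd c))) \<in> atoms full_vocab \<longleftrightarrow> A c" for c k
    unfolding A_def atoms_def full_vocab_def by auto
  have P3: "P (3 * c) \<longleftrightarrow> is_suf2 (decode c)" "P (Suc (3 * c)) \<longleftrightarrow> is_matrix (decode c)"
    "P (Suc (Suc (3 * c))) \<longleftrightarrow> is_body (decode c)" for c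
  proof -
    have "Suc (3 * c) mod 3 = 1" "Suc (3 * c) div 3 = c"
      "Suc (Suc (3 * c)) mod 3 = 2" "Suc (Suc (3 * c)) div 3 = c" by presburger+
    then show "P (3 * c) \<longleftrightarrow> is_suf2 (decode c)" "P (Suc (3 * c)) \<longleftrightarrow> is_matrix (decode c)"
      "P (Suc (Suc (3 * c))) \<longleftrightarrow> is_body (decode c)"
      unfolding P_def by simp_all
  qed
  have "P i \<longleftrightarrow> S (\<lambda>j. j < i \<and> P j) i" for i
  proof -
    define c where "c = i div 3"
    have less: "3 * d < i" "Suc (3 * d) < i" "Suc (Suc (3 * d)) < i" if "d < c" for d
      using that unfolding c_def by linarith+
    have l: "pfst c \<noteq> 0 \<Longrightarrow> psnd c < c" "pfst c \<noteq> 0 \<Longrightarrow> pfst (psnd c) < c"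
      "pfst c \<noteq> 0 \<Longrightarrow> psnd (psnd c) < c"
      by (simp_all add: psnd_less pfst_psnd_less psnd_psnd_less)
    have i: "i = 3 * c + i mod 3" "i mod 3 < 3" unfolding c_def by simp_all
    consider "i mod 3 = 0" | "i mod 3 = 1" | "i mod 3 = 2" by linarith
    then show ?thesis
    proof cases
      case 1
      then show ?thesis
        unfolding S_def Let_def c_def[symmetric] fv_decode_minus_self using l less P3(1)[of c] i
        by (cases c rule: tag_cases) (auto simp: P3 A)
    next
      case 2
      then show ?thesis
        unfolding S_def Let_def c_def[symmetric] using l less P3(2)[of c] i
        by (cases c rule: tag_cases) (auto simp: P3 A)
    next
      case 3
      then have "Suc (3 * c) < i" "P i \<longleftrightarrow> is_body (decode c)" using i P3(3)[of c] by auto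
      then show ?thesis
        unfolding S_def Let_def c_def[symmetric] using l less 3
        by (cases c rule: tag_cases) (auto simp: P3 A is_body_if_is_matrix)
    qed
  qed
  moreover have "decidable (\<lambda>p. S (\<lambda>j. j < psnd p \<and> bit (pfst p) j) (psnd p))"
    unfolding S_def A_def Let_def by (intro computable_intros decidable_at_most_one decidable_at_most_two decidable_uniform_skeleton) simp_all
  ultimately have "decidable P" by (rule decidable_course_of_values)
  moreover have "computable (\<lambda>c. 3 * c)" by (intro computable_intros)
  ultimately have "decidable (\<lambda>c. P (3 * c))" by (rule decidable_compose)
  then show ?thesis by (simp add: P3)
qed

section \<open>Satisfiability as a \<open>\<Pi>\<^sup>0\<^sub>1\<close> property\<close>

lemma decidable_relI:
  assumes "decidable (\<lambda>p. R (pfst p) (psnd p))" shows "decidable_rel R"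
proof -
  have "recursive_ext 2 (\<lambda>xs. of_bool (R (pfst (pair (xs ! 0) (xs ! 1))) (psnd (pair (xs ! 0) (xs ! 1)))))"
    by (intro recursive_ext_computable[OF assms[unfolded decidable_def]] recursive_ext_pair recursive_ext_proj) auto
  then obtain g where "recursive 2 g" and g: "\<forall>xs. length xs = 2 \<longrightarrow> of_bool (R (xs ! 0) (xs ! 1)) = g xs"
    unfolding recursive_ext_def pfst_pair psnd_pair by (elim exE conjE)
  moreover have "g [x, y] = (if R x y then 1 else 0)" for x y
    using g[rule_format, of "[x, y]"] by (cases "R x y") simp_all
  ultimately show ?thesis unfolding decidable_rel_def by blast
qed

text \<open>
  Compactness of the Cantor space, by thinning out the stages: \<open>S n\<close> is an infinite set of stages
  whose bit patterns agree below \<open>n\<close>.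
\<close>

lemma koenig_bits:
  assumes "\<And>n. \<exists>w::nat. \<forall>i<n. \<forall>j<n. \<forall>k<n. C i j k (bit w i) (bit w j) (bit w k)"
  shows "\<exists>W. \<forall>i j k. C i j k (W i) (W j) (W k)"
proof -
  obtain w :: "nat \<Rightarrow> nat" where
    w: "\<And>n i j k. i < n \<Longrightarrow> j < n \<Longrightarrow> k < n \<Longrightarrow> C i j k (bit (w n) i) (bit (w n) j) (bit (w n) k)"
    using assms by metis
  define P where "P n S \<longleftrightarrow> infinite S \<and> (\<forall>i<n. \<forall>a\<in>S. \<forall>b\<in>S. bit (w a) i = bit (w b) i)"
    for n :: nat and S :: "nat set"
  have step: "\<exists>T. P (Suc n) T \<and> T \<subseteq> S" if "P n S" for n S
  proof -
    have "S = {a\<in>S. bit (w a) n} \<union> {a\<in>S. \<not> bit (w a) n}" by blast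
    then have "infinite {a\<in>S. bit (w a) n} \<or> infinite {a\<in>S. \<not> bit (w a) n}"
      using \<open>P n S\<close> unfolding P_def by (metis finite_Un)
    then show ?thesis
    proof
      assume "infinite {a\<in>S. bit (w a) n}"
      then show ?thesis using \<open>P n S\<close> unfolding P_def
        by (intro exI[of _ "{a\<in>S. bit (w a) n}"]) (auto simp: less_Suc_eq)
    next
      assume "infinite {a\<in>S. \<not> bit (w a) n}"
      then show ?thesis using \<open>P n S\<close> unfolding P_def
        by (intro exI[of _ "{a\<in>S. \<not> bit (w a) n}"]) (auto simp: less_Suc_eq)
    qed
  qed
  have "P 0 UNIV" unfolding P_def by simp
  obtain S where S: "\<And>n. P n (S n)" "\<And>n. S (Suc n) \<subseteq> S n"
    using dependent_nat_choice[of P "\<lambda>n S T. T \<subseteq> S"] \<open>P 0 UNIV\<close> step by blast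
  have mono: "S n \<subseteq> S m" if "m \<le> n" for m n
    using that by (induction rule: dec_induct) (use S(2) in auto)
  define W where "W i \<longleftrightarrow> (\<exists>a\<in>S (Suc i). bit (w a) i)" for i
  have W: "W i \<longleftrightarrow> bit (w a) i" if "a \<in> S m" "i < m" for a i m
  proof -
    have "a \<in> S (Suc i)" using mono[of "Suc i" m] that by auto
    then show ?thesis using S(1)[of "Suc i"] unfolding W_def P_def by blast
  qed
  have "C i j k (W i) (W j) (W k)" for i j k
  proof -
    define m where "m = Suc (i + j + k)"
    obtain a where a: "a \<in> S m" "a \<ge> m"
      using S(1)[of m] unfolding P_def by (meson infinite_nat_iff_unbounded_le)
    have "i < m" "j < m" "k < m" unfolding m_def by auto
    then show ?thesis using W[OF a(1)] w[of i a j k] a(2) by simp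
  qed
  then show ?thesis by blast
qed

text \<open>
  An environment is a number read as an infinite sequence by iterated unpairing. Every finite
  modification of a sequence of this kind is again one (\<open>env_update\<close>), and the entries never exceed
  the number itself (\<open>env_le\<close>).
\<close>

definition env :: "nat \<Rightarrow> nat \<Rightarrow> nat" where "env e z = pfst ((psnd ^^ z) e)"

lemma env_pair [simp]: "env (pair a b) 0 = a" "env (pair a b) (Suc z) = env b z"
  by (simp_all add: env_def funpow_swap1)

lemma env_0: "env e 0 = pfst e"
  by (simp add: env_def)

lemma env_Suc: "env e (Suc z) = env (psnd e) z"
  by (simp add: env_def funpow_swap1)

lemma env_le: "env e z \<le> e"
proof (induction z arbitrary: e)
  case 0 then show ?case by (simp add: env_def pfst_le)
next
  case (Suc z)
  then show ?case using psnd_le[of e] unfolding env_Suc by (meson order_trans)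
qed

lemma env_update: "\<exists>e'. env e' = (env e)(y := n)"
proof (induction y arbitrary: e)
  case 0
  have "env (pair n (psnd e)) z = ((env e)(0 := n)) z" for z
    by (cases z) (auto simp: env_Suc)
  then show ?case by blast
next
  case (Suc y)
  obtain e' where e': "env e' = (env (psnd e))(y := n)" using Suc by blast
  have "env (pair (pfst e) e') z = ((env e)(Suc y := n)) z" for z
    by (cases z) (auto simp: env_0 env_Suc e')
  then show ?case by blast
qed

lemma env_prefix: "\<exists>e. \<forall>z<m. env e z = f z"
proof (induction m)
  case (Suc m)
  then obtain e where e: "\<forall>z<m. env e z = f z" by blast
  obtain e' where "env e' = (env e)(m := f m)" using env_update by blast
  with e show ?case by (intro exI[of _ e']) (auto simp: less_Suc_eq)
qed simp

lemma holds_cong: "(\<And>z. z \<in> fv \<phi> \<Longrightarrow> s z = t z) \<Longrightarrow> holds M s \<phi> \<longleftrightarrow> holds M t \<phi>"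
proof (induction \<phi> arbitrary: s t)
  case (Atom R ys)
  then have "map s ys = map t ys" by simp
  then show ?case by (simp only: holds.simps)
next
  case (Ex y \<phi>)
  have "holds M (s(y := d)) \<phi> \<longleftrightarrow> holds M (t(y := d)) \<phi>" for d
    by (rule Ex.IH) (use Ex.prems in auto)
  then show ?case by simp
next
  case (Conj \<phi> \<psi>)
  have "holds M s \<phi> \<longleftrightarrow> holds M t \<phi>" by (rule Conj.IH) (use Conj.prems in auto)
  moreover have "holds M s \<psi> \<longleftrightarrow> holds M t \<psi>" by (rule Conj.IH) (use Conj.prems in auto)
  ultimately show ?case by simp
next
  case (Neg \<phi>)
  have "holds M s \<phi> \<longleftrightarrow> holds M t \<phi>" by (rule Neg.IH) (use Neg.prems in auto)
  then show ?case by simp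
qed auto

definition same_args :: "nat \<Rightarrow> nat \<Rightarrow> nat \<Rightarrow> nat \<Rightarrow> bool" where
  "same_args e l e' l' \<longleftrightarrow> (\<forall>n<Suc (l + l'). (ldrop n l = 0 \<longleftrightarrow> ldrop n l' = 0) \<and>
    (ldrop n l \<noteq> 0 \<longrightarrow> env e (lnth l n) = env e' (lnth l' n)))"

lemma same_args_iff:
  "same_args e l e' l' \<longleftrightarrow> map (env e) (list_decode l) = map (env e') (list_decode l')"
proof
  assume *: "map (env e) (list_decode l) = map (env e') (list_decode l')"
  then have len: "length (list_decode l) = length (list_decode l')" by (rule map_eq_imp_length_eq)
  have "env e (lnth l n) = env e' (lnth l' n)" if "ldrop n l \<noteq> 0" for n
  proof -
    have n: "n < length (list_decode l)" using that by (simp add: ldrop_eq_0_iff)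
    then have "map (env e) (list_decode l) ! n = map (env e') (list_decode l') ! n" using * by simp
    then show ?thesis using n len by (simp add: lnth_eq)
  qed
  then show "same_args e l e' l'" unfolding same_args_def by (simp add: ldrop_eq_0_iff len)
next
  assume *: "same_args e l e' l'"
  have iff: "length (list_decode l) \<le> n \<longleftrightarrow> length (list_decode l') \<le> n" if "n < Suc (l + l')" for n
    using * that unfolding same_args_def by (simp add: ldrop_eq_0_iff)
  have "length (list_decode l) = length (list_decode l')"
    using iff[of "length (list_decode l)"] iff[of "length (list_decode l')"]
      list_decode_bounds(1)[of l] list_decode_bounds(1)[of l'] by auto
  moreover have "env e (list_decode l ! n) = env e' (list_decode l' ! n)" if "n < length (list_decode l)" for n
  proof -
    have "n < Suc (l + l')" "ldrop n l \<noteq> 0"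
      using that list_decode_bounds(1)[of l] by (auto simp: ldrop_eq_0_iff)
    then have "env e (lnth l n) = env e' (lnth l' n)" using * unfolding same_args_def by blast
    then show ?thesis using that calculation by (simp add: lnth_eq)
  qed
  ultimately show "map (env e) (list_decode l) = map (env e') (list_decode l')"
    by (intro nth_equalityI) auto
qed

text \<open>
  Index \<open>i\<close> stands for the environment \<open>pfst i\<close> together with the formula \<open>psnd i\<close>, and \<open>p\<close>, \<open>q\<close>, \<open>r\<close> are
  the truth values at the indices \<open>i\<close>, \<open>j\<close>, \<open>k\<close>. For an existential formula, \<open>j\<close> holds its matrix in an
  environment that differs at the bound variable only; the name reserved for the witness of \<open>i\<close> is
  \<open>Suc (2 * i)\<close>. Even names are left for the free variables of the formula \<open>x\<close> itself.
\<close>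

definition truth_constraint :: "nat \<Rightarrow> nat \<Rightarrow> nat \<Rightarrow> nat \<Rightarrow> bool \<Rightarrow> bool \<Rightarrow> bool \<Rightarrow> bool" where
  "truth_constraint x i j k p q r \<longleftrightarrow>
    (pfst (psnd i) = 0 \<or> 5 < pfst (psnd i) \<longrightarrow> p) \<and>
    (pfst (psnd i) = 1 \<longrightarrow> \<not> p) \<and>
    (pfst (psnd i) = 2 \<and> pfst (psnd j) = 2 \<and> pfst (psnd (psnd i)) = pfst (psnd (psnd j)) \<and>
      same_args (pfst i) (psnd (psnd (psnd i))) (pfst j) (psnd (psnd (psnd j))) \<longrightarrow> p = q) \<and>
    (pfst (psnd i) = 3 \<and> j = pair (pfst i) (psnd (psnd i)) \<longrightarrow> p = (\<not> q)) \<and>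
    (pfst (psnd i) = 4 \<and> j = pair (pfst i) (pfst (psnd (psnd i))) \<and>
      k = pair (pfst i) (psnd (psnd (psnd i))) \<longrightarrow> p = (q \<and> r)) \<and>
    (pfst (psnd i) = 5 \<and> psnd j = psnd (psnd (psnd i)) \<and>
      (\<forall>z<psnd j. z \<noteq> pfst (psnd (psnd i)) \<longrightarrow> env (pfst j) z = env (pfst i) z) \<longrightarrow>
      (q \<longrightarrow> p) \<and> (env (pfst j) (pfst (psnd (psnd i))) = Suc (2 * i) \<and> p \<longrightarrow> q)) \<and>
    (psnd i = x \<and> (\<forall>z<x. env (pfst i) z = 2 * z) \<longrightarrow> p)"

context
  fixes M :: "nat struct" and s :: "nat \<Rightarrow> nat"
begin

text \<open>
  Evaluation of names in a given model. The recursion is well-founded since all names in the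
  environment of \<open>i\<close> are at most \<open>i\<close>, hence smaller than the witness name \<open>Suc (2 * i)\<close>.
\<close>

function name_val :: "nat \<Rightarrow> nat" where
  "name_val n = (if even n then s (n div 2) else
    (let i = n div 2; y = pfst (psnd (psnd i)); \<psi> = decode (psnd (psnd (psnd i)));
         f = (\<lambda>z. name_val (env (pfst i) z))
     in if \<exists>d\<in>universe M. holds M (f(y := d)) \<psi>
        then SOME d. d \<in> universe M \<and> holds M (f(y := d)) \<psi> else s 0))"
  by pat_completeness auto
termination
proof (relation "measure id")
  fix n z x :: nat
  assume "odd n" "x = n div 2"
  then have "env (pfst x) z \<le> n div 2" using env_le[of "pfst x" z] pfst_le[of x] by linarith
  moreover have "n div 2 < n" using \<open>odd n\<close> by (intro div_less_dividend) (auto intro: Nat.gr0I)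
  ultimately show "(env (pfst x) z, n) \<in> measure id" by simp
qed simp

declare name_val.simps [simp del]

lemma name_val_var: "name_val (2 * z) = s z"
  by (subst name_val.simps) simp

lemma name_val_henkin:
  "name_val (Suc (2 * i)) =
    (let f = (\<lambda>z. name_val (env (pfst i) z)) in
     if \<exists>d\<in>universe M. holds M (f(pfst (psnd (psnd i)) := d)) (decode (psnd (psnd (psnd i))))
     then SOME d. d \<in> universe M \<and> holds M (f(pfst (psnd (psnd i)) := d)) (decode (psnd (psnd (psnd i))))
     else s 0)"
proof -
  have "Suc (2 * i) div 2 = i" "odd (Suc (2 * i))" by simp_all
  then show ?thesis by (subst name_val.simps) (simp only: if_False Let_def not_True_eq_False)
qed

lemma name_val_in_universe: "range s \<subseteq> universe M \<Longrightarrow> name_val n \<in> universe M"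
proof (cases "even n")
  case True
  assume "range s \<subseteq> universe M"
  then show ?thesis using True name_val_var[of "n div 2"] by auto
next
  case False
  assume s: "range s \<subseteq> universe M"
  obtain i where n: "n = Suc (2 * i)" using False by (metis oddE Suc_eq_plus1)
  show ?thesis
  proof (cases "\<exists>d\<in>universe M. holds M ((\<lambda>z. name_val (env (pfst i) z))(pfst (psnd (psnd i)) := d)) (decode (psnd (psnd (psnd i))))")
    case True
    from someI_ex[OF this[unfolded Bex_def]] True
    show ?thesis unfolding n name_val_henkin Let_def by simp
  next
    case False
    then show ?thesis using s unfolding n name_val_henkin Let_def by auto
  qed
qed

text \<open>
  The truth table of a model: indices are evaluated by way of \<open>name_val\<close>.
\<close>

lemma truth_constraints_if_holds:
  assumes s: "range s \<subseteq> universe M" and x: "holds M s (decode x)"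
    and W: "\<And>i. W i \<longleftrightarrow> holds M (\<lambda>z. name_val (env (pfst i) z)) (decode (psnd i))"
  shows "truth_constraint x i j k (W i) (W j) (W k)"
proof -
  let ?f = "\<lambda>i z. name_val (env (pfst i) z)"
  have atom: "W i = W j" if t: "pfst (psnd i) = 2" "pfst (psnd j) = 2"
    and R: "pfst (psnd (psnd i)) = pfst (psnd (psnd j))"
    and args: "same_args (pfst i) (psnd (psnd (psnd i))) (pfst j) (psnd (psnd (psnd j)))"
  proof -
    have "map (?f e) ys = map name_val (map (env (pfst e)) ys)" for e ys by simp
    then have "map (?f i) (list_decode (psnd (psnd (psnd i)))) = map (?f j) (list_decode (psnd (psnd (psnd j))))"
      using args unfolding same_args_iff by (simp only:)
    then show ?thesis unfolding W using t R by simp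
  qed
  have ex: "(W j \<longrightarrow> W i) \<and> (env (pfst j) (pfst (psnd (psnd i))) = Suc (2 * i) \<and> W i \<longrightarrow> W j)"
    if t: "pfst (psnd i) = 5" "psnd j = psnd (psnd (psnd i))"
      and agree: "\<forall>z<psnd j. z \<noteq> pfst (psnd (psnd i)) \<longrightarrow> env (pfst j) z = env (pfst i) z"
  proof -
    let ?y = "pfst (psnd (psnd i))" and ?\<psi> = "decode (psnd j)"
    have Wj: "W j \<longleftrightarrow> holds M ((?f i)(?y := ?f j ?y)) ?\<psi>"
      unfolding W by (rule holds_cong) (use agree fv_decode_less in auto)
    have Wi: "W i \<longleftrightarrow> (\<exists>d\<in>universe M. holds M ((?f i)(?y := d)) ?\<psi>)"
      unfolding W using t by simp
    have "W j \<longrightarrow> W i" unfolding Wj Wi using name_val_in_universe[OF s] by blast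
    moreover have "W j" if h: "env (pfst j) ?y = Suc (2 * i)" and "W i"
    proof -
      have ex: "\<exists>d\<in>universe M. holds M ((?f i)(?y := d)) ?\<psi>" using \<open>W i\<close> Wi by blast
      have "?f j ?y = (SOME d. d \<in> universe M \<and> holds M ((?f i)(?y := d)) ?\<psi>)"
        unfolding h name_val_henkin Let_def t(2)[symmetric] by (simp only: ex if_True)
      then show ?thesis unfolding Wj using someI_ex[OF ex[unfolded Bex_def]] by simp
    qed
    ultimately show ?thesis by blast
  qed
  have init: "W i" if "psnd i = x" "\<forall>z<x. env (pfst i) z = 2 * z"
  proof -
    have "W i \<longleftrightarrow> holds M s (decode x)"
      unfolding W that(1) by (rule holds_cong) (use that(2) fv_decode_less name_val_var in auto)
    then show ?thesis using x by simp
  qed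
  have "W i = (\<not> W j)" if "pfst (psnd i) = 3" "j = pair (pfst i) (psnd (psnd i))"
    unfolding W using that by simp
  moreover have "W i = (W j \<and> W k)" if "pfst (psnd i) = 4" "j = pair (pfst i) (pfst (psnd (psnd i)))"
    "k = pair (pfst i) (psnd (psnd (psnd i)))"
    unfolding W using that by simp
  moreover have "W i" if "pfst (psnd i) = 0 \<or> 5 < pfst (psnd i)"
    unfolding W using that by simp
  moreover have "\<not> W i" if "pfst (psnd i) = 1"
    unfolding W using that by simp
  ultimately show ?thesis unfolding truth_constraint_def using atom ex init by blast
qed

end

primrec proper :: "fm \<Rightarrow> bool" where
  "proper Top = True"
| "proper Bot = True"
| "proper (Atom R ys) = (length ys = arity R)"
| "proper (Neg \<phi>) = proper \<phi>"
| "proper (Conj \<phi> \<psi>) = (proper \<phi> \<and> proper \<psi>)"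
| "proper (Ex y \<phi>) = proper \<phi>"

lemma proper_if_is_suf2: "is_suf2 \<phi> \<or> is_matrix \<phi> \<or> is_body \<phi> \<Longrightarrow> proper \<phi>"
  by (induction \<phi>) (auto simp: atoms_def)

text \<open>
  The term model of a table: names denote themselves. The constraint on atoms ensures that the
  relations do not depend on the atom and environment that a tuple is read off from.
\<close>

definition table_model :: "(nat \<Rightarrow> bool) \<Rightarrow> nat struct" where
  "table_model W = \<lparr>universe = UNIV, rel = (\<lambda>R. case R of Rel a n \<Rightarrow>
    {map (env e) (list_decode l) | e l. length (list_decode l) = a \<and>
      W (pair e (pair 2 (pair (pair a n) l)))})\<rparr>"

lemma table_model_structure: "is_structure (table_model W)"
  unfolding is_structure_def table_model_def by (auto split: rsym.splits)

lemma holds_table_model: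
  assumes W: "\<And>i j k. truth_constraint x i j k (W i) (W j) (W k)"
  shows "proper (decode c) \<Longrightarrow> W (pair e c) \<longleftrightarrow> holds (table_model W) (env e) (decode c)"
proof (induction c arbitrary: e rule: less_induct)
  case (less c)
  have u: "universe (table_model W) = UNIV" by (simp add: table_model_def)
  show ?case
  proof (cases c rule: tag_cases)
    case 1
    then show ?thesis using W[of "pair e c"] unfolding truth_constraint_def by simp
  next
    case 2
    let ?l = "psnd (psnd c)" and ?r = "pfst (psnd c)"
    have c: "pair 2 (pair ?r ?l) = c" using 2 by (simp add: pair_eq_conv)
    have len: "length (list_decode ?l) = pfst ?r" using less.prems 2 by simp
    have "holds (table_model W) (env e) (decode c) \<longleftrightarrow>
      (\<exists>e' l. map (env e) (list_decode ?l) = map (env e') (list_decode l) \<and>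
        length (list_decode l) = pfst ?r \<and> W (pair e' (pair 2 (pair ?r l))))"
      using 2 by (simp add: table_model_def)
    also have "\<dots> \<longleftrightarrow> W (pair e c)"
    proof
      assume "\<exists>e' l. map (env e) (list_decode ?l) = map (env e') (list_decode l) \<and>
        length (list_decode l) = pfst ?r \<and> W (pair e' (pair 2 (pair ?r l)))"
      then obtain e' l where "map (env e) (list_decode ?l) = map (env e') (list_decode l)"
        and w: "W (pair e' (pair 2 (pair ?r l)))" by blast
      then have "same_args e ?l e' l" unfolding same_args_iff by blast
      then have "W (pair e c) = W (pair e' (pair 2 (pair ?r l)))"
        using W[of "pair e c" "pair e' (pair 2 (pair ?r l))"] 2 unfolding truth_constraint_def by simp
      then show "W (pair e c)" using w by simp
    next
      assume "W (pair e c)"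
      then show "\<exists>e' l. map (env e) (list_decode ?l) = map (env e') (list_decode l) \<and>
        length (list_decode l) = pfst ?r \<and> W (pair e' (pair 2 (pair ?r l)))"
        using c len by (intro exI[of _ e] exI[of _ ?l]) simp
    qed
    finally show ?thesis by (rule sym)
  next
    case 3
    then have "W (pair e c) = (\<not> W (pair e (psnd c)))"
      using W[of "pair e c" "pair e (psnd c)"] unfolding truth_constraint_def by simp
    then show ?thesis using 3 less.IH[of "psnd c" e] less.prems psnd_less[of c] by simp
  next
    case 4
    then have "W (pair e c) = (W (pair e (pfst (psnd c))) \<and> W (pair e (psnd (psnd c))))"
      using W[of "pair e c" "pair e (pfst (psnd c))" "pair e (psnd (psnd c))"]
      unfolding truth_constraint_def by simp
    then show ?thesis
      using 4 less.IH[of "pfst (psnd c)" e] less.IH[of "psnd (psnd c)" e] less.prems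
        pfst_psnd_less[of c] psnd_psnd_less[of c] by simp
  next
    case 5
    let ?y = "pfst (psnd c)" and ?d = "psnd (psnd c)"
    have IH: "W (pair e' ?d) \<longleftrightarrow> holds (table_model W) (env e') (decode ?d)" for e'
      using 5 less.IH[of ?d e'] less.prems psnd_psnd_less[of c] by simp
    have C: "(W (pair e' ?d) \<longrightarrow> W (pair e c)) \<and> (n = Suc (2 * pair e c) \<and> W (pair e c) \<longrightarrow> W (pair e' ?d))"
      if "env e' = (env e)(?y := n)" for e' n
      using W[of "pair e c" "pair e' ?d"] 5 that unfolding truth_constraint_def by simp
    have "W (pair e c) \<longleftrightarrow> (\<exists>n. holds (table_model W) ((env e)(?y := n)) (decode ?d))"
    proof
      assume w: "W (pair e c)"
      obtain e' where e': "env e' = (env e)(?y := Suc (2 * pair e c))" using env_update by blast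
      show "\<exists>n. holds (table_model W) ((env e)(?y := n)) (decode ?d)"
        using C[OF e'] w IH[of e'] unfolding e' by blast
    next
      assume "\<exists>n. holds (table_model W) ((env e)(?y := n)) (decode ?d)"
      then obtain n where n: "holds (table_model W) ((env e)(?y := n)) (decode ?d)" by blast
      obtain e' where e': "env e' = (env e)(?y := n)" using env_update by blast
      show "W (pair e c)" using C[OF e'] n IH[of e'] unfolding e' by blast
    qed
    then show ?thesis using 5 u by simp
  next
    case 6
    then show ?thesis using W[of "pair e c"] unfolding truth_constraint_def by simp
  qed
qed

lemma satisfiable_iff_bits:
  assumes "is_suf2 (decode x)"
  shows "satisfiable TYPE(nat) (decode x) \<longleftrightarrow>
    (\<forall>n. \<exists>w<(2::nat) ^ n. \<forall>i<n. \<forall>j<n. \<forall>k<n. truth_constraint x i j k (bit w i) (bit w j) (bit w k))"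
    (is "_ \<longleftrightarrow> ?R")
proof
  assume "satisfiable TYPE(nat) (decode x)"
  then obtain M :: "nat struct" and s where s: "range s \<subseteq> universe M" and x: "holds M s (decode x)"
    unfolding satisfiable_def by blast
  define W where "W i \<longleftrightarrow> holds M (\<lambda>z. name_val M s (env (pfst i) z)) (decode (psnd i))" for i
  have W: "truth_constraint x i j k (W i) (W j) (W k)" for i j k
    by (rule truth_constraints_if_holds[OF s x W_def])
  show ?R
  proof
    fix n
    obtain w :: nat where "w < 2 ^ n" "\<forall>i<n. bit w i \<longleftrightarrow> W i" using ex_bits by blast
    then show "\<exists>w<(2::nat) ^ n. \<forall>i<n. \<forall>j<n. \<forall>k<n. truth_constraint x i j k (bit w i) (bit w j) (bit w k)"
      using W by (intro exI[of _ w]) auto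
  qed
next
  assume ?R
  then have "\<exists>W. \<forall>i j k. truth_constraint x i j k (W i) (W j) (W k)"
    by (intro koenig_bits) blast
  then obtain W where W: "\<And>i j k. truth_constraint x i j k (W i) (W j) (W k)" by blast
  obtain e where e: "\<forall>z<x. env e z = 2 * z" using env_prefix[of x "\<lambda>z. 2 * z"] by blast
  have "W (pair e x)" using W[of "pair e x"] e unfolding truth_constraint_def by simp
  then have "holds (table_model W) (env e) (decode x)"
    using holds_table_model[OF W] assms proper_if_is_suf2 by blast
  moreover have "range (env e) \<subseteq> universe (table_model W)" by (simp add: table_model_def)
  ultimately show "satisfiable TYPE(nat) (decode x)"
    unfolding satisfiable_def using table_model_structure by blast
qed

lemma computable_env [computable_intros]:
  "computable f \<Longrightarrow> computable g \<Longrightarrow> computable (\<lambda>x. env (f x) (g x))"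
  unfolding env_def by (intro computable_intros)

theorem Pi01_SUF2_SAT:
  assumes "infinite (UNIV :: 'a set)"
  shows "Pi01 (SUF2_SAT TYPE('a))"
proof -
  define R where "R x n \<longleftrightarrow> fm_encode (decode x) = x \<and> is_suf2 (decode x) \<and>
    (\<exists>w<(2::nat) ^ n. \<forall>i<n. \<forall>j<n. \<forall>k<n. truth_constraint x i j k (bit w i) (bit w j) (bit w k))" for x n
  have sat: "satisfiable TYPE('a) \<phi> \<longleftrightarrow> satisfiable TYPE(nat) \<phi>" for \<phi>
    by (intro iffI) (erule satisfiable_transfer[OF infinite_UNIV_nat] satisfiable_transfer[OF assms])+
  have "x \<in> SUF2_SAT TYPE('a) \<longleftrightarrow>
      fm_encode (decode x) = x \<and> is_suf2 (decode x) \<and> satisfiable TYPE(nat) (decode x)" for x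
  proof
    assume "x \<in> SUF2_SAT TYPE('a)"
    then obtain \<phi> where "\<phi> \<in> SUF2" "satisfiable TYPE('a) \<phi>" "x = fm_encode \<phi>"
      unfolding SUF2_SAT_def by blast
    then show "fm_encode (decode x) = x \<and> is_suf2 (decode x) \<and> satisfiable TYPE(nat) (decode x)"
      by (simp add: decode_fm_encode sat SUF2_iff_is_suf2)
  next
    assume *: "fm_encode (decode x) = x \<and> is_suf2 (decode x) \<and> satisfiable TYPE(nat) (decode x)"
    then have "fm_encode (decode x) \<in> SUF2_SAT TYPE('a)"
      unfolding SUF2_SAT_def by (intro imageI) (simp add: sat SUF2_iff_is_suf2)
    then show "x \<in> SUF2_SAT TYPE('a)" using * by simp
  qed
  then have "SUF2_SAT TYPE('a) = {x. \<forall>n. R x n}"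
    unfolding R_def using satisfiable_iff_bits by blast
  moreover have "decidable_rel R"
  proof (rule decidable_relI)
    show "decidable (\<lambda>p. R (pfst p) (psnd p))"
      unfolding R_def truth_constraint_def same_args_def
      by (intro computable_intros decidable_compose[OF decidable_is_code] decidable_compose[OF decidable_is_suf2])
  qed
  ultimately show ?thesis unfolding Pi01_def by blast
qed

section \<open>Recursive functions as Horn clauses\<close>

text \<open>
  Unary functions on numbers, where a number doubles as the list that it codes as a stream. This
  removes arities from the syntax; they reappear in \<open>sound_num\<close> and \<open>sound_list\<close>.
\<close>

datatype rec_term = ZeroT | SuccT | HeadT | TailT | ConsT rec_term rec_term | CompT rec_term rec_term | PrimT rec_term rec_term | MinT rec_term

primrec sem :: "rec_term \<Rightarrow> nat \<Rightarrow> nat" where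
  "sem ZeroT p = 0"
| "sem SuccT p = Suc p"
| "sem HeadT p = pfst p"
| "sem TailT p = psnd p"
| "sem (ConsT f g) p = pair (sem f p) (sem g p)"
| "sem (CompT f g) p = sem f (sem g p)"
| "sem (PrimT f g) p =
    rec_nat (sem f (psnd p)) (\<lambda>k v. sem g (pair k (pair v (psnd p)))) (pfst p)"
| "sem (MinT f) p = (LEAST y. sem f (pair y p) = 0)"

text \<open>
  \<open>Graph u\<close> is the graph of \<open>u\<close>, \<open>NoZero u\<close> says that the search of \<open>MinT u\<close> has not succeeded
  before a given number, and \<open>ZeroAt u\<close> relates two arguments at which \<open>u\<close> vanishes.
\<close>

datatype rel_name = Graph rec_term | NoZero rec_term | ZeroAt rec_term

instance rec_term :: countable by countable_datatype
instance rel_name :: countable by countable_datatype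

type_synonym batom = "rel_name \<times> nat \<times> nat"
type_synonym clause = "batom list \<times> batom"
type_synonym interp = "rel_name \<Rightarrow> nat \<Rightarrow> nat \<Rightarrow> bool"

definition batom_holds :: "interp \<Rightarrow> (nat \<Rightarrow> nat) \<Rightarrow> batom \<Rightarrow> bool" where
  "batom_holds J \<rho> = (\<lambda>(r, p, q). J r (\<rho> p) (\<rho> q))"

definition clause_holds :: "nat set \<Rightarrow> interp \<Rightarrow> clause \<Rightarrow> bool" where
  "clause_holds U J c \<longleftrightarrow> (\<forall>\<rho>. range \<rho> \<subseteq> U \<longrightarrow>
    (\<forall>b\<in>set (fst c). batom_holds J \<rho> b) \<longrightarrow> batom_holds J \<rho> (snd c))"

text \<open>
  Variables are numbers below 9. In the step clause of \<open>PrimT\<close> they are, in this order: the argument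
  list, its head \<open>k + 1\<close>, \<open>k\<close>, the parameters, the list for the recursive call, its value, the argument
  list of \<open>g\<close>, its tail, and the new value. A clause for \<open>NoZero f\<close> uses that a value is a successor
  instead of negation, so that the program remains Horn.
\<close>

primrec clauses_of :: "rec_term \<Rightarrow> clause list" where
  "clauses_of ZeroT = []"
| "clauses_of SuccT = []"
| "clauses_of HeadT = []"
| "clauses_of TailT = []"
| "clauses_of (ConsT f g) =
    ([(Graph f, 0, 1), (Graph g, 0, 2), (Graph HeadT, 3, 1), (Graph TailT, 3, 2)], (Graph (ConsT f g), 0, 3)) #
    clauses_of f @ clauses_of g"
| "clauses_of (CompT f g) = ([(Graph g, 0, 1), (Graph f, 1, 2)], (Graph (CompT f g), 0, 2)) # clauses_of f @ clauses_of g"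
| "clauses_of (PrimT f g) =
    ([(Graph HeadT, 0, 1), (Graph ZeroT, 0, 1), (Graph TailT, 0, 2), (Graph f, 2, 3)], (Graph (PrimT f g), 0, 3)) #
    ([(Graph HeadT, 0, 1), (Graph SuccT, 2, 1), (Graph TailT, 0, 3), (Graph HeadT, 4, 2), (Graph TailT, 4, 3), (Graph (PrimT f g), 4, 5),
      (Graph HeadT, 6, 2), (Graph TailT, 6, 7), (Graph HeadT, 7, 5), (Graph TailT, 7, 3), (Graph g, 6, 8)], (Graph (PrimT f g), 0, 8)) #
    clauses_of f @ clauses_of g"
| "clauses_of (MinT f) =
    ([(Graph ZeroT, 0, 1)], (NoZero f, 0, 1)) #
    ([(NoZero f, 0, 1), (Graph HeadT, 2, 1), (Graph TailT, 2, 0), (Graph f, 2, 3), (Graph SuccT, 4, 3), (Graph SuccT, 1, 5)], (NoZero f, 0, 5)) #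
    ([(NoZero f, 0, 1), (Graph HeadT, 2, 1), (Graph TailT, 2, 0), (Graph f, 2, 3), (Graph ZeroT, 2, 3)], (Graph (MinT f), 0, 1)) #
    clauses_of f"

text \<open>
  Variable 1 is a list whose first two entries are the variables 0 and 3, and variable 4 is the value
  of \<open>u\<close> at that list. The atom \<open>(Graph ZeroT, 0, 4)\<close> says
  that the value is zero; the first argument of \<open>Graph ZeroT\<close> is arbitrary.
\<close>

definition goal_clause :: "rec_term \<Rightarrow> clause" where
  "goal_clause u =
    ([(Graph HeadT, 1, 0), (Graph TailT, 1, 2), (Graph HeadT, 2, 3), (Graph u, 1, 4), (Graph ZeroT, 0, 4)], (ZeroAt u, 0, 3))"

primrec std_interp :: interp where
  "std_interp (Graph u) p q \<longleftrightarrow> q = sem u p"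
| "std_interp (NoZero u) p q \<longleftrightarrow> (\<forall>y<q. sem u (pair y p) \<noteq> 0)"
| "std_interp (ZeroAt u) p q \<longleftrightarrow> (\<exists>c. sem u (pair p (pair q c)) = 0)"

lemma eq_pair_conv: "p = pair a b \<longleftrightarrow> pfst p = a \<and> psnd p = b"
  by auto

lemma std_interp_clauses: "c \<in> set (clauses_of u) \<Longrightarrow> clause_holds UNIV std_interp c"
proof (induction u)
  case (PrimT f g)
  have step: "\<rho> 8 = sem (PrimT f g) (\<rho> 0)"
    if "\<rho> 1 = pfst (\<rho> 0)" "\<rho> 1 = Suc (\<rho> 2)" "\<rho> 3 = psnd (\<rho> 0)" "\<rho> 2 = pfst (\<rho> 4)" "\<rho> 3 = psnd (\<rho> 4)"
      "\<rho> 5 = sem (PrimT f g) (\<rho> 4)" "\<rho> 2 = pfst (\<rho> 6)" "\<rho> 7 = psnd (\<rho> 6)" "\<rho> 5 = pfst (\<rho> 7)"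
      "\<rho> 3 = psnd (\<rho> 7)" "\<rho> 8 = sem g (\<rho> 6)" for \<rho> :: "nat \<Rightarrow> nat"
  proof -
    have "\<rho> 6 = pair (\<rho> 2) (pair (\<rho> 5) (\<rho> 3))" using that(7-10) by simp
    moreover have "\<rho> 5 = rec_nat (sem f (\<rho> 3)) (\<lambda>k v. sem g (pair k (pair v (\<rho> 3)))) (\<rho> 2)"
      using that(4-6) by simp
    ultimately show ?thesis using that(1-3,11) by simp
  qed
  have "clause_holds UNIV std_interp ([(Graph HeadT, 0, 1), (Graph SuccT, 2, 1), (Graph TailT, 0, 3), (Graph HeadT, 4, 2), (Graph TailT, 4, 3),
      (Graph (PrimT f g), 4, 5), (Graph HeadT, 6, 2), (Graph TailT, 6, 7), (Graph HeadT, 7, 5), (Graph TailT, 7, 3), (Graph g, 6, 8)],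
      (Graph (PrimT f g), 0, 8))"
    unfolding clause_holds_def batom_holds_def
  proof (intro allI impI, goal_cases)
    case (1 \<rho>)
    from 1(2) have "\<rho> 8 = sem (PrimT f g) (\<rho> 0)"
      unfolding fst_conv list.set ball_simps split_conv std_interp.simps sem.simps(2-4)
      by (intro step) (elim conjE, assumption)+
    then show ?case unfolding snd_conv split_conv std_interp.simps .
  qed
  moreover have "clause_holds UNIV std_interp
      ([(Graph HeadT, 0, 1), (Graph ZeroT, 0, 1), (Graph TailT, 0, 2), (Graph f, 2, 3)], (Graph (PrimT f g), 0, 3))"
    unfolding clause_holds_def batom_holds_def
  proof (intro allI impI, goal_cases)
    case (1 \<rho>)
    then have "pfst (\<rho> 0) = 0" "\<rho> 3 = sem f (psnd (\<rho> 0))" by auto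
    then show ?case by simp
  qed
  ultimately show ?case using PrimT by auto
next
  case (MinT f)
  have min: "y = (LEAST y. sem f (pair y p) = 0)"
    if "\<forall>z<y. sem f (pair z p) \<noteq> 0" "sem f (pair y p) = 0" for y p
    using that by (intro Least_equality[symmetric]) (auto intro: leI)
  have "clause_holds UNIV std_interp ([(NoZero f, 0, 1), (Graph HeadT, 2, 1), (Graph TailT, 2, 0), (Graph f, 2, 3), (Graph SuccT, 4, 3), (Graph SuccT, 1, 5)], (NoZero f, 0, 5))"
    unfolding clause_holds_def batom_holds_def
  proof (intro allI impI, goal_cases)
    case (1 \<rho>)
    then have eq: "pair (\<rho> 1) (\<rho> 0) = \<rho> 2" "\<rho> 3 = sem f (\<rho> 2)" "\<rho> 3 = Suc (\<rho> 4)" "\<rho> 5 = Suc (\<rho> 1)"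
      by (simp_all add: pair_eq_conv)
    from 1(2) have "\<forall>y<\<rho> 1. sem f (pair y (\<rho> 0)) \<noteq> 0"
      unfolding fst_conv list.set ball_simps split_conv std_interp.simps by (rule conjunct1)
    moreover have "sem f (pair (\<rho> 1) (\<rho> 0)) \<noteq> 0" using eq by simp
    ultimately show ?case using eq(4) by (auto simp: less_Suc_eq)
  qed
  moreover have "clause_holds UNIV std_interp ([(NoZero f, 0, 1), (Graph HeadT, 2, 1), (Graph TailT, 2, 0), (Graph f, 2, 3), (Graph ZeroT, 2, 3)], (Graph (MinT f), 0, 1))"
    unfolding clause_holds_def batom_holds_def
  proof (intro allI impI, goal_cases)
    case (1 \<rho>)
    then have eq: "pair (\<rho> 1) (\<rho> 0) = \<rho> 2" "\<rho> 3 = sem f (\<rho> 2)" "\<rho> 3 = 0"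
      by (simp_all add: pair_eq_conv)
    from 1(2) have "\<forall>y<\<rho> 1. sem f (pair y (\<rho> 0)) \<noteq> 0"
      unfolding fst_conv list.set ball_simps split_conv std_interp.simps by (rule conjunct1)
    moreover have "sem f (pair (\<rho> 1) (\<rho> 0)) = 0" using eq by simp
    ultimately show ?case using min by simp
  qed
  moreover have "clause_holds UNIV std_interp ([(Graph ZeroT, 0, 1)], (NoZero f, 0, 1))"
    by (simp add: clause_holds_def batom_holds_def)
  ultimately show ?case using MinT by auto
qed (auto simp: clause_holds_def batom_holds_def eq_pair_conv)

lemma std_interp_goal_clause: "clause_holds UNIV std_interp (goal_clause u)"
  unfolding clause_holds_def batom_holds_def goal_clause_def
proof (intro allI impI, goal_cases)
  case (1 \<rho>)
  then have "pair (\<rho> 0) (pair (\<rho> 3) (psnd (\<rho> 2))) = \<rho> 1" "sem u (\<rho> 1) = 0"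
    by (simp_all add: pair_eq_conv)
  then have "sem u (pair (\<rho> 0) (pair (\<rho> 3) (psnd (\<rho> 2)))) = 0" by simp
  then show ?case by auto
qed

text \<open>
  Totality is all that is demanded of successor and pairing: without equality, their values cannot be
  required to be unique.
\<close>

definition base_model :: "nat set \<Rightarrow> interp \<Rightarrow> bool" where
  "base_model U J \<longleftrightarrow> (\<forall>r a b. J r a b \<longrightarrow> a \<in> U \<and> b \<in> U) \<and>
    (\<forall>x\<in>U. \<exists>y. J (Graph SuccT) x y) \<and> (\<exists>z\<in>U. \<forall>x\<in>U. J (Graph ZeroT) x z) \<and>
    (\<forall>a\<in>U. \<forall>b\<in>U. \<exists>c. J (Graph HeadT) c a \<and> J (Graph TailT) c b)"

text \<open>
  An element represents \<open>n\<close> if it can be reached from some zero in \<open>n\<close> successor steps. Distinct numbers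
  may have common representatives.
\<close>

primrec rep_num :: "nat set \<Rightarrow> interp \<Rightarrow> nat \<Rightarrow> nat \<Rightarrow> bool" where
  "rep_num U J 0 d \<longleftrightarrow> d \<in> U \<and> (\<forall>x\<in>U. J (Graph ZeroT) x d)"
| "rep_num U J (Suc n) d \<longleftrightarrow> (\<exists>d'. rep_num U J n d' \<and> J (Graph SuccT) d' d)"

text \<open>
  Only the first \<open>m\<close> entries of the stream \<open>p\<close> are required to be represented.
\<close>

primrec rep_list :: "nat set \<Rightarrow> interp \<Rightarrow> nat \<Rightarrow> nat \<Rightarrow> nat \<Rightarrow> bool" where
  "rep_list U J 0 p d \<longleftrightarrow> d \<in> U"
| "rep_list U J (Suc m) p d \<longleftrightarrow> (\<exists>a b. J (Graph HeadT) d a \<and> J (Graph TailT) d b \<and>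
    rep_num U J (pfst p) a \<and> rep_list U J m (psnd p) b)"

definition sound_num :: "nat set \<Rightarrow> interp \<Rightarrow> nat \<Rightarrow> rec_term \<Rightarrow> bool" where
  "sound_num U J n u \<longleftrightarrow> (\<forall>p d. rep_list U J n p d \<longrightarrow> (\<exists>v. J (Graph u) d v \<and> rep_num U J (sem u p) v))"

definition sound_list :: "nat set \<Rightarrow> interp \<Rightarrow> nat \<Rightarrow> nat \<Rightarrow> rec_term \<Rightarrow> bool" where
  "sound_list U J n m u \<longleftrightarrow> (\<forall>p d. rep_list U J n p d \<longrightarrow> (\<exists>v. J (Graph u) d v \<and> rep_list U J m (sem u p) v))"

context
  fixes U :: "nat set" and J :: interp
  assumes base: "base_model U J"
begin

lemma dom: "J r a b \<Longrightarrow> a \<in> U" "J r a b \<Longrightarrow> b \<in> U"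
  using base unfolding base_model_def by blast+

lemma rep_num_dom: "rep_num U J n d \<Longrightarrow> d \<in> U"
  by (cases n) (auto dest: dom)

lemma rep_list_dom: "rep_list U J n p d \<Longrightarrow> d \<in> U"
  by (cases n) (auto dest: dom)

lemma ex_pair:
  assumes "a \<in> U" "b \<in> U" obtains c where "J (Graph HeadT) c a" "J (Graph TailT) c b"
  using base assms unfolding base_model_def by blast

lemma ex_Suc:
  assumes "a \<in> U" obtains b where "J (Graph SuccT) a b"
  using base assms unfolding base_model_def by blast

lemma ex_rep_num: "\<exists>d. rep_num U J n d"
proof (induction n)
  case 0 then show ?case using base unfolding base_model_def by auto
next
  case (Suc n)
  then obtain d where "rep_num U J n d" by blast
  moreover obtain e where "J (Graph SuccT) d e" using ex_Suc[OF rep_num_dom[OF calculation]] by blast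
  ultimately show ?case by auto
qed

lemma ex_rep_list: "\<exists>d. rep_list U J n p d"
proof (induction n arbitrary: p)
  case 0
  obtain d where "rep_num U J 0 d" using ex_rep_num by blast
  then show ?case using rep_num_dom by auto
next
  case (Suc n)
  obtain a b where ab: "rep_num U J (pfst p) a" "rep_list U J n (psnd p) b"
    using ex_rep_num Suc by blast
  obtain c where "J (Graph HeadT) c a" "J (Graph TailT) c b"
    using ex_pair[OF rep_num_dom[OF ab(1)] rep_list_dom[OF ab(2)]] by blast
  then show ?case using ab by auto
qed

text \<open>
  Clauses are applied to an explicit list of elements, the values of the variables 0, 1, and so on.
\<close>

lemma clauseD:
  assumes "clause_holds U J (bs, r, p, q)" "set xs \<subseteq> U"
    and "list_all (\<lambda>(r, p, q). p < length xs \<and> q < length xs \<and> J r (xs ! p) (xs ! q)) bs"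
    and "p < length xs" "q < length xs"
  shows "J r (xs ! p) (xs ! q)"
proof -
  \<comment> \<open>Variables beyond the list receive its first entry, which lies in the universe as well.\<close>
  define \<rho> where "\<rho> z = xs ! (if z < length xs then z else 0)" for z
  have "\<rho> z \<in> set xs" for z unfolding \<rho>_def by (rule nth_mem) (use assms(4) in auto)
  then have "range \<rho> \<subseteq> U" using assms(2) by blast
  moreover have "\<forall>b\<in>set bs. batom_holds J \<rho> b"
    using assms(3) by (auto simp: list_all_iff batom_holds_def \<rho>_def)
  ultimately have "batom_holds J \<rho> (r, p, q)"
    using assms(1) unfolding clause_holds_def by simp
  then show ?thesis using assms(4,5) by (simp add: batom_holds_def \<rho>_def)
qed

lemma sound_ZeroT: "sound_num U J n ZeroT"
  unfolding sound_num_def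
proof (intro allI impI)
  fix p d assume d: "rep_list U J n p d"
  obtain v where "rep_num U J 0 v" using ex_rep_num by blast
  then show "\<exists>v. J (Graph ZeroT) d v \<and> rep_num U J (sem ZeroT p) v" using rep_list_dom[OF d] by auto
qed

lemma sound_nil: "sound_list U J n 0 ZeroT"
  using sound_ZeroT[of n] rep_num_dom unfolding sound_num_def sound_list_def by fastforce

lemma sound_HeadT: "sound_num U J (Suc n) HeadT" and sound_TailT: "sound_list U J (Suc n) n TailT"
  unfolding sound_num_def sound_list_def by auto

lemma sound_Suc_head:
  assumes "\<forall>c\<in>set (clauses_of (CompT SuccT HeadT)). clause_holds U J c"
  shows "sound_num U J (Suc n) (CompT SuccT HeadT)"
  unfolding sound_num_def
proof (intro allI impI)
  fix p d assume "rep_list U J (Suc n) p d"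
  then obtain a where a: "J (Graph HeadT) d a" "rep_num U J (pfst p) a" by auto
  obtain v where v: "J (Graph SuccT) a v" using ex_Suc[OF dom(2)[OF a(1)]] by blast
  have "set [d, a, v] \<subseteq> U"
    using dom[OF a(1)] dom[OF v] by auto
  then have "J (Graph (CompT SuccT HeadT)) d v"
    using clauseD[of "[(Graph HeadT, 0, 1), (Graph SuccT, 1, 2)]" "Graph (CompT SuccT HeadT)" 0 2
        "[d, a, v]"]
      assms a v by simp
  moreover have "rep_num U J (sem (CompT SuccT HeadT) p) v" using a v by auto
  ultimately show "\<exists>v. J (Graph (CompT SuccT HeadT)) d v \<and> rep_num U J (sem (CompT SuccT HeadT) p) v" by blast
qed

lemma sound_CompT:
  assumes "\<forall>c\<in>set (clauses_of (CompT f g)). clause_holds U J c"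
    and g: "sound_list U J n m g" and f: "sound_num U J m f"
  shows "sound_num U J n (CompT f g)"
  unfolding sound_num_def
proof (intro allI impI)
  fix p d assume "rep_list U J n p d"
  then obtain w where w: "J (Graph g) d w" "rep_list U J m (sem g p) w"
    using g unfolding sound_list_def by blast
  then obtain v where v: "J (Graph f) w v" "rep_num U J (sem f (sem g p)) v"
    using f unfolding sound_num_def by blast
  have "set [d, w, v] \<subseteq> U"
    using dom[OF w(1)] dom[OF v(1)] by auto
  then have "J (Graph (CompT f g)) d v"
    using clauseD[of "[(Graph g, 0, 1), (Graph f, 1, 2)]" "Graph (CompT f g)" 0 2
        "[d, w, v]"]
      assms(1) w v by simp
  then show "\<exists>v. J (Graph (CompT f g)) d v \<and> rep_num U J (sem (CompT f g) p) v" using v by auto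
qed

lemma sound_ConsT:
  assumes "\<forall>c\<in>set (clauses_of (ConsT f g)). clause_holds U J c"
    and f: "sound_num U J n f" and g: "sound_list U J n m g"
  shows "sound_list U J n (Suc m) (ConsT f g)"
  unfolding sound_list_def
proof (intro allI impI)
  fix p d assume d: "rep_list U J n p d"
  obtain a where a: "J (Graph f) d a" "rep_num U J (sem f p) a"
    using f d unfolding sound_num_def by blast
  obtain b where b: "J (Graph g) d b" "rep_list U J m (sem g p) b"
    using g d unfolding sound_list_def by blast
  obtain w where w: "J (Graph HeadT) w a" "J (Graph TailT) w b"
    using ex_pair[OF dom(2)[OF a(1)] dom(2)[OF b(1)]] by blast
  have "set [d, a, b, w] \<subseteq> U"
    using dom[OF a(1)] dom[OF b(1)] dom[OF w(1)] by auto
  then have "J (Graph (ConsT f g)) d w"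
    using clauseD[of "[(Graph f, 0, 1), (Graph g, 0, 2), (Graph HeadT, 3, 1), (Graph TailT, 3, 2)]" "Graph (ConsT f g)" 0 3
        "[d, a, b, w]"] assms(1) a b w by simp
  moreover have "rep_list U J (Suc m) (sem (ConsT f g) p) w" using a b w by auto
  ultimately show "\<exists>v. J (Graph (ConsT f g)) d v \<and> rep_list U J (Suc m) (sem (ConsT f g) p) v" by blast
qed

text \<open>
  Induction on the recursion argument; each step builds the two argument lists by pairing.
\<close>

lemma sound_PrimT:
  assumes cl: "\<forall>c\<in>set (clauses_of (PrimT f g)). clause_holds U J c"
    and f: "sound_num U J n f" and g: "sound_num U J (Suc (Suc n)) g"
  shows "sound_num U J (Suc n) (PrimT f g)"
  unfolding sound_num_def
proof (intro allI impI)
  let ?h = "PrimT f g"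
  fix p d assume "rep_list U J (Suc n) p d"
  then obtain a t where d: "J (Graph HeadT) d a" "J (Graph TailT) d t" and a: "rep_num U J (pfst p) a"
    and t: "rep_list U J n (psnd p) t" by auto
  define q where "q = psnd p"
  have "\<exists>v. J (Graph ?h) d v \<and> rep_num U J (sem ?h (pair k q)) v"
    if "rep_num U J k a" "J (Graph HeadT) d a" "J (Graph TailT) d t" for k a d
    using that
  proof (induction k arbitrary: a d)
    case 0
    obtain v where v: "J (Graph f) t v" "rep_num U J (sem f q) v"
      using f t unfolding sound_num_def q_def by blast
    have "set [d, a, t, v] \<subseteq> U"
      using dom[OF 0(2)] dom[OF 0(3)] dom[OF v(1)] by auto
    moreover have "J (Graph ZeroT) d a" using 0 dom(1)[OF 0(2)] by simp
    ultimately have "J (Graph ?h) d v"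
      using clauseD[of "[(Graph HeadT, 0, 1), (Graph ZeroT, 0, 1), (Graph TailT, 0, 2), (Graph f, 2, 3)]" "Graph ?h" 0 3
        "[d, a, t, v]"] cl 0 v by simp
    then show ?case using v by auto
  next
    case (Suc k)
    then obtain a' where a': "rep_num U J k a'" "J (Graph SuccT) a' a" by auto
    have U: "a' \<in> U" "t \<in> U" using rep_num_dom[OF a'(1)] dom[OF Suc.prems(3)] by auto
    obtain x2 where x2: "J (Graph HeadT) x2 a'" "J (Graph TailT) x2 t" using ex_pair[OF U] by blast
    obtain v where v: "J (Graph ?h) x2 v" "rep_num U J (sem ?h (pair k q)) v"
      using Suc.IH[OF a'(1) x2] by blast
    obtain y where y: "J (Graph HeadT) y v" "J (Graph TailT) y t"
      using ex_pair[OF dom(2)[OF v(1)] U(2)] by blast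
    obtain x3 where x3: "J (Graph HeadT) x3 a'" "J (Graph TailT) x3 y"
      using ex_pair[OF U(1) dom(1)[OF y(1)]] by blast
    have "rep_list U J (Suc (Suc n)) (pair k (pair (sem ?h (pair k q)) q)) x3"
      using x3 y a' v t unfolding q_def by auto
    then obtain w where w: "J (Graph g) x3 w" "rep_num U J (sem g (pair k (pair (sem ?h (pair k q)) q))) w"
      using g unfolding sound_num_def by blast
    have "set [d, a, a', t, x2, v, x3, y, w] \<subseteq> U"
      using dom[OF Suc.prems(2)] U dom[OF v(1)] dom[OF x3(2)] dom[OF w(1)] by auto
    then have "J (Graph ?h) d w"
      using clauseD[of "[(Graph HeadT, 0, 1), (Graph SuccT, 2, 1), (Graph TailT, 0, 3), (Graph HeadT, 4, 2), (Graph TailT, 4, 3), (Graph ?h, 4, 5),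
        (Graph HeadT, 6, 2), (Graph TailT, 6, 7), (Graph HeadT, 7, 5), (Graph TailT, 7, 3), (Graph g, 6, 8)]" "Graph ?h" 0 8
        "[d, a, a', t, x2, v, x3, y, w]"]
        cl Suc.prems a' x2 v y x3 w by simp
    then show ?case using w(2) by auto
  qed
  from this[OF a d] show "\<exists>v. J (Graph ?h) d v \<and> rep_num U J (sem ?h p) v"
    unfolding q_def by simp
qed

text \<open>
  Regularity is needed here only: the search reaches the least zero since all values before it are
  represented by successors.
\<close>

lemma sound_MinT:
  assumes cl: "\<forall>c\<in>set (clauses_of (MinT f)). clause_holds U J c"
    and f: "sound_num U J (Suc n) f" and zero: "\<And>p. \<exists>y. sem f (pair y p) = 0"
  shows "sound_num U J n (MinT f)"
  unfolding sound_num_def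
proof (intro allI impI)
  fix p d assume d: "rep_list U J n p d"
  define m where "m = (LEAST y. sem f (pair y p) = 0)"
  have m: "sem f (pair m p) = 0" unfolding m_def using LeastI_ex[OF zero] .
  have val: "\<exists>u v. J (Graph HeadT) u e \<and> J (Graph TailT) u d \<and> J (Graph f) u v \<and> rep_num U J (sem f (pair y p)) v"
    if e: "rep_num U J y e" for y e
  proof -
    obtain u where u: "J (Graph HeadT) u e" "J (Graph TailT) u d"
      using ex_pair[OF rep_num_dom[OF e] rep_list_dom[OF d]] by blast
    then have "rep_list U J (Suc n) (pair y p) u" using e d by auto
    then show ?thesis using f u unfolding sound_num_def by blast
  qed
  have "y \<le> m \<Longrightarrow> \<exists>e. rep_num U J y e \<and> J (NoZero f) d e" for y
  proof (induction y)
    case 0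
    obtain e where e: "rep_num U J 0 e" using ex_rep_num by blast
    have "set [d, e] \<subseteq> U" using rep_list_dom[OF d] rep_num_dom[OF e] by auto
    moreover have "J (Graph ZeroT) d e" using e rep_list_dom[OF d] by auto
    ultimately have "J (NoZero f) d e"
      using clauseD[of "[(Graph ZeroT, 0, 1)]" "NoZero f" 0 1
        "[d, e]"] cl
      by simp
    then show ?case using e by blast
  next
    case (Suc y)
    then obtain e where e: "rep_num U J y e" "J (NoZero f) d e" by auto
    obtain u v where u: "J (Graph HeadT) u e" "J (Graph TailT) u d" "J (Graph f) u v"
      and v: "rep_num U J (sem f (pair y p)) v" using val[OF e(1)] by blast
    have "sem f (pair y p) \<noteq> 0" using Suc.prems not_less_Least[of y "\<lambda>y. sem f (pair y p) = 0"] unfolding m_def by simp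
    then obtain k where "sem f (pair y p) = Suc k" using not0_implies_Suc by blast
    then obtain v' where v': "J (Graph SuccT) v' v" using v by auto
    obtain e' where e': "J (Graph SuccT) e e'" using ex_Suc[OF rep_num_dom[OF e(1)]] by blast
    have "set [d, e, u, v, v', e'] \<subseteq> U" using dom[OF e(2)] dom[OF u(3)] dom[OF v'] dom[OF e'] by auto
    then have "J (NoZero f) d e'"
      using clauseD[of "[(NoZero f, 0, 1), (Graph HeadT, 2, 1), (Graph TailT, 2, 0), (Graph f, 2, 3), (Graph SuccT, 4, 3), (Graph SuccT, 1, 5)]" "NoZero f" 0 5
        "[d, e, u, v, v', e']"]
        cl e u v' e' by simp
    then show ?case using e e' by auto
  qed
  then obtain e where e: "rep_num U J m e" "J (NoZero f) d e" by blast
  obtain u v where u: "J (Graph HeadT) u e" "J (Graph TailT) u d" "J (Graph f) u v"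
    and v: "rep_num U J 0 v" using val[OF e(1)] m by auto
  have "set [d, e, u, v] \<subseteq> U" using dom[OF e(2)] dom[OF u(3)] by auto
  moreover have "J (Graph ZeroT) u v" using v dom[OF u(3)] by simp
  ultimately have "J (Graph (MinT f)) d e"
    using clauseD[of "[(NoZero f, 0, 1), (Graph HeadT, 2, 1), (Graph TailT, 2, 0), (Graph f, 2, 3), (Graph ZeroT, 2, 3)]" "Graph (MinT f)" 0 1
        "[d, e, u, v]"]
      cl e u by simp
  then show "\<exists>v. J (Graph (MinT f)) d v \<and> rep_num U J (sem (MinT f) p) v"
    using e(1) unfolding m_def by auto
qed

end

definition prefix :: "nat \<Rightarrow> nat \<Rightarrow> nat list" where "prefix n p = map (env p) [0..<n]"

lemma prefix_0 [simp]: "prefix 0 p = []"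
  by (simp add: prefix_def)

lemma prefix_Suc [simp]: "prefix (Suc n) p = pfst p # prefix n (psnd p)"
  by (simp add: prefix_def upt_conv_Cons env_0 env_Suc map_Suc_upt[symmetric] del: upt_Suc)

lemma length_prefix [simp]: "length (prefix n p) = n"
  by (simp add: prefix_def)

text \<open>
  The soundness clause quantifies over all models of the clauses, so it applies to any model of a
  formula that contains them.
\<close>

definition represents :: "rec_term \<Rightarrow> nat \<Rightarrow> (nat list \<Rightarrow> nat) \<Rightarrow> bool" where
  "represents u n f \<longleftrightarrow> (\<forall>p. sem u p = f (prefix n p)) \<and>
    (\<forall>U J. base_model U J \<longrightarrow> (\<forall>c\<in>set (clauses_of u). clause_holds U J c) \<longrightarrow> sound_num U J n u)"

lemma represents_proj: "i < n \<Longrightarrow> \<exists>u. represents u n (\<lambda>xs. xs ! i)"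
proof (induction i arbitrary: n)
  case 0
  then obtain m where "n = Suc m" using not0_implies_Suc by blast
  then have "represents HeadT n (\<lambda>xs. xs ! 0)"
    unfolding represents_def using sound_HeadT by auto
  then show ?case by blast
next
  case (Suc i)
  then obtain m where m: "n = Suc m" "i < m" by (cases n) auto
  obtain u where u: "represents u m (\<lambda>xs. xs ! i)" using Suc.IH[OF m(2)] by blast
  have "represents (CompT u TailT) n (\<lambda>xs. xs ! Suc i)"
    unfolding represents_def
  proof (intro conjI allI impI)
    show "sem (CompT u TailT) p = prefix n p ! Suc i" for p
      using u unfolding represents_def m(1) by simp
  next
    fix U J assume b: "base_model U J" and cl: "\<forall>c\<in>set (clauses_of (CompT u TailT)). clause_holds U J c"
    then have "sound_num U J m u" using u unfolding represents_def by simp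
    then show "sound_num U J n (CompT u TailT)"
      unfolding m(1) using sound_CompT[OF b cl] sound_TailT[OF b] by blast
  qed
  then show ?case by blast
qed

text \<open>
  Composition with several inner functions: their values are collected in a list by \<open>ConsT\<close>.
\<close>

lemma represents_list:
  assumes "\<forall>g\<in>set gs. \<exists>u. represents u n g"
  shows "\<exists>w. (\<forall>p. prefix (length gs) (sem w p) = map (\<lambda>g. g (prefix n p)) gs) \<and>
    (\<forall>U J. base_model U J \<longrightarrow> (\<forall>c\<in>set (clauses_of w). clause_holds U J c) \<longrightarrow> sound_list U J n (length gs) w)"
  using assms
proof (induction gs)
  case Nil
  then show ?case using sound_nil by (intro exI[of _ ZeroT]) auto
next
  case (Cons g gs)
  then obtain w where w: "\<And>p. prefix (length gs) (sem w p) = map (\<lambda>g. g (prefix n p)) gs"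
    "\<And>U J. base_model U J \<Longrightarrow> \<forall>c\<in>set (clauses_of w). clause_holds U J c \<Longrightarrow> sound_list U J n (length gs) w"
    by auto
  obtain u where u: "represents u n g" using Cons.prems by auto
  have "sound_list U J n (length (g # gs)) (ConsT u w)"
    if b: "base_model U J" and cl: "\<forall>c\<in>set (clauses_of (ConsT u w)). clause_holds U J c" for U J
    using sound_ConsT[OF b cl, of n "length gs"] w(2)[OF b] u b cl unfolding represents_def by simp
  moreover have "prefix (length (g # gs)) (sem (ConsT u w) p) = map (\<lambda>g. g (prefix n p)) (g # gs)" for p
    using w(1) u unfolding represents_def by simp
  ultimately show ?case by (intro exI[of _ "ConsT u w"]) blast
qed

lemma ex_represents: "recursive n f \<Longrightarrow> \<exists>u. represents u n f"
proof (induction rule: recursive.induct)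
  case (zero n)
  then show ?case using sound_ZeroT by (intro exI[of _ ZeroT]) (auto simp: represents_def)
next
  case succ
  have "represents (CompT SuccT HeadT) 1 (\<lambda>xs. Suc (xs ! 0))"
    unfolding represents_def using sound_Suc_head[of _ _ 0] by auto
  then show ?case by blast
next
  case (proj i n)
  then show ?case by (rule represents_proj)
next
  case (comp gs f n)
  obtain u where u: "represents u (length gs) f" using comp by blast
  obtain w where w: "\<And>p. prefix (length gs) (sem w p) = map (\<lambda>g. g (prefix n p)) gs"
    "\<And>U J. base_model U J \<Longrightarrow> \<forall>c\<in>set (clauses_of w). clause_holds U J c \<Longrightarrow> sound_list U J n (length gs) w"
    using represents_list[of gs n] comp by blast
  have "sound_num U J n (CompT u w)"
    if b: "base_model U J" and cl: "\<forall>c\<in>set (clauses_of (CompT u w)). clause_holds U J c" for U J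
    using sound_CompT[OF b cl, of n "length gs"] w(2)[OF b] u b cl unfolding represents_def by simp
  then have "represents (CompT u w) n (\<lambda>xs. f (map (\<lambda>g. g xs) gs))"
    using u w(1) unfolding represents_def by simp
  then show ?case by blast
next
  case (primitive_recursion n f g)
  then obtain u w where u: "represents u n f" and w: "represents w (Suc (Suc n)) g" by blast
  have "sound_num U J (Suc n) (PrimT u w)"
    if b: "base_model U J" and cl: "\<forall>c\<in>set (clauses_of (PrimT u w)). clause_holds U J c" for U J
    using sound_PrimT[OF b cl, of n] u w b cl unfolding represents_def by simp
  then have "represents (PrimT u w) (Suc n)
      (\<lambda>xs. rec_nat (f (tl xs)) (\<lambda>k v. g (k # v # tl xs)) (hd xs))"
    using u w unfolding represents_def by simp
  then show ?case by blast
next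
  case (minimisation n f)
  then obtain u where u: "represents u (Suc n) f" by blast
  have eq: "sem u (pair y p) = f (y # prefix n p)" for y p
    using u unfolding represents_def by simp
  have zero: "\<exists>y. sem u (pair y p) = 0" for p
    unfolding eq using minimisation by simp
  have "sound_num U J n (MinT u)"
    if b: "base_model U J" and cl: "\<forall>c\<in>set (clauses_of (MinT u)). clause_holds U J c" for U J
    using sound_MinT[OF b cl _ zero, of n] u b cl unfolding represents_def by simp
  then have "represents (MinT u) n (\<lambda>xs. LEAST y. f (y # xs) = 0)"
    unfolding represents_def by (simp add: eq)
  then show ?case by blast
qed

section \<open>Horn clauses as formulae of the fragment\<close>

definition bin_atom :: "rel_name \<Rightarrow> nat \<Rightarrow> nat \<Rightarrow> fm" where
  "bin_atom r p q = Atom (Rel 2 (to_nat r)) [p, q]"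

text \<open>
  The name of the predicate records the two positions that it depends on.
\<close>

definition pad_atom :: "batom \<Rightarrow> fm" where
  "pad_atom b = Atom (Rel 9 (to_nat b)) [0..<9]"

definition num_atom :: "nat \<Rightarrow> nat \<Rightarrow> fm" where
  "num_atom i y = Atom (Rel 1 i) [y]"

definition others :: "nat \<Rightarrow> nat \<Rightarrow> nat list" where
  "others p q = filter (\<lambda>z. z \<noteq> p \<and> z \<noteq> q) [0..<9]"

text \<open>
  With \<open>p\<close> and \<open>q\<close> left free by the block, the formula asserts the equivalence of the binary atom with
  the 9-ary one for all values of the other variables.
\<close>

definition pad :: "batom \<Rightarrow> fm" where
  "pad = (\<lambda>(r, p, q). Conj
    (Neg (Ex p (Ex q (Conj (bin_atom r p q) (Exs (others p q) (Neg (pad_atom (r, p, q))))))))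
    (Neg (Ex p (Ex q (Conj (Neg (bin_atom r p q)) (Exs (others p q) (pad_atom (r, p, q))))))))"

definition conjs :: "fm list \<Rightarrow> fm" where
  "conjs \<phi>s = foldr Conj \<phi>s Top"

definition clause_fm :: "clause \<Rightarrow> fm" where
  "clause_fm c = Conj (conjs (map pad (snd c # fst c)))
    (Neg (Exs [0..<9] (Conj (conjs (map pad_atom (fst c))) (Neg (pad_atom (snd c))))))"

definition zero_fm :: fm where
  "zero_fm = Ex 0 (Neg (Ex 1 (Neg (bin_atom (Graph ZeroT) 1 0))))"

definition succ_fm :: fm where
  "succ_fm = Neg (Ex 0 (Neg (Ex 1 (bin_atom (Graph SuccT) 0 1))))"

definition pair_fm :: fm where
  "pair_fm = Conj (conjs (map pad [(Graph HeadT, 2, 0), (Graph TailT, 2, 1)]))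
    (Neg (Ex 0 (Ex 1 (Neg (Exs (others 0 1) (Conj (pad_atom (Graph HeadT, 2, 0)) (pad_atom (Graph TailT, 2, 1))))))))"

definition theory_fm :: "rec_term \<Rightarrow> fm" where
  "theory_fm u = conjs (zero_fm # succ_fm # pair_fm # map clause_fm (goal_clause u # clauses_of u))"

definition numeral_0_fm :: fm where
  "numeral_0_fm = Neg (Ex 0 (Conj (Neg (Ex 1 (Neg (bin_atom (Graph ZeroT) 1 0)))) (Neg (num_atom 0 0))))"

definition numeral_Suc_fm :: "nat \<Rightarrow> fm" where
  "numeral_Suc_fm i = Neg (Ex 0 (Ex 1 (Conj (Conj (num_atom i 0) (bin_atom (Graph SuccT) 0 1)) (Neg (num_atom (Suc i) 1)))))"

text \<open>
  The unary predicate number \<open>i\<close> holds of all representatives of \<open>i\<close>, for \<open>i \<le> n\<close>.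
\<close>

definition numeral_fm :: "nat \<Rightarrow> fm" where
  "numeral_fm n = rec_nat numeral_0_fm (\<lambda>i \<phi>. Conj \<phi> (numeral_Suc_fm i)) n"

definition query_fm :: "rec_term \<Rightarrow> nat \<Rightarrow> fm" where
  "query_fm u n = Neg (Ex 0 (Ex 1 (Conj (num_atom n 0) (bin_atom (ZeroAt u) 0 1))))"

definition reduction_fm :: "rec_term \<Rightarrow> nat \<Rightarrow> fm" where
  "reduction_fm u n = Conj (theory_fm u) (Conj (numeral_fm n) (query_fm u n))"

definition good_batom :: "batom \<Rightarrow> bool" where
  "good_batom = (\<lambda>(r, p, q). p < 9 \<and> q < 9 \<and> p \<noteq> q)"

lemma good_clauses_of: "c \<in> set (clauses_of u) \<Longrightarrow> b \<in> insert (snd c) (set (fst c)) \<Longrightarrow> good_batom b"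
  by (induction u) (auto simp: good_batom_def)

lemma good_goal_clause: "b \<in> insert (snd (goal_clause u)) (set (fst (goal_clause u))) \<Longrightarrow> good_batom b"
  by (auto simp: good_batom_def goal_clause_def)

subsection \<open>Membership in the fragment\<close>

lemma set_others: "set (others p q) = {..<9} - {p, q}"
  unfolding others_def by auto

lemma others_Cons: "\<exists>y ys. others p q = y # ys"
proof -
  have "card {p, q} \<le> 2" by (cases "p = q") auto
  then have "\<not> {..<9} \<subseteq> {p, q}" using card_mono[of "{p, q}" "{..<9}"] by auto
  then have "set (others p q) \<noteq> {}" unfolding set_others by blast
  then show ?thesis by (cases "others p q") auto
qed

lemma is_suf2_Exs:
  assumes "is_body \<phi>" "at_most_two (fv \<phi> - set (y # ys))" shows "is_suf2 (Exs (y # ys) \<phi>)"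
proof -
  have "fv (Exs ys \<phi>) - {y} = fv \<phi> - set (y # ys)" unfolding fv_Exs by auto
  then show ?thesis using assms is_body_Exs[of \<phi> ys] by simp
qed

lemma fv_pad_atom [simp]: "fv (pad_atom b) = {..<9}"
  by (auto simp: pad_atom_def)

lemma pad_atom_atom [simp]: "is_matrix (pad_atom b)" "skeleton_atoms (pad_atom b) = {pad_atom b}"
  by (simp_all add: pad_atom_def atoms_def full_vocab_def)

lemma is_suf2_bin_atom [simp]: "is_suf2 (bin_atom r p q)" and fv_bin_atom [simp]: "fv (bin_atom r p q) = {p, q}"
  by (auto simp: bin_atom_def atoms_def full_vocab_def at_most_two_def)

lemma is_suf2_num_atom [simp]: "is_suf2 (num_atom i y)" and fv_num_atom [simp]: "fv (num_atom i y) = {y}"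
  by (auto simp: num_atom_def atoms_def full_vocab_def at_most_two_def)

text \<open>
  Any Boolean combination of padded atoms is uniform.
\<close>

lemma is_body_pad_atom:
  assumes "is_matrix \<phi>" "\<forall>\<alpha>\<in>skeleton_atoms \<phi>. fv \<alpha> = {..<9}" shows "is_body \<phi>"
  using assms by (intro is_bodyI) (auto simp: uniform_skeleton_def)

lemma is_suf2_Exs_others:
  assumes "is_matrix \<phi>" "\<forall>\<alpha>\<in>skeleton_atoms \<phi>. fv \<alpha> = {..<9}" "fv \<phi> \<subseteq> {..<9}"
  shows "is_suf2 (Exs (others p q) \<phi>)" "fv (Exs (others p q) \<phi>) \<subseteq> {p, q}"
proof -
  show fv: "fv (Exs (others p q) \<phi>) \<subseteq> {p, q}"
    using assms(3) unfolding fv_Exs set_others by auto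
  obtain y ys where y: "others p q = y # ys" using others_Cons by blast
  have "at_most_two (fv \<phi> - set (y # ys))"
    using fv unfolding fv_Exs y at_most_two_def by blast
  then show "is_suf2 (Exs (others p q) \<phi>)"
    unfolding y using is_body_pad_atom[OF assms(1,2)] by (intro is_suf2_Exs)
qed

lemma is_suf2_Ex2:
  assumes "is_suf2 \<phi>" "fv \<phi> \<subseteq> {p, q}" shows "is_suf2 (Ex p (Ex q \<phi>))"
proof -
  have "at_most_one (fv \<phi> - {q})" "at_most_one (fv \<phi> - {q} - {p})" using assms(2) unfolding at_most_one_def by blast+
  then show ?thesis using assms(1) by simp
qed

lemma is_suf2_conjs: "(\<And>\<phi>. \<phi> \<in> set \<phi>s \<Longrightarrow> is_suf2 \<phi>) \<Longrightarrow> is_suf2 (conjs \<phi>s)"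
  by (induction \<phi>s) (auto simp: conjs_def)

lemma is_suf2_pad: "is_suf2 (pad b)"
proof (cases b)
  case (fields r p q)
  have "is_suf2 (Exs (others p q) (Neg (pad_atom b)))" "fv (Exs (others p q) (Neg (pad_atom b))) \<subseteq> {p, q}"
    "is_suf2 (Exs (others p q) (pad_atom b))" "fv (Exs (others p q) (pad_atom b)) \<subseteq> {p, q}"
    by (rule is_suf2_Exs_others; simp)+
  then have "is_suf2 (Ex p (Ex q (Conj (bin_atom r p q) (Exs (others p q) (Neg (pad_atom b))))))"
    "is_suf2 (Ex p (Ex q (Conj (Neg (bin_atom r p q)) (Exs (others p q) (pad_atom b)))))"
    by (intro is_suf2_Ex2; simp)+
  then show ?thesis by (simp add: pad_def fields del: is_suf2.simps(6))
qed

lemma conjs_pad_atom: "is_matrix (conjs (map pad_atom bs)) \<and> (\<forall>\<alpha>\<in>skeleton_atoms (conjs (map pad_atom bs)). fv \<alpha> = {..<9}) \<and>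
    fv (conjs (map pad_atom bs)) \<subseteq> {..<9}"
  by (induction bs) (auto simp: conjs_def)

lemma is_suf2_clause_fm: "is_suf2 (clause_fm c)"
proof -
  let ?\<phi> = "Conj (conjs (map pad_atom (fst c))) (Neg (pad_atom (snd c)))"
  have "is_body ?\<phi>" by (rule is_body_pad_atom) (use conjs_pad_atom[of "fst c"] in auto)
  moreover have "[0..<9] = 0 # [1..<9]" by (simp add: upt_conv_Cons)
  moreover have "fv ?\<phi> \<subseteq> {..<9}" using conjs_pad_atom[of "fst c"] by simp
  then have "fv ?\<phi> - set [0..<9] = {}" by auto
  ultimately have "is_suf2 (Exs [0..<9] ?\<phi>)"
    by (metis is_suf2_Exs at_most_two_def empty_subsetI)
  moreover have "is_suf2 (conjs (map pad (snd c # fst c)))"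
    by (rule is_suf2_conjs) (auto simp: is_suf2_pad)
  ultimately show ?thesis unfolding clause_fm_def by simp
qed

lemma is_suf2_pair_fm: "is_suf2 pair_fm"
proof -
  let ?\<phi> = "Conj (pad_atom (Graph HeadT, 2, 0)) (pad_atom (Graph TailT, 2, 1))"
  have "is_suf2 (Exs (others 0 1) ?\<phi>)" "fv (Exs (others 0 1) ?\<phi>) \<subseteq> {0, 1}"
    by (rule is_suf2_Exs_others; auto)+
  then have "is_suf2 (Ex 0 (Ex 1 (Neg (Exs (others 0 1) ?\<phi>))))" by (intro is_suf2_Ex2) simp_all
  moreover have "is_suf2 (conjs (map pad [(Graph HeadT, 2, 0), (Graph TailT, 2, 1)]))"
    by (rule is_suf2_conjs) (auto simp: is_suf2_pad)
  ultimately show ?thesis by (simp add: pair_fm_def del: is_suf2.simps(6) list.map)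
qed

lemma reduction_fm_SUF2: "reduction_fm u n \<in> SUF2"
proof -
  have "is_suf2 (numeral_fm n)"
    by (induction n) (auto simp: numeral_fm_def numeral_0_fm_def numeral_Suc_fm_def at_most_one_def)
  moreover have "is_suf2 (query_fm u n)" by (auto simp: query_fm_def at_most_one_def)
  moreover have "is_suf2 (theory_fm u)"
    unfolding theory_fm_def
    by (rule is_suf2_conjs) (auto simp: is_suf2_clause_fm is_suf2_pair_fm zero_fm_def succ_fm_def at_most_one_def)
  ultimately show ?thesis by (simp add: SUF2_iff_is_suf2 reduction_fm_def)
qed

subsection \<open>Semantics\<close>

text \<open>
  Values outside the free variables are irrelevant, so the witness may be taken to be any assignment
  into the universe that agrees with the given one on the variables that remain free.
\<close>

lemma holds_Exs:
  assumes s: "range s \<subseteq> universe M"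
  shows "holds M s (Exs ys \<phi>) \<longleftrightarrow>
    (\<exists>t. range t \<subseteq> universe M \<and> (\<forall>z\<in>fv \<phi> - set ys. t z = s z) \<and> holds M t \<phi>)"
  using s
proof (induction ys arbitrary: s)
  case Nil
  show ?case
  proof
    assume "holds M s (Exs [] \<phi>)"
    then show "\<exists>t. range t \<subseteq> universe M \<and> (\<forall>z\<in>fv \<phi> - set []. t z = s z) \<and> holds M t \<phi>"
      using Nil by (intro exI[of _ s]) auto
  next
    assume "\<exists>t. range t \<subseteq> universe M \<and> (\<forall>z\<in>fv \<phi> - set []. t z = s z) \<and> holds M t \<phi>"
    then obtain t where "\<forall>z\<in>fv \<phi>. t z = s z" "holds M t \<phi>" by auto
    then show "holds M s (Exs [] \<phi>)" using holds_cong[of \<phi> t s M] by simp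
  qed
next
  case (Cons y ys)
  have IH: "holds M (s(y := d)) (Exs ys \<phi>) \<longleftrightarrow>
    (\<exists>t. range t \<subseteq> universe M \<and> (\<forall>z\<in>fv \<phi> - set ys. t z = (s(y := d)) z) \<and> holds M t \<phi>)"
    if "d \<in> universe M" for d
    by (rule Cons.IH) (use that Cons.prems in auto)
  show ?case
  proof
    assume "holds M s (Exs (y # ys) \<phi>)"
    then obtain d where d: "d \<in> universe M" "holds M (s(y := d)) (Exs ys \<phi>)" by auto
    then obtain t where "range t \<subseteq> universe M" "\<forall>z\<in>fv \<phi> - set ys. t z = (s(y := d)) z" "holds M t \<phi>"
      using IH by blast
    then show "\<exists>t. range t \<subseteq> universe M \<and> (\<forall>z\<in>fv \<phi> - set (y # ys). t z = s z) \<and> holds M t \<phi>"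
      by (intro exI[of _ t]) auto
  next
    assume "\<exists>t. range t \<subseteq> universe M \<and> (\<forall>z\<in>fv \<phi> - set (y # ys). t z = s z) \<and> holds M t \<phi>"
    then obtain t where t: "range t \<subseteq> universe M" "\<forall>z\<in>fv \<phi> - set (y # ys). t z = s z" "holds M t \<phi>"
      by blast
    then have "t y \<in> universe M" by blast
    moreover have "holds M (s(y := t y)) (Exs ys \<phi>)"
      unfolding IH[OF calculation] using t by (intro exI[of _ t]) auto
    ultimately show "holds M s (Exs (y # ys) \<phi>)" by auto
  qed
qed

lemma holds_conjs: "holds M s (conjs \<phi>s) \<longleftrightarrow> (\<forall>\<phi>\<in>set \<phi>s. holds M s \<phi>)"
  by (induction \<phi>s) (auto simp: conjs_def)

definition binterp :: "nat struct \<Rightarrow> interp" where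
  "binterp M r a b \<longleftrightarrow> [a, b] \<in> rel M (Rel 2 (to_nat r))"

lemma holds_bin_atom: "holds M s (bin_atom r p q) \<longleftrightarrow> binterp M r (s p) (s q)"
  by (simp add: bin_atom_def binterp_def)

text \<open>
  The 9-ary predicate of \<open>b\<close> has the intended meaning in \<open>M\<close>.
\<close>

definition padded :: "nat struct \<Rightarrow> batom \<Rightarrow> bool" where
  "padded M b \<longleftrightarrow> (\<forall>t. range t \<subseteq> universe M \<longrightarrow> (holds M t (pad_atom b) \<longleftrightarrow> batom_holds (binterp M) t b))"

lemma fv_pad_part: "good_batom (r, p, q) \<Longrightarrow> {..<9} - set (others p q) = {p, q}"
  by (auto simp: set_others good_batom_def)

lemma holds_pad_iff:
  assumes s: "range s \<subseteq> universe M" and b: "good_batom b"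
  shows "holds M s (pad b) \<longleftrightarrow> padded M b"
proof (cases b)
  case (fields r p q)
  have pq: "p \<noteq> q" "p < 9" "q < 9" using b by (auto simp: fields good_batom_def)
  have part: "holds M s (Ex p (Ex q (Conj \<chi> (Exs (others p q) \<phi>)))) \<longleftrightarrow>
      (\<exists>t. range t \<subseteq> universe M \<and> holds M t \<chi> \<and> holds M t \<phi>)"
    if fv: "fv \<chi> = {p, q}" "fv \<phi> = {..<9}" for \<chi> \<phi>
  proof
    assume "holds M s (Ex p (Ex q (Conj \<chi> (Exs (others p q) \<phi>))))"
    then obtain d e where d: "d \<in> universe M" "e \<in> universe M" and
      h: "holds M (s(p := d, q := e)) \<chi>" "holds M (s(p := d, q := e)) (Exs (others p q) \<phi>)" by auto
    have "range (s(p := d, q := e)) \<subseteq> universe M" using s d by auto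
    then obtain t where t: "range t \<subseteq> universe M" "\<forall>z\<in>{p, q}. t z = (s(p := d, q := e)) z" "holds M t \<phi>"
      using h(2) unfolding holds_Exs[OF \<open>range (s(p := d, q := e)) \<subseteq> universe M\<close>] fv
        fv_pad_part[OF b[unfolded fields]] by blast
    have "holds M t \<chi> \<longleftrightarrow> holds M (s(p := d, q := e)) \<chi>"
      by (rule holds_cong) (use t(2) fv in auto)
    with h(1) have "holds M t \<chi>" by simp
    then show "\<exists>t. range t \<subseteq> universe M \<and> holds M t \<chi> \<and> holds M t \<phi>" using t by blast
  next
    assume "\<exists>t. range t \<subseteq> universe M \<and> holds M t \<chi> \<and> holds M t \<phi>"
    then obtain t where t: "range t \<subseteq> universe M" "holds M t \<chi>" "holds M t \<phi>" by blast
    let ?s = "s(p := t p, q := t q)"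
    have "range ?s \<subseteq> universe M" using s t(1) by auto
    moreover have "\<forall>z\<in>{p, q}. t z = ?s z" using pq by auto
    ultimately have "holds M ?s (Exs (others p q) \<phi>)"
      unfolding holds_Exs[OF \<open>range ?s \<subseteq> universe M\<close>] fv fv_pad_part[OF b[unfolded fields]]
      using t by blast
    moreover have "holds M ?s \<chi> \<longleftrightarrow> holds M t \<chi>" by (rule holds_cong) (use pq fv in auto)
    with t(2) have "holds M ?s \<chi>" by simp
    moreover have "t p \<in> universe M" "t q \<in> universe M" using t(1) by auto
    ultimately show "holds M s (Ex p (Ex q (Conj \<chi> (Exs (others p q) \<phi>))))" by auto
  qed
  have "holds M s (pad b) \<longleftrightarrow>
    \<not> (\<exists>t. range t \<subseteq> universe M \<and> holds M t (bin_atom r p q) \<and> holds M t (Neg (pad_atom b))) \<and>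
    \<not> (\<exists>t. range t \<subseteq> universe M \<and> holds M t (Neg (bin_atom r p q)) \<and> holds M t (pad_atom b))"
    using part[of "bin_atom r p q" "Neg (pad_atom b)"] part[of "Neg (bin_atom r p q)" "pad_atom b"]
    by (simp add: pad_def fields del: holds.simps(6))
  then show ?thesis
    unfolding padded_def by (auto simp: holds_bin_atom batom_holds_def fields)
qed

lemma holds_clause_fm:
  assumes s: "range s \<subseteq> universe M" and c: "\<And>b. b \<in> insert (snd c) (set (fst c)) \<Longrightarrow> good_batom b"
  shows "holds M s (clause_fm c) \<longleftrightarrow>
    (\<forall>b\<in>insert (snd c) (set (fst c)). padded M b) \<and> clause_holds (universe M) (binterp M) c"
proof -
  let ?\<phi> = "Conj (conjs (map pad_atom (fst c))) (Neg (pad_atom (snd c)))"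
  have fv: "fv ?\<phi> - set [0..<9] = {}" using conjs_pad_atom[of "fst c"] by auto
  have "holds M s (Exs [0..<9] ?\<phi>) \<longleftrightarrow> (\<exists>t. range t \<subseteq> universe M \<and> holds M t ?\<phi>)"
    unfolding holds_Exs[OF s] fv by (simp only: ball_simps simp_thms)
  moreover have "holds M s (conjs (map pad (snd c # fst c))) \<longleftrightarrow>
      (\<forall>b\<in>insert (snd c) (set (fst c)). padded M b)"
    unfolding holds_conjs using holds_pad_iff[OF s c] by auto
  ultimately have "holds M s (clause_fm c) \<longleftrightarrow> (\<forall>b\<in>insert (snd c) (set (fst c)). padded M b) \<and>
      \<not> (\<exists>t. range t \<subseteq> universe M \<and> (\<forall>b\<in>set (fst c). holds M t (pad_atom b)) \<and> \<not> holds M t (pad_atom (snd c)))"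
    by (simp add: clause_fm_def holds_conjs)
  moreover have "(\<nexists>t. range t \<subseteq> universe M \<and> (\<forall>b\<in>set (fst c). holds M t (pad_atom b)) \<and> \<not> holds M t (pad_atom (snd c)))
      \<longleftrightarrow> clause_holds (universe M) (binterp M) c"
    if p: "\<forall>b\<in>insert (snd c) (set (fst c)). padded M b"
  proof -
    have "holds M t (pad_atom b) \<longleftrightarrow> batom_holds (binterp M) t b"
      if "range t \<subseteq> universe M" "b \<in> insert (snd c) (set (fst c))" for t b
      using p that unfolding padded_def by blast
    then have "range t \<subseteq> universe M \<and> (\<forall>b\<in>set (fst c). holds M t (pad_atom b)) \<and> \<not> holds M t (pad_atom (snd c))
      \<longleftrightarrow> range t \<subseteq> universe M \<and> (\<forall>b\<in>set (fst c). batom_holds (binterp M) t b) \<and>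
        \<not> batom_holds (binterp M) t (snd c)" for t
      by (simp cong: conj_cong)
    then show ?thesis unfolding clause_holds_def by (simp only:) blast
  qed
  ultimately show ?thesis by (simp cong: conj_cong)
qed

lemma holds_zero_fm:
  "holds M s zero_fm \<longleftrightarrow> (\<exists>z\<in>universe M. \<forall>x\<in>universe M. binterp M (Graph ZeroT) x z)"
  by (simp add: zero_fm_def holds_bin_atom)

lemma holds_succ_fm:
  "holds M s succ_fm \<longleftrightarrow> (\<forall>x\<in>universe M. \<exists>y\<in>universe M. binterp M (Graph SuccT) x y)"
  by (simp add: succ_fm_def holds_bin_atom)

lemma holds_pair_fm:
  assumes s: "range s \<subseteq> universe M"
  shows "holds M s pair_fm \<longleftrightarrow> padded M (Graph HeadT, 2, 0) \<and> padded M (Graph TailT, 2, 1) \<and>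
    (\<forall>a\<in>universe M. \<forall>b\<in>universe M. \<exists>c\<in>universe M. binterp M (Graph HeadT) c a \<and> binterp M (Graph TailT) c b)"
proof -
  let ?\<phi> = "Conj (pad_atom (Graph HeadT, 2, 0)) (pad_atom (Graph TailT, 2, 1))"
  have good: "good_batom (Graph HeadT, 2, 0)" "good_batom (Graph TailT, 2, 1)" by (simp_all add: good_batom_def)
  have ex: "holds M (s(0 := a, 1 := b)) (Exs (others 0 1) ?\<phi>) \<longleftrightarrow>
      (\<exists>c\<in>universe M. binterp M (Graph HeadT) c a \<and> binterp M (Graph TailT) c b)"
    if P: "padded M (Graph HeadT, 2, 0)" "padded M (Graph TailT, 2, 1)" and ab: "a \<in> universe M" "b \<in> universe M" for a b
  proof -
    have r: "range (s(0 := a, 1 := b)) \<subseteq> universe M" using s ab by auto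
    have fv: "fv ?\<phi> - set (others 0 1) = {0, 1}" by (auto simp: set_others)
    have "holds M (s(0 := a, 1 := b)) (Exs (others 0 1) ?\<phi>) \<longleftrightarrow>
      (\<exists>t :: nat \<Rightarrow> nat. range t \<subseteq> universe M \<and> t 0 = a \<and> t 1 = b \<and> holds M t ?\<phi>)"
      unfolding holds_Exs[OF r] fv by auto
    also have "\<dots> \<longleftrightarrow> (\<exists>t :: nat \<Rightarrow> nat. range t \<subseteq> universe M \<and> t 0 = a \<and> t 1 = b \<and>
        binterp M (Graph HeadT) (t 2) a \<and> binterp M (Graph TailT) (t 2) b)"
      using P unfolding padded_def batom_holds_def by auto
    also have "\<dots> \<longleftrightarrow> (\<exists>c\<in>universe M. binterp M (Graph HeadT) c a \<and> binterp M (Graph TailT) c b)"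
    proof
      assume "\<exists>c\<in>universe M. binterp M (Graph HeadT) c a \<and> binterp M (Graph TailT) c b"
      then obtain c where "c \<in> universe M" "binterp M (Graph HeadT) c a" "binterp M (Graph TailT) c b" by blast
      then show "\<exists>t :: nat \<Rightarrow> nat. range t \<subseteq> universe M \<and> t 0 = a \<and> t 1 = b \<and>
        binterp M (Graph HeadT) (t 2) a \<and> binterp M (Graph TailT) (t 2) b"
        using ab by (intro exI[of _ "\<lambda>z :: nat. if z = 0 then a else if z = 1 then b else c"]) auto
    qed blast
    finally show ?thesis .
  qed
  have "holds M s pair_fm \<longleftrightarrow> padded M (Graph HeadT, 2, 0) \<and> padded M (Graph TailT, 2, 1) \<and>
    (\<forall>a\<in>universe M. \<forall>b\<in>universe M. holds M (s(0 := a, 1 := b)) (Exs (others 0 1) ?\<phi>))"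
    unfolding pair_fm_def using holds_pad_iff[OF s good(1)] holds_pad_iff[OF s good(2)]
    by (simp add: holds_conjs)
  then show ?thesis using ex by auto
qed

lemma holds_theory_fm:
  assumes M: "is_structure M" and s: "range s \<subseteq> universe M"
  shows "holds M s (theory_fm u) \<longleftrightarrow> base_model (universe M) (binterp M) \<and>
    padded M (Graph HeadT, 2, 0) \<and> padded M (Graph TailT, 2, 1) \<and>
    (\<forall>c\<in>insert (goal_clause u) (set (clauses_of u)).
      (\<forall>b\<in>insert (snd c) (set (fst c)). padded M b) \<and> clause_holds (universe M) (binterp M) c)"
proof -
  have dom: "a \<in> universe M \<and> b \<in> universe M" if "binterp M r a b" for r a b
  proof -
    have "Rel 2 (to_nat r) \<in> full_vocab" by (simp add: full_vocab_def)
    then show ?thesis using M that unfolding is_structure_def binterp_def by fastforce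
  qed
  have clauses: "holds M s (clause_fm c) \<longleftrightarrow> (\<forall>b\<in>insert (snd c) (set (fst c)). padded M b) \<and>
      clause_holds (universe M) (binterp M) c" if "c \<in> insert (goal_clause u) (set (clauses_of u))" for c
    by (rule holds_clause_fm[OF s]) (use that good_clauses_of good_goal_clause in blast)
  have model: "base_model (universe M) (binterp M) \<longleftrightarrow>
    (\<exists>z\<in>universe M. \<forall>x\<in>universe M. binterp M (Graph ZeroT) x z) \<and>
    (\<forall>x\<in>universe M. \<exists>y\<in>universe M. binterp M (Graph SuccT) x y) \<and>
    (\<forall>a\<in>universe M. \<forall>b\<in>universe M. \<exists>c\<in>universe M. binterp M (Graph HeadT) c a \<and> binterp M (Graph TailT) c b)"
    unfolding base_model_def using dom by blast
  have thy: "holds M s (theory_fm u) \<longleftrightarrow> holds M s zero_fm \<and> holds M s succ_fm \<and>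
      holds M s pair_fm \<and> (\<forall>c\<in>insert (goal_clause u) (set (clauses_of u)). holds M s (clause_fm c))"
    unfolding theory_fm_def holds_conjs by auto
  have "(\<forall>c\<in>insert (goal_clause u) (set (clauses_of u)). holds M s (clause_fm c)) \<longleftrightarrow>
      (\<forall>c\<in>insert (goal_clause u) (set (clauses_of u)).
        (\<forall>b\<in>insert (snd c) (set (fst c)). padded M b) \<and> clause_holds (universe M) (binterp M) c)"
    by (rule ball_cong[OF refl clauses])
  then show ?thesis
    unfolding thy model holds_zero_fm holds_succ_fm holds_pair_fm[OF s]
    by (simp only: conj_ac)
qed

lemma holds_numeral_fm:
  "holds M s (numeral_fm n) \<longleftrightarrow>
    (\<forall>x\<in>universe M. (\<forall>w\<in>universe M. binterp M (Graph ZeroT) w x) \<longrightarrow> [x] \<in> rel M (Rel 1 0)) \<and>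
    (\<forall>i<n. \<forall>x\<in>universe M. \<forall>y\<in>universe M.
      [x] \<in> rel M (Rel 1 i) \<longrightarrow> binterp M (Graph SuccT) x y \<longrightarrow> [y] \<in> rel M (Rel 1 (Suc i)))"
proof (induction n)
  case 0
  show ?case by (auto simp: numeral_fm_def numeral_0_fm_def holds_bin_atom num_atom_def)
next
  case (Suc n)
  have "holds M s (numeral_Suc_fm i) \<longleftrightarrow> (\<forall>x\<in>universe M. \<forall>y\<in>universe M.
      [x] \<in> rel M (Rel 1 i) \<longrightarrow> binterp M (Graph SuccT) x y \<longrightarrow> [y] \<in> rel M (Rel 1 (Suc i)))" for i
    by (auto simp: numeral_Suc_fm_def holds_bin_atom num_atom_def)
  moreover have "holds M s (numeral_fm (Suc n)) \<longleftrightarrow> holds M s (numeral_fm n) \<and> holds M s (numeral_Suc_fm n)"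
    by (simp add: numeral_fm_def)
  ultimately show ?case using Suc by (auto simp: less_Suc_eq)
qed

lemma holds_query_fm:
  "holds M s (query_fm u n) \<longleftrightarrow>
    (\<forall>x\<in>universe M. \<forall>y\<in>universe M. [x] \<in> rel M (Rel 1 n) \<longrightarrow> \<not> binterp M (ZeroAt u) x y)"
  by (auto simp: query_fm_def holds_bin_atom num_atom_def)

text \<open>
  The unary predicates are singletons of numerals; all predicates of arity other than 1 and 2 may be read
  as padded ones, as only the arity 9 occurs.
\<close>

definition standard_model :: "nat struct" where
  "standard_model = \<lparr>universe = UNIV, rel = (\<lambda>R. case R of Rel k i \<Rightarrow>
    if k = 1 then {[i]}
    else if k = 2 then {[a, b] | a b. std_interp (from_nat i) a b}
    else {as. length as = k \<and> (case from_nat i of (r, p, q) \<Rightarrow> std_interp r (as ! p) (as ! q))})\<rparr>"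

lemma standard_model_structure: "is_structure standard_model"
  unfolding is_structure_def standard_model_def by (auto split: rsym.splits if_splits)

lemma binterp_standard: "binterp standard_model = std_interp"
  by (intro ext) (simp add: binterp_def standard_model_def)

lemma padded_standard: "good_batom b \<Longrightarrow> padded standard_model b"
proof (cases b)
  case (fields r p q)
  assume "good_batom b"
  then have "p < 9" "q < 9" by (auto simp: fields good_batom_def)
  then have "holds standard_model t (pad_atom b) \<longleftrightarrow> std_interp r (t p) (t q)" for t
    by (simp add: pad_atom_def standard_model_def fields)
  then show ?thesis
    unfolding padded_def by (simp add: batom_holds_def binterp_standard fields)
qed

lemma base_model_std_interp: "base_model UNIV std_interp"
  unfolding base_model_def
proof (intro conjI ballI)
  fix a b x :: nat
  show "\<exists>c. std_interp (Graph HeadT) c a \<and> std_interp (Graph TailT) c b" by (intro exI[of _ "pair a b"]) simp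
  show "\<exists>y. std_interp (Graph SuccT) x y" by (intro exI[of _ "Suc x"]) simp
  show "\<exists>z\<in>UNIV. \<forall>x\<in>UNIV. std_interp (Graph ZeroT) x z" by simp
qed simp

lemma reduction_fm_satisfiable_if:
  assumes "\<And>y c. sem u (pair n (pair y c)) \<noteq> 0"
  shows "satisfiable TYPE(nat) (reduction_fm u n)"
proof -
  have u: "universe standard_model = UNIV" by (simp add: standard_model_def)
  have s: "range id \<subseteq> universe standard_model" by (simp add: u)
  have "holds standard_model id (theory_fm u)"
    unfolding holds_theory_fm[OF standard_model_structure s] u binterp_standard
  proof (intro conjI ballI)
    show "padded standard_model (Graph HeadT, 2, 0)" "padded standard_model (Graph TailT, 2, 1)"
      by (rule padded_standard, simp add: good_batom_def)+
  next
    fix c b assume "c \<in> insert (goal_clause u) (set (clauses_of u))" "b \<in> insert (snd c) (set (fst c))"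
    then show "padded standard_model b"
      using good_clauses_of good_goal_clause padded_standard by blast
  next
    fix c assume "c \<in> insert (goal_clause u) (set (clauses_of u))"
    then show "clause_holds UNIV std_interp c" using std_interp_clauses std_interp_goal_clause by blast
  qed (rule base_model_std_interp)
  moreover have "holds standard_model id (numeral_fm n)"
    unfolding holds_numeral_fm u binterp_standard by (auto simp: standard_model_def)
  moreover have "holds standard_model id (query_fm u n)"
    unfolding holds_query_fm u binterp_standard using assms by (auto simp: standard_model_def)
  ultimately show ?thesis
    unfolding satisfiable_def reduction_fm_def using standard_model_structure s by auto
qed

text \<open>
  If \<open>g [n, y]\<close> vanished, then the clauses would derive this in the given model for a representative \<open>a\<close>
  of \<open>n\<close>, against the last conjunct of the formula.
\<close>

lemma nonzero_if_reduction_fm_satisfiable: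
  assumes "satisfiable TYPE(nat) (reduction_fm u n)" and u: "represents u 2 g"
  shows "g [n, y] \<noteq> 0"
proof
  assume zero: "g [n, y] = 0"
  obtain M :: "nat struct" and s where M: "is_structure M" and s: "range s \<subseteq> universe M"
    and h: "holds M s (theory_fm u)" "holds M s (numeral_fm n)" "holds M s (query_fm u n)"
    using assms(1) unfolding satisfiable_def reduction_fm_def by auto
  let ?U = "universe M" and ?J = "binterp M"
  have base: "base_model ?U ?J" and cl: "\<forall>c\<in>insert (goal_clause u) (set (clauses_of u)). clause_holds ?U ?J c"
    using h(1) unfolding holds_theory_fm[OF M s] by blast+
  have num: "[d] \<in> rel M (Rel 1 i)" if "rep_num ?U ?J i d" "i \<le> n" for i d
    using that
  proof (induction i arbitrary: d)
    case 0
    then show ?case using h(2) unfolding holds_numeral_fm by simp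
  next
    case (Suc i)
    then obtain d' where d': "rep_num ?U ?J i d'" "?J (Graph SuccT) d' d" by auto
    then have "[d'] \<in> rel M (Rel 1 i)" using Suc by simp
    then show ?case
      using d'(2) dom[OF base d'(2)] h(2) Suc.prems(2) unfolding holds_numeral_fm by simp
  qed
  obtain l where "rep_list ?U ?J 2 (pair n (pair y 0)) l" using ex_rep_list[OF base] by blast
  moreover from this obtain a l' b where l: "?J (Graph HeadT) l a" "?J (Graph TailT) l l'" "rep_num ?U ?J n a" "?J (Graph HeadT) l' b"
    by (auto simp: numeral_2_eq_2)
  moreover have "sound_num ?U ?J 2 u" using u base cl unfolding represents_def by blast
  ultimately obtain v where v: "?J (Graph u) l v" "rep_num ?U ?J (sem u (pair n (pair y 0))) v"
    unfolding sound_num_def by blast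
  have "sem u (pair n (pair y 0)) = 0"
    using u zero unfolding represents_def by (simp add: numeral_2_eq_2)
  then have "?J (Graph ZeroT) a v" using v(2) dom[OF base l(1)] by simp
  moreover have "set [a, l, l', b, v] \<subseteq> ?U"
    using dom[OF base l(1)] dom[OF base l(4)] dom[OF base v(1)] by simp
  ultimately have "?J (ZeroAt u) a b"
    using clauseD[OF base, of "fst (goal_clause u)" "ZeroAt u" 0 3 "[a, l, l', b, v]"] cl l v
    by (simp add: goal_clause_def)
  moreover have "[a] \<in> rel M (Rel 1 n)" using num[OF l(3)] by simp
  ultimately show False
    using h(3) dom[OF base \<open>?J (ZeroAt u) a b\<close>] unfolding holds_query_fm by blast
qed

lemma computable_reduction: "computable (\<lambda>n. fm_encode (reduction_fm u n))"
proof -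
  have num: "fm_encode (numeral_fm n) =
    rec_nat (fm_encode numeral_0_fm) (\<lambda>i v. pair 4 (pair v (fm_encode (numeral_Suc_fm i)))) n" for n
    by (induction n) (simp_all add: numeral_fm_def pair_def)
  have unary: "fm_encode (num_atom i y) = pair 2 (pair (pair 1 i) (list_encode [y]))" for i y
    by (simp add: num_atom_def pair_def)
  have Suc: "fm_encode (numeral_Suc_fm i) = pair 3 (pair 5 (pair 0 (pair 5 (pair 1 (pair 4 (pair
      (pair 4 (pair (fm_encode (num_atom i 0)) (fm_encode (bin_atom (Graph SuccT) 0 1))))
      (pair 3 (fm_encode (num_atom (Suc i) 1)))))))))" for i
    by (simp add: numeral_Suc_fm_def pair_def)
  have query: "fm_encode (query_fm u n) = pair 3 (pair 5 (pair 0 (pair 5 (pair 1 (pair 4 (pair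
      (fm_encode (num_atom n 0)) (fm_encode (bin_atom (ZeroAt u) 0 1))))))))" for n
    by (simp add: query_fm_def pair_def)
  have "fm_encode (reduction_fm u n) = pair 4 (pair (fm_encode (theory_fm u))
      (pair 4 (pair (fm_encode (numeral_fm n)) (fm_encode (query_fm u n)))))" for n
    by (simp add: reduction_fm_def pair_def)
  then show ?thesis
    unfolding num Suc query unary by (simp only:) (intro computable_intros)
qed

lemma Pi01_reducible:
  assumes inf: "infinite (UNIV :: 'a set)" and B: "Pi01 B"
  shows "B \<le>\<^sub>m SUF2_SAT TYPE('a)"
proof -
  obtain R where "decidable_rel R" and B: "B = {x. \<forall>y. R x y}"
    using B unfolding Pi01_def by blast
  then obtain g where "recursive 2 g" and g: "\<And>x y. g [x, y] = (if R x y then 1 else 0)"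
    unfolding decidable_rel_def by blast
  then obtain u where u: "represents u 2 g" using ex_represents by blast
  have sem: "sem u (pair x (pair y c)) = g [x, y]" for x y c
    using u unfolding represents_def by (simp add: numeral_2_eq_2)
  have "x \<in> B \<longleftrightarrow> satisfiable TYPE(nat) (reduction_fm u x)" for x
  proof
    assume "x \<in> B"
    then show "satisfiable TYPE(nat) (reduction_fm u x)"
      by (intro reduction_fm_satisfiable_if) (simp add: sem g B)
  next
    assume sat: "satisfiable TYPE(nat) (reduction_fm u x)"
    have "R x y" for y
      using nonzero_if_reduction_fm_satisfiable[OF sat u, of y] g[of x y] by (cases "R x y") auto
    then show "x \<in> B" unfolding B by blast
  qed
  moreover have "satisfiable TYPE(nat) \<phi> \<longleftrightarrow> satisfiable TYPE('a) \<phi>" for \<phi>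
    by (intro iffI) (erule satisfiable_transfer[OF infinite_UNIV_nat] satisfiable_transfer[OF inf])+
  ultimately have "x \<in> B \<longleftrightarrow> fm_encode (reduction_fm u x) \<in> SUF2_SAT TYPE('a)" for x
    unfolding SUF2_SAT_def inj_image_mem_iff[OF inj_fm_encode] using reduction_fm_SUF2 by simp
  then show ?thesis unfolding many_one_reducible_def using computable_reduction[of u] by blast
qed

theorem theoremC3:
  assumes "infinite (UNIV :: 'a set)"
  shows "Pi01_complete (SUF2_SAT TYPE('a))"
  unfolding Pi01_complete_def using Pi01_SUF2_SAT[OF assms] Pi01_reducible[OF assms] by blast

end
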